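(* Let $\Omega\subset\mathbb{R}^2$ be an open and bounded domain. Let $v_0\in\mathcal{C}^1(\bar\Omega)$, $w_0\in\mathcal{C}^1(\bar\Omega,\mathbb{R}^2)$ and $A_0\in\mathcal{C}^{0,\beta}(\bar\Omega,\mathbb{R}^{2\times2}_{sym})$, for some $\beta\in(0,1)$, be such that $$\exists c_0>0\qquad A_0-\Big(\frac12\nabla v_0\otimes\nabla v_0+\mathrm{sym}\,\nabla w_0\Big)>c_0\,\mathrm{Id}_2\quad\text{in }\bar\Omega .$$ Then, for every exponent $\alpha$ in the range $0<\alpha<\min\{\frac17,\frac\beta2\}$, there exist sequences $v_n\in\mathcal{C}^{1,\alpha}(\bar\Omega)$ and $w_n\in\mathcal{C}^{1,\alpha}(\bar\Omega,\mathbb{R}^2)$ which converge uniformly to $v_0$ and $w_0$, respectively, and which satisfy, for every $n$, $$A_0=\frac12\nabla v_n\otimes\nabla v_n+\mathrm{sym}\,\nabla w_n\quad\text{in }\bar\Omega .$$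
   Context: $\mathbb{R}^{2\times2}_{sym}$ denotes the space of symmetric $2\times2$ matrices; $\mathrm{sym}\,M=\frac12(M+M^T)$; for symmetric matrices, $A>B$ means that $A-B$ is positive definite (here at every point of $\bar\Omega$). The space $\mathcal{C}^{k,\alpha}(\bar\Omega)$ (and likewise $\mathcal{C}^k(\bar\Omega)$) consists of restrictions to $\Omega$ of functions in $\mathcal{C}^{k,\alpha}(\mathbb{R}^2)$ (respectively $\mathcal{C}^k(\mathbb{R}^2)$). *)

theory Defs
  imports "HOL-Analysis.Analysis"
begin

text \<open>
  Functions on the closed set \<open>closure \<Omega>\<close> are modelled by total functions on the whole space whose
  values off \<open>closure \<Omega>\<close> are irrelevant.
\<close>

section \<open>Function spaces\<close>

primrec Ck :: "nat \<Rightarrow> ('a::euclidean_space \<Rightarrow> 'b::real_normed_vector) set" where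
  "Ck 0 = {f. continuous_on UNIV f}"
| "Ck (Suc k) = {f. (\<forall>x. f differentiable (at x)) \<and>
      (\<forall>e\<in>Basis. (\<lambda>x. frechet_derivative f (at x) e) \<in> Ck k)}"

text \<open>
  \<open>Ckh k \<alpha>\<close> is the space of \<open>k\<close> times differentiable functions with finite Hoelder norm: all
  partial derivatives of order at most \<open>k\<close> are bounded and those of order \<open>k\<close> are
  \<open>\<alpha>\<close>-Hoelder continuous on the whole space.
\<close>

primrec Ckh :: "nat \<Rightarrow> real \<Rightarrow> ('a::euclidean_space \<Rightarrow> 'b::real_normed_vector) set" where
  "Ckh 0 \<alpha> = {f. bounded (range f) \<and>
      (\<exists>C. \<forall>x y. norm (f x - f y) \<le> C * dist x y powr \<alpha>)}"
| "Ckh (Suc k) \<alpha> = {f. bounded (range f) \<and> (\<forall>x. f differentiable (at x)) \<and>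
      (\<forall>e\<in>Basis. (\<lambda>x. frechet_derivative f (at x) e) \<in> Ckh k \<alpha>)}"

definition restrictions ::
    "'a::topological_space set \<Rightarrow> ('a \<Rightarrow> 'b) set \<Rightarrow> ('a \<Rightarrow> 'b) set" where
  "restrictions \<Omega> X = {f. \<exists>F\<in>X. \<forall>x\<in>closure \<Omega>. f x = F x}"

abbreviation Ck_bar ::
    "nat \<Rightarrow> 'a::euclidean_space set \<Rightarrow> ('a \<Rightarrow> 'b::real_normed_vector) set" where
  "Ck_bar k \<Omega> \<equiv> restrictions \<Omega> (Ck k)"

abbreviation Ckh_bar ::
    "nat \<Rightarrow> real \<Rightarrow> 'a::euclidean_space set \<Rightarrow> ('a \<Rightarrow> 'b::real_normed_vector) set" where
  "Ckh_bar k \<alpha> \<Omega> \<equiv> restrictions \<Omega> (Ckh k \<alpha>)"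

section \<open>Derivatives up to the boundary\<close>

definition gradient :: "(real^'n \<Rightarrow> real) \<Rightarrow> real^'n \<Rightarrow> real^'n" where
  "gradient f x = (\<chi> i. frechet_derivative f (at x) (axis i 1))"

text \<open>
  A derivative at a boundary point is the limit of the derivatives at interior points; by the
  lemmas below it agrees with the derivative of any \<open>C\<^sup>1\<close> extension.
\<close>

definition gradient_bar :: "(real^'n) set \<Rightarrow> (real^'n \<Rightarrow> real) \<Rightarrow> real^'n \<Rightarrow> real^'n" where
  "gradient_bar \<Omega> f x = Lim (at x within \<Omega>) (gradient f)"

definition jacobian_bar :: "(real^'n) set \<Rightarrow> (real^'n \<Rightarrow> real^'m) \<Rightarrow> real^'n \<Rightarrow> real^'n^'m" where
  "jacobian_bar \<Omega> f x = Lim (at x within \<Omega>) (\<lambda>y. jacobian f (at y))"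

lemma at_within_open_nontrivial:
  fixes \<Omega> :: "'a::euclidean_space set"
  assumes "open \<Omega>" "x \<in> closure \<Omega>"
  shows "at x within \<Omega> \<noteq> bot"
proof -
  have "x islimpt \<Omega>"
    using assms interior_limit_point[of x \<Omega>] by (auto simp: closure_def interior_open)
  then show ?thesis
    by (metis trivial_limit_within)
qed

lemma frechet_derivative_cong_open:
  assumes "open S" "y \<in> S" "\<And>z. z \<in> S \<Longrightarrow> f z = g z"
  shows "frechet_derivative f (at y) = frechet_derivative g (at y)"
proof -
  have "(f has_derivative D) (at y) \<longleftrightarrow> (g has_derivative D) (at y)" for D
    by (rule iffI; erule has_derivative_transform_within_open[OF _ assms(1,2)]; simp add: assms(3))
  then show ?thesis
    by (simp add: frechet_derivative_def)
qed

lemma gradient_bar_extension: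
  assumes "open \<Omega>" "x \<in> closure \<Omega>" "F \<in> Ck 1" "\<forall>z\<in>closure \<Omega>. f z = F z"
  shows "gradient_bar \<Omega> f x = gradient F x"
proof -
  have "continuous_on UNIV (gradient F)"
    unfolding gradient_def[abs_def] using assms(3)
    by (intro continuous_on_vec_lambda) (auto simp: axis_in_Basis_iff)
  then have lim: "(gradient F \<longlongrightarrow> gradient F x) (at x within \<Omega>)"
    by - (rule tendsto_within_subset[OF _ subset_UNIV], simp add: continuous_on_def)
  have "gradient f y = gradient F y" if "y \<in> \<Omega>" for y
    using frechet_derivative_cong_open[of \<Omega> y f F] assms(1,4) that closure_subset[of \<Omega>]
    by (simp add: gradient_def subset_iff)
  then have "eventually (\<lambda>y. gradient F y = gradient f y) (at x within \<Omega>)"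
    by (simp add: eventually_at_filter)
  then have "(gradient f \<longlongrightarrow> gradient F x) (at x within \<Omega>)"
    using lim by (rule Lim_transform_eventually[rotated])
  then show ?thesis
    unfolding gradient_bar_def
    by (intro tendsto_Lim at_within_open_nontrivial assms)
qed

lemma jacobian_bar_extension:
  assumes "open \<Omega>" "x \<in> closure \<Omega>" "F \<in> Ck 1" "\<forall>z\<in>closure \<Omega>. f z = F z"
  shows "jacobian_bar \<Omega> f x = jacobian F (at x)"
proof -
  have "continuous_on UNIV (\<lambda>y. jacobian F (at y))"
    unfolding jacobian_def matrix_def using assms(3)
    by (intro continuous_on_vec_lambda continuous_on_component) (auto simp: axis_in_Basis_iff)
  then have lim: "((\<lambda>y. jacobian F (at y)) \<longlongrightarrow> jacobian F (at x)) (at x within \<Omega>)"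
    by - (rule tendsto_within_subset[OF _ subset_UNIV], simp add: continuous_on_def)
  have "jacobian f (at y) = jacobian F (at y)" if "y \<in> \<Omega>" for y
    using frechet_derivative_cong_open[of \<Omega> y f F] assms(1,4) that closure_subset[of \<Omega>]
    by (simp add: jacobian_def subset_iff)
  then have "eventually (\<lambda>y. jacobian F (at y) = jacobian f (at y)) (at x within \<Omega>)"
    by (simp add: eventually_at_filter)
  then have "((\<lambda>y. jacobian f (at y)) \<longlongrightarrow> jacobian F (at x)) (at x within \<Omega>)"
    using lim by (rule Lim_transform_eventually[rotated])
  then show ?thesis
    unfolding jacobian_bar_def
    by (intro tendsto_Lim at_within_open_nontrivial assms)
qed

section \<open>Matrices\<close>

definition sym_matrix :: "real^'n^'n \<Rightarrow> bool" where
  "sym_matrix M \<longleftrightarrow> transpose M = M"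

definition sym_part :: "real^'n^'n \<Rightarrow> real^'n^'n" where
  "sym_part M = (1/2) *\<^sub>R (M + transpose M)"

definition tensor :: "real^'m \<Rightarrow> real^'n \<Rightarrow> real^'n^'m" (infixl \<open>\<otimes>\<^sub>v\<close> 75) where
  "a \<otimes>\<^sub>v b = (\<chi> i j. a $ i * b $ j)"

definition pos_definite :: "real^'n^'n \<Rightarrow> bool" where
  "pos_definite M \<longleftrightarrow> sym_matrix M \<and> (\<forall>x. x \<noteq> 0 \<longrightarrow> x \<bullet> (M *v x) > 0)"

text \<open>\<open>A > B\<close> in the sense of symmetric matrices.\<close>

definition matrix_gt :: "real^'n^'n \<Rightarrow> real^'n^'n \<Rightarrow> bool" (infix \<open>\<succ>\<close> 50) where
  "A \<succ> B \<longleftrightarrow> pos_definite (A - B)"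

end

theory Submission
  imports Defs
begin

text \<open>
  Convex integration in the manner of Nash and Kuiper, with the Hoelder bookkeeping of Conti, De Lellis
  and Szekelyhidi. Adding \<open>(2 a / \<lambda>) sin (\<lambda> z \<bullet> x)\<close> to \<open>v\<close>, with a matching oscillation in \<open>w\<close>,
  changes \<open>(1/2) \<nabla>v \<otimes> \<nabla>v + sym \<nabla>w\<close> by \<open>a\<^sup>2 z \<otimes> z\<close> up to \<open>O(1/\<lambda>)\<close>; the error involves second
  derivatives of \<open>v\<close> but none of \<open>w\<close>. A stage mollifies at scale \<open>l\<close>, so that the defect, close to
  \<open>\<delta> Id\<close>, varies at scale \<open>l\<close>, and writes it as three such terms. With frequencies growing by a factor
  of order \<open>K\<close> each time, starting from \<open>1/l\<close>, the defect drops to about \<open>(\<delta>/K) Id\<close> while second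
  derivatives become of order \<open>K\<^sup>3 \<delta>\<^sup>1\<^sup>/\<^sup>2 / l\<close>. Iterating with \<open>\<delta>\<close> proportional to \<open>K\<^sup>-\<^sup>n\<close> and \<open>l\<close> to
  \<open>K\<close> to the power \<open>-\<rho> n\<close> is possible if \<open>\<rho> > 7/2\<close> (three frequencies) and \<open>\<rho> > 1/\<beta>\<close> (mollification
  error of the target), and interpolation gives \<open>C\<^sup>1\<^sup>,\<^sup>\<alpha>\<close> convergence when \<open>2 \<alpha> \<rho> < 1\<close>.

  Boundary effects are avoided by solving on the whole plane: adding a large multiple of
  the truncated distance to the closed domain times the identity makes the data strictly short everywhere.
\<close>

section \<open>Functions bounded at a given scale\<close>

text \<open>The obstacle is a loss of derivatives: the error of a corrugation contains second
  derivatives of \<open>v\<close>, which every stage makes larger. The exponent 7/2 is the balance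
  of this loss. If \<open>M\<close> bounds the second derivatives, mollification at scale
  \<open>l\<close> is harmless while \<open>l M\<close> stays below a small multiple of
  \<delta>^(1/2). One stage makes \<open>M\<close> of order K^3 \<delta>^(1/2) / l, whereas
  \<open>l\<close> shrinks by the factor K^-\<rho> and \<delta>^(1/2) by K^(-1/2); so the condition
  reproduces itself when 3 - \<rho> < -1/2. The 3 is the dimension of the symmetric matrices, one
  frequency per rank-one term. The slack in \<rho> > 7/2 allows a fixed large \<open>K\<close>,
  since the power \<rho> - 7/2 of \<open>K\<close> absorbs all constants. A stage treats only
  defects near a multiple of the identity, because three fixed directions with positive coefficients
  cover just a cone around it. The given defect is an arbitrary positive definite field, so an
  initial stage with many directions brings it near \<delta> Id; it happens once, hence its
  frequencies may be as large as the data require.\<close>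

definition dd :: "2 \<Rightarrow> (real^2 \<Rightarrow> real) \<Rightarrow> real^2 \<Rightarrow> real" where
  "dd i f x = frechet_derivative f (at x) (axis i 1)"

lemma dd_eqI: "(f has_derivative f') (at x) \<Longrightarrow> dd i f x = f' (axis i 1)"
  unfolding dd_def by (metis frechet_derivative_at)

lemma vec2_expand: "(h::real^2) = h$1 *\<^sub>R axis 1 1 + h$2 *\<^sub>R axis 2 1"
  by (simp add: vec_eq_iff forall_2 axis_def)

lemma has_derivative_dd:
  assumes "f differentiable (at x)"
  shows "(f has_derivative (\<lambda>h. dd 1 f x * h$1 + dd 2 f x * h$2)) (at x)"
proof -
  have d: "(f has_derivative frechet_derivative f (at x)) (at x)"
    using assms frechet_derivative_works by blast
  interpret linear "frechet_derivative f (at x)"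
    using d has_derivative_linear by blast
  have "frechet_derivative f (at x) h = dd 1 f x * h$1 + dd 2 f x * h$2" for h
    by (subst vec2_expand[of h]) (simp add: add scale dd_def)
  then have "frechet_derivative f (at x) = (\<lambda>h. dd 1 f x * h$1 + dd 2 f x * h$2)"
    by auto
  with d show ?thesis by simp
qed

lemma dd_cong_open:
  assumes "open S" "y \<in> S" "\<And>z. z \<in> S \<Longrightarrow> f z = g z"
  shows "dd i f y = dd i g y"
  using frechet_derivative_cong_open[OF assms] by (simp add: dd_def)

lemma dd_add:
  assumes "f differentiable (at x)" "g differentiable (at x)"
  shows "dd i (\<lambda>x. f x + g x) x = dd i f x + dd i g x"
  using dd_eqI[OF has_derivative_add[OF assms[unfolded frechet_derivative_works]]]
  by (simp add: dd_def)

lemma dd_mult: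
  assumes "f differentiable (at x)" "g differentiable (at x)"
  shows "dd i (\<lambda>x. f x * g x) x = f x * dd i g x + dd i f x * g x"
  using dd_eqI[OF has_derivative_mult[OF assms[unfolded frechet_derivative_works]]]
  by (simp add: dd_def)

lemma dd_const [simp]: "dd i (\<lambda>x. c) x = 0"
  by (simp add: dd_def)

lemma dd_cmult:
  assumes "f differentiable (at x)"
  shows "dd i (\<lambda>x. c * f x) x = c * dd i f x"
  using dd_mult[of "\<lambda>x. c" x f i] assms by simp

lemma dd_chain:
  assumes "f differentiable (at x)" "(h has_real_derivative h') (at (f x))"
  shows "(\<lambda>x. h (f x)) differentiable (at x)" "dd i (\<lambda>x. h (f x)) x = h' * dd i f x"
proof -
  have "((\<lambda>x. h (f x)) has_derivative (\<lambda>y. h' * frechet_derivative f (at x) y)) (at x)"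
    using has_derivative_compose[of f "frechet_derivative f (at x)" x UNIV h "\<lambda>y. h' * y"] assms
    by (simp add: has_field_derivative_def frechet_derivative_works)
  then show "(\<lambda>x. h (f x)) differentiable (at x)" "dd i (\<lambda>x. h (f x)) x = h' * dd i f x"
    using dd_eqI[of "\<lambda>x. h (f x)"] by (auto simp: differentiable_def dd_def)
qed

lemma dd_line:
  assumes "f differentiable (at (x + t *\<^sub>R axis i 1))"
  shows "((\<lambda>t. f (x + t *\<^sub>R axis i 1)) has_real_derivative dd i f (x + t *\<^sub>R axis i 1)) (at t)"
proof -
  have *: "((\<lambda>t. x + t *\<^sub>R axis i 1) has_derivative (\<lambda>t. t *\<^sub>R axis i 1)) (at t)"
    by (auto intro!: derivative_eq_intros)
  have "((\<lambda>t. f (x + t *\<^sub>R axis i 1)) has_derivative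
      (\<lambda>s. frechet_derivative f (at (x + t *\<^sub>R axis i 1)) (s *\<^sub>R axis i 1))) (at t)"
    using has_derivative_compose[OF *, of f] assms by (simp add: frechet_derivative_works)
  moreover have "frechet_derivative f (at (x + t *\<^sub>R axis i 1)) (s *\<^sub>R axis i 1) =
      dd i f (x + t *\<^sub>R axis i 1) * s" for s
    using linear_scale[OF linear_frechet_derivative[OF assms]] by (simp add: dd_def mult.commute)
  ultimately show ?thesis
    by (simp add: has_field_derivative_def)
qed

text \<open>Averages are differentiated along coordinate lines only; continuity of the partial
  derivatives turns this into total differentiability. A derivative at parameter 0 suffices, since
  \<open>x\<close> is arbitrary and lines can be shifted. \<open>E\<close> identifies the plane with
  a product of two lines, so that one variable can be treated at a time.\<close>

lemma C1_partialsI: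
  fixes f :: "real^2 \<Rightarrow> real"
  assumes der: "\<And>i x. ((\<lambda>t. f (x + t *\<^sub>R axis i 1)) has_real_derivative g i x) (at 0)"
    and cont: "\<And>i. continuous_on UNIV (g i)"
  shows "f differentiable (at x)" "dd i f x = g i x"
proof -
  define E where "E = (\<lambda>p::real\<times>real. fst p *\<^sub>R (axis 1 1::real^2) + snd p *\<^sub>R axis 2 1)"
  have der': "((\<lambda>t. f (y + t *\<^sub>R axis i 1)) has_real_derivative g i (y + t *\<^sub>R axis i 1)) (at t)" for i y t
    using DERIV_shift[of "\<lambda>s. f (y + s *\<^sub>R axis i 1)" "g i (y + t *\<^sub>R axis i 1)" 0 t]
      der[of "y + t *\<^sub>R axis i 1" i]
    by (simp add: algebra_simps)
  have EU: "E (s,t) = s *\<^sub>R axis 1 1 + t *\<^sub>R axis 2 1" for s t by (simp add: E_def)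
  have "((\<lambda>(s,t). f (E (s,t))) has_derivative
     (\<lambda>(tx, ty). g 1 (E (a,b)) * tx + blinfun_apply (blinfun_mult_right (g 2 (E (a,b)))) ty)) (at (a,b) within UNIV \<times> UNIV)" for a b
  proof (rule has_derivative_partialsI)
    show "((\<lambda>s. f (E (s,b))) has_derivative (\<lambda>tx. g 1 (E (a,b)) * tx)) (at a within UNIV)"
      using der'[of "b *\<^sub>R axis 2 1" 1 a] by (simp add: has_field_derivative_def EU add.commute)
    show "((\<lambda>t. f (E (s,t))) has_derivative blinfun_apply (blinfun_mult_right (g 2 (E (s,t))))) (at t within UNIV)" for s t
      using der'[of "s *\<^sub>R axis 1 1" 2 t] by (simp add: has_field_derivative_def EU)
    have "continuous_on UNIV (\<lambda>p. blinfun_mult_right (g 2 (E p)))"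
      unfolding E_def
      by (intro bounded_linear.continuous_on[OF bounded_linear_blinfun_mult_right] continuous_on_compose2[OF cont] continuous_intros) auto
    then show "continuous (at (a, b) within UNIV \<times> UNIV) (\<lambda>(x, y). blinfun_mult_right (g 2 (E (x, y))))"
      by (simp add: continuous_on_eq_continuous_at case_prod_beta')
  qed auto
  then have 1: "((\<lambda>p. f (E p)) has_derivative
     (\<lambda>h. g 1 (E p) * fst h + g 2 (E p) * snd h)) (at p)" for p
    by (cases p) (simp add: case_prod_beta')
  have 2: "((\<lambda>x::real^2. (x$1, x$2)) has_derivative (\<lambda>h. (h$1,h$2))) (at x)"
    by (intro bounded_linear_imp_has_derivative bounded_linear_Pair bounded_linear_vec_nth)
  have 3: "E (x$1, x$2) = x" for x using vec2_expand[of x] by (simp add: EU)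
  have 4: "(f has_derivative (\<lambda>h. g 1 x * h$1 + g 2 x * h$2)) (at x)"
    using has_derivative_compose[OF 2 1[of "(x$1,x$2)"]] by (simp add: 3)
  then show "f differentiable (at x)" by (auto simp: differentiable_def)
  show "dd i f x = g i x"
    unfolding dd_eqI[OF 4] using exhaust_2[of i] by (auto simp: axis_def)
qed

text \<open>\<open>s\<close> is an amplitude and \<open>L\<close> a frequency: a derivative of order
  \<open>j\<close> is at most \<open>s * L^j\<close>. Charging the same factor for every derivative
  makes the constants of products and powers independent of \<open>L\<close>. Continuity at the top
  order allows these functions to be averaged.\<close>

primrec bnd :: "nat \<Rightarrow> real \<Rightarrow> real \<Rightarrow> (real^2 \<Rightarrow> real) \<Rightarrow> bool" where
  "bnd 0 s L f \<longleftrightarrow> continuous_on UNIV f \<and> (\<forall>x. \<bar>f x\<bar> \<le> s)"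
| "bnd (Suc k) s L f \<longleftrightarrow> (\<forall>x. f differentiable (at x) \<and> \<bar>f x\<bar> \<le> s) \<and> (\<forall>i. bnd k (s * L) L (dd i f))"

lemma differentiable_imp_cont: "(\<And>x. f differentiable (at x)) \<Longrightarrow> continuous_on UNIV f"
  by (simp add: continuous_at_imp_continuous_on differentiable_imp_continuous_within)

lemma bnd_bound: "bnd k s L f \<Longrightarrow> \<bar>f x\<bar> \<le> s"
  by (cases k) auto

lemma bnd_nonneg: "bnd k s L f \<Longrightarrow> 0 \<le> s"
  using bnd_bound[of k s L f undefined] by linarith

lemma bnd_cont: "bnd k s L f \<Longrightarrow> continuous_on UNIV f"
  by (cases k) (auto intro: differentiable_imp_cont)

lemma bnd_diff: "bnd (Suc k) s L f \<Longrightarrow> f differentiable (at x)"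
  by auto

lemma bnd_dd: "bnd (Suc k) s L f \<Longrightarrow> bnd k (s * L) L (dd i f)"
  by auto

lemma bnd_mono: "bnd k s L f \<Longrightarrow> s \<le> s' \<Longrightarrow> 0 \<le> L \<Longrightarrow> L \<le> L' \<Longrightarrow> bnd k s' L' f"
proof (induction k arbitrary: s s' f)
  case 0 then show ?case by (auto intro: order_trans)
next
  case (Suc k)
  have "bnd k (s' * L') L' (dd i f)" for i
    using Suc.prems bnd_nonneg[OF Suc.prems(1)]
    by (intro Suc.IH[of "s * L"]) (auto intro!: mult_mono)
  then show ?case using Suc.prems by (auto intro: order_trans)
qed

lemma bnd_SucD: "bnd (Suc k) s L f \<Longrightarrow> bnd k s L f"
proof (induction k arbitrary: s f)
  case 0 then show ?case using differentiable_imp_cont[of f] by auto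
next
  case (Suc k)
  have "bnd k (s * L) L (dd i f)" for i
    using Suc.prems by (intro Suc.IH) (auto simp del: bnd.simps(1))
  then show ?case using Suc.prems by auto
qed

lemma bnd_le: "bnd k s L f \<Longrightarrow> j \<le> k \<Longrightarrow> bnd j s L f"
proof (induction k)
  case 0 then show ?case by auto
next
  case (Suc k)
  show ?case
  proof (cases "j = Suc k")
    case True with Suc.prems show ?thesis by metis
  next
    case False
    then have "j \<le> k" using Suc.prems by simp
    moreover have "bnd k s L f" using Suc.prems by (blast intro: bnd_SucD)
    ultimately show ?thesis using Suc.IH by blast
  qed
qed

lemma bnd_const: "\<bar>c\<bar> \<le> s \<Longrightarrow> 0 \<le> L \<Longrightarrow> bnd k s L (\<lambda>x. c)"
proof (induction k arbitrary: s c)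
  case (Suc k)
  have "dd i (\<lambda>x. c) = (\<lambda>x. 0)" for i by auto
  moreover have "0 \<le> s * L" using Suc.prems by auto
  ultimately show ?case using Suc by (auto simp del: bnd.simps(1))
qed auto

lemma bnd_add: "bnd k s L f \<Longrightarrow> bnd k t L g \<Longrightarrow> bnd k (s + t) L (\<lambda>x. f x + g x)"
proof (induction k arbitrary: s t f g)
  case 0 then show ?case by (auto intro!: continuous_intros abs_triangle_ineq[THEN order_trans] add_mono)
next
  case (Suc k)
  have d: "f differentiable (at x)" "g differentiable (at x)" for x using Suc.prems by auto
  have "dd i (\<lambda>x. f x + g x) = (\<lambda>x. dd i f x + dd i g x)" for i
    using d by (auto simp: dd_add)
  moreover have "bnd k (s * L + t * L) L (\<lambda>x. dd i f x + dd i g x)" for i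
    using Suc.prems by (intro Suc.IH) auto
  ultimately show ?case
    using d Suc.prems by (auto simp: distrib_right intro!: abs_triangle_ineq[THEN order_trans] add_mono)
qed

text \<open>By the Leibniz rule every derivative doubles the number of terms, hence
  \<open>2^k\<close>.\<close>

lemma bnd_mult: "bnd k s L f \<Longrightarrow> bnd k t L g \<Longrightarrow> bnd k (2^k * (s * t)) L (\<lambda>x. f x * g x)"
proof (induction k arbitrary: s t f g)
  case 0 then show ?case
    by (auto simp: abs_mult intro!: continuous_intros mult_mono intro: order_trans[OF abs_ge_zero])
next
  case (Suc k)
  have d: "f differentiable (at x)" "g differentiable (at x)" for x using Suc.prems by auto
  have n: "0 \<le> s" "0 \<le> t" using Suc.prems bnd_nonneg by blast+
  have "dd i (\<lambda>x. f x * g x) = (\<lambda>x. f x * dd i g x + dd i f x * g x)" for i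
    using d by (auto simp: dd_mult)
  moreover have "bnd k (2^k * (s * (t * L)) + 2^k * ((s * L) * t)) L (\<lambda>x. f x * dd i g x + dd i f x * g x)" for i
    using Suc.prems by (intro bnd_add Suc.IH) (blast intro: bnd_SucD bnd_dd)+
  moreover have "2^k * (s * (t * L)) + 2^k * ((s * L) * t) = 2^Suc k * (s * t) * L"
    by (simp add: algebra_simps)
  moreover have "\<bar>f x * g x\<bar> \<le> 2^Suc k * (s * t)" for x
  proof -
    have "\<bar>f x * g x\<bar> \<le> 1 * (s * t)"
      unfolding abs_mult using Suc.prems n by (auto intro!: mult_mono)
    also have "\<dots> \<le> 2^Suc k * (s * t)"
      using n by (intro mult_right_mono one_le_power) auto
    finally show ?thesis .
  qed
  ultimately show ?case
    using d by simp
qed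

lemma bnd_cmult: 
  assumes "bnd k s L f" shows "bnd k (\<bar>c\<bar> * s) L (\<lambda>x. c * f x)"
  using assms
proof (induction k arbitrary: s f)
  case 0 then show ?case by (auto simp: abs_mult intro!: continuous_intros mult_mono)
next
  case (Suc k)
  have d: "f differentiable (at x)" for x using Suc.prems by auto
  have "dd i (\<lambda>x. c * f x) = (\<lambda>x. c * dd i f x)" for i
    using d by (auto simp: dd_cmult)
  then show ?case
    using d Suc.prems Suc.IH[of "s * L" "dd i f" for i] by (auto simp: abs_mult mult.assoc intro!: mult_left_mono)
qed

lemma bnd_cmult': "bnd k s L f \<Longrightarrow> \<bar>c\<bar> * s \<le> t \<Longrightarrow> 0 \<le> L \<Longrightarrow> bnd k t L (\<lambda>x. c * f x)"
  using bnd_mono[OF bnd_cmult, of k s L f c t L] by simp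

lemma bnd_minus: "bnd k s L f \<Longrightarrow> bnd k t L g \<Longrightarrow> bnd k (s + t) L (\<lambda>x. f x - g x)"
  using bnd_add[of k s L f t "\<lambda>x. (-1) * g x"] bnd_cmult[of k t L g "-1"] by simp

lemma bnd_uminus: "bnd k s L f \<Longrightarrow> bnd k s L (\<lambda>x. - f x)"
  using bnd_cmult[of k s L f "-1"] by simp

text \<open>In the commutator estimate the comparison function changes from point to point. The
  bound is a pointwise statement about derivatives, so a different comparison function near every
  point is enough.\<close>

lemma bnd_local:
  assumes "\<And>x. \<exists>g S. open S \<and> x \<in> S \<and> (\<forall>y\<in>S. f y = g y) \<and> bnd k s L g"
  shows "bnd k s L f"
  using assms
proof (induction k arbitrary: s f)
  case 0
  have "continuous (at x) f \<and> \<bar>f x\<bar> \<le> s" for x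
  proof -
    obtain g S where S: "open S" "x \<in> S" "\<forall>y\<in>S. f y = g y" and g: "bnd 0 s L g"
      using 0 by metis
    have "isCont g x" using g by (auto simp: continuous_on_eq_continuous_at)
    then have "isCont f x"
      using S isCont_cong[of f g x] by (auto simp: eventually_nhds)
    with S g show ?thesis by auto
  qed
  then show ?case by (auto simp: continuous_on_eq_continuous_at)
next
  case (Suc k)
  have 1: "f differentiable (at x) \<and> \<bar>f x\<bar> \<le> s" for x
  proof -
    obtain g S where S: "open S" "x \<in> S" "\<forall>y\<in>S. f y = g y" and g: "bnd (Suc k) s L g"
      using Suc.prems by metis
    obtain D where D: "(g has_derivative D) (at x)" using g by (auto simp: differentiable_def)
    have "(f has_derivative D) (at x)"
      by (rule has_derivative_transform_within_open[OF D S(1,2)]) (use S in auto)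
    with S g show ?thesis by (auto simp: differentiable_def)
  qed
  have "bnd k (s * L) L (dd i f)" for i
  proof (rule Suc.IH)
    fix x
    obtain g S where S: "open S" "x \<in> S" "\<forall>y\<in>S. f y = g y" and g: "bnd (Suc k) s L g"
      using Suc.prems by metis
    then have "\<forall>y\<in>S. dd i f y = dd i g y" using dd_cong_open[of S _ f g i] by auto
    with S g show "\<exists>g S. open S \<and> x \<in> S \<and> (\<forall>y\<in>S. dd i f y = g y) \<and> bnd k (s*L) L g"
      by (intro exI[of _ "dd i g"] exI[of _ S]) auto
  qed
  with 1 show ?case by auto
qed

section \<open>Oscillating functions and real powers at a given scale\<close>

lemma dd_inner: "(\<lambda>x. c + x \<bullet> z) differentiable (at x)" "dd i (\<lambda>x. c + x \<bullet> z) x = z $ i"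
proof -
  have *: "((\<lambda>x. c + x \<bullet> z) has_derivative (\<lambda>h. h \<bullet> z)) (at x)"
    by (auto intro!: derivative_eq_intros)
  then show "(\<lambda>x. c + x \<bullet> z) differentiable (at x)" by (auto simp: differentiable_def)
  show "dd i (\<lambda>x. c + x \<bullet> z) x = z $ i"
    using dd_eqI[OF *] by (simp add: inner_axis inner_commute)
qed

lemma dd_sin:
  "(\<lambda>x. sin (c + x \<bullet> z)) differentiable (at x)" "dd i (\<lambda>x. sin (c + x \<bullet> z)) x = cos (c + x \<bullet> z) * z $ i"
  using dd_chain(1)[OF dd_inner(1)[of c z x] DERIV_sin] dd_chain(2)[OF dd_inner(1)[of c z x] DERIV_sin, of i]
  by (auto simp: dd_inner)

lemma dd_cos:
  "(\<lambda>x. cos (c + x \<bullet> z)) differentiable (at x)" "dd i (\<lambda>x. cos (c + x \<bullet> z)) x = - sin (c + x \<bullet> z) * z $ i"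
  using dd_chain(1)[OF dd_inner(1)[of c z x] DERIV_cos] dd_chain(2)[OF dd_inner(1)[of c z x] DERIV_cos, of i]
  by (auto simp: dd_inner)

lemma bnd_sin:
  assumes "\<And>i. \<bar>z $ i\<bar> \<le> L"
  shows "bnd k 1 L (\<lambda>x. sin (c + x \<bullet> z)) \<and> bnd k 1 L (\<lambda>x. cos (c + x \<bullet> z))"
proof (induction k)
  case 0 show ?case by (auto intro!: continuous_intros)
next
  case (Suc k)
  have L: "0 \<le> L" using assms[of 1] by linarith
  have "dd i (\<lambda>x. sin (c + x \<bullet> z)) = (\<lambda>x. z $ i * cos (c + x \<bullet> z))" 
       "dd i (\<lambda>x. cos (c + x \<bullet> z)) = (\<lambda>x. - z $ i * sin (c + x \<bullet> z))" for i
    by (auto simp: dd_sin dd_cos)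
  then show ?case
    using Suc assms L by (auto simp: dd_sin dd_cos intro!: bnd_cmult'[where s=1] bnd_uminus)
qed

text \<open>Differentiation replaces the exponent \<open>q\<close> by \<open>q - 1\<close>, so the
  induction runs over all exponents. The lower bound \<open>c\<close> controls the negative powers
  that arise. \<open>C\<close> depends on neither \<open>L\<close> nor \<open>f\<close>, which lets
  the amplitudes of all stages share one constant.\<close>

lemma bnd_powr:
  assumes "0 < c" "0 \<le> s"
  shows "\<exists>C\<ge>0. \<forall>L f. 0 \<le> L \<longrightarrow> bnd k s L f \<longrightarrow> (\<forall>x. c \<le> f x) \<longrightarrow> bnd k C L (\<lambda>x. f x powr q)"
proof (induction k arbitrary: q)
  case 0
  have *: "\<bar>y powr q\<bar> \<le> c powr q + s powr q" if "c \<le> y" "y \<le> s" for y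
  proof (cases "q \<ge> 0")
    case True
    then have "y powr q \<le> s powr q" using that assms by (intro powr_mono2) auto
    then show ?thesis by (simp add: add_increasing)
  next
    case False
    then have "y powr q \<le> c powr q" using that assms by (intro powr_mono2') auto
    then show ?thesis by (simp add: add_increasing2)
  qed
  show ?case
  proof (intro exI[of _ "c powr q + s powr q"] conjI allI impI)
    fix L :: real and f assume "bnd 0 s L f" "\<forall>x. c \<le> f x"
    then have "f x \<noteq> 0" "c \<le> f x" "f x \<le> s" for x
      using assms(1) by (auto simp: abs_le_iff dest: spec[of _ x])
    then show "bnd 0 (c powr q + s powr q) L (\<lambda>x. f x powr q)"
      using \<open>bnd 0 s L f\<close> * by (auto intro!: continuous_on_powr continuous_on_const)
  qed auto
next
  case (Suc k)
  obtain C0 where C0: "C0 \<ge> 0" "\<And>L f. 0 \<le> L \<Longrightarrow> bnd k s L f \<Longrightarrow> (\<forall>x. c \<le> f x) \<Longrightarrow> bnd k C0 L (\<lambda>x. f x powr q)"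
    using Suc.IH[of q] by blast
  obtain C1 where C1: "C1 \<ge> 0" "\<And>L f. 0 \<le> L \<Longrightarrow> bnd k s L f \<Longrightarrow> (\<forall>x. c \<le> f x) \<Longrightarrow> bnd k C1 L (\<lambda>x. f x powr (q-1))"
    using Suc.IH[of "q-1"] by blast
  define C where "C = C0 + \<bar>q\<bar> * (2^k * (C1 * s))"
  have C: "C0 \<le> C" "\<bar>q\<bar> * (2^k * (C1 * s)) \<le> C" "0 \<le> C"
    using C0 C1 assms by (auto simp: C_def)
  show ?case
  proof (intro exI[of _ C] conjI allI impI)
    fix L :: real and f assume L: "0 \<le> L" and f: "bnd (Suc k) s L f" "\<forall>x. c \<le> f x"
    have d: "(\<lambda>x. f x powr q) differentiable (at x)" "dd i (\<lambda>x. f x powr q) x = q * (f x powr (q-1) * dd i f x)" for x i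
    proof -
      have "((\<lambda>y. y powr q) has_real_derivative q * f x powr (q-1)) (at (f x))"
        using f(2)[rule_format, of x] assms by (auto intro!: has_real_derivative_powr)
      from dd_chain[OF bnd_diff[OF f(1)] this] show "(\<lambda>x. f x powr q) differentiable (at x)"
        "dd i (\<lambda>x. f x powr q) x = q * (f x powr (q-1) * dd i f x)" by auto
    qed
    have b0: "bnd k s L f" using f by (blast intro: bnd_SucD)
    have "bnd k (\<bar>q\<bar> * (2^k * (C1 * (s * L)))) L (\<lambda>x. q * (f x powr (q-1) * dd i f x))" for i
      using f b0 L by (intro bnd_cmult bnd_mult C1) auto
    moreover have "\<bar>q\<bar> * (2^k * (C1 * (s * L))) \<le> C * L"
      using mult_right_mono[OF C(2) L] by (simp add: algebra_simps)
    ultimately have "bnd k (C * L) L (\<lambda>x. q * (f x powr (q-1) * dd i f x))" for i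
      using L bnd_mono by blast
    moreover have "dd i (\<lambda>x. f x powr q) = (\<lambda>x. q * (f x powr (q-1) * dd i f x))" for i using d by auto
    moreover have "\<bar>f x powr q\<bar> \<le> C" for x
      using bnd_bound[OF C0(2)[OF L b0 f(2)], of x] C by linarith
    ultimately show "bnd (Suc k) C L (\<lambda>x. f x powr q)" using d by auto
  qed (use C in auto)
qed

section \<open>Mollification by iterated averages\<close>

text \<open>Averaging over segments turns a derivative into a difference quotient, so that no smooth kernel
  is needed.\<close>

definition avg :: "2 \<Rightarrow> real \<Rightarrow> (real^2 \<Rightarrow> real) \<Rightarrow> real^2 \<Rightarrow> real" where
  "avg i l f x = integral (cbox 0 1) (\<lambda>s. f (x + (l * s) *\<^sub>R axis i 1))"

lemma continuous_on_UNIV_compose: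
  "continuous_on UNIV f \<Longrightarrow> continuous_on S h \<Longrightarrow> continuous_on S (\<lambda>s. f (h s))"
  by (rule continuous_on_compose2) auto

lemma avg_integrand_cont:
  fixes f :: "real^2 \<Rightarrow> real"
  shows
  "continuous_on UNIV f \<Longrightarrow> continuous_on S (\<lambda>s. f (x + (l * s) *\<^sub>R axis i 1))"
  by (erule continuous_on_UNIV_compose) (intro continuous_intros)

lemma avg_integrable:
  fixes f :: "real^2 \<Rightarrow> real"
  shows
  "continuous_on UNIV f \<Longrightarrow> (\<lambda>s. f (x + (l * s) *\<^sub>R axis i 1)) integrable_on cbox 0 (1::real)"
  by (intro integrable_continuous avg_integrand_cont)

lemma avg_cont:
  assumes "continuous_on UNIV f" shows "continuous_on UNIV (avg i l f)"
  unfolding avg_def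
  by (intro integral_continuous_on_param)
     (auto simp: case_prod_beta' intro!: continuous_on_UNIV_compose[OF assms] continuous_intros)

lemma avg_add:
  assumes "continuous_on UNIV f" "continuous_on UNIV g"
  shows "avg i l (\<lambda>x. f x + g x) = (\<lambda>x. avg i l f x + avg i l g x)"
  unfolding avg_def by (intro ext Henstock_Kurzweil_Integration.integral_add avg_integrable assms)

lemma avg_cmult: "avg i l (\<lambda>x. c * f x) = (\<lambda>x. c * avg i l f x)"
  unfolding avg_def by (intro ext) simp

text \<open>An average at \<open>z\<close> sees points within \<open>l\<close> of it. Carrying the
  radius \<open>r\<close> along makes the estimate compose: each further average consumes
  \<open>l\<close> of the neighbourhood of \<open>x\<close>.\<close>

lemma avg_near:
  assumes f: "continuous_on UNIV f" and l: "0 \<le> l"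
    and b: "\<And>y. dist y x \<le> r + l \<Longrightarrow> \<bar>f y - c\<bar> \<le> s"
    and z: "dist z x \<le> r"
  shows "\<bar>avg i l f z - c\<bar> \<le> s"
proof -
  have d: "dist (z + (l * u) *\<^sub>R axis i 1) x \<le> r + l" if "u \<in> cbox 0 1" for u
  proof -
    have "dist (z + (l * u) *\<^sub>R axis i 1) z = \<bar>l * u\<bar>" by (simp add: dist_norm norm_axis_1)
    also have "\<dots> \<le> l" using that l by (auto simp: abs_mult intro: mult_left_le)
    finally show ?thesis using dist_triangle[of "z + (l * u) *\<^sub>R axis i 1" x z] z by linarith
  qed
  have "((\<lambda>s. f (z + (l * s) *\<^sub>R axis i 1)) has_integral avg i l f z) (cbox 0 1)"
    unfolding avg_def by (intro integrable_integral avg_integrable f)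
  moreover have "((\<lambda>s. c) has_integral c) (cbox 0 (1::real))"
    using has_integral_const_real[of c 0 1] by simp
  ultimately have "((\<lambda>s. f (z + (l * s) *\<^sub>R axis i 1) - c) has_integral avg i l f z - c) (cbox 0 1)"
    by (rule has_integral_diff)
  from has_integral_bound[OF _ this, of s] have "norm (avg i l f z - c) \<le> s * measure lborel (cbox 0 (1::real))"
    using b[OF d] b[of z] z l by force
  then show ?thesis by simp
qed

lemma avg_swap:
  assumes f: "continuous_on UNIV f"
  shows "avg i l (avg j l f) = avg j l (avg i l f)"
proof
  fix x
  have "continuous_on (cbox (0,0) (1,1)) (\<lambda>(s::real,t::real). f (x + (l * s) *\<^sub>R axis i 1 + (l * t) *\<^sub>R axis j 1))"
    by (auto simp: case_prod_beta' intro!: continuous_on_UNIV_compose[OF f] continuous_intros)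
  from integral_swap_continuous[OF this]
  show "avg i l (avg j l f) x = avg j l (avg i l f) x"
    unfolding avg_def by (simp add: add_ac)
qed

text \<open>With an antiderivative \<open>G\<close> along the line, the average is
  \<open>(G (t + l) - G t) / l\<close>; so the derivative exists although \<open>f\<close> is only
  continuous.\<close>

lemma avg_deriv:
  assumes f: "continuous_on UNIV f" and l: "0 < l"
  shows "((\<lambda>t. avg i l f (x + t *\<^sub>R axis i 1)) has_real_derivative (f (x + l *\<^sub>R axis i 1) - f x) / l) (at 0)"
proof -
  define g where "g = (\<lambda>u. f (x + u *\<^sub>R axis i 1))"
  \<comment> \<open>The lower limit -2 lies below \<open>t\<close> and \<open>t + l * s\<close> for
    all \<open>\<bar>t\<bar> < 1\<close>, so \<open>G\<close> is differentiable wherever this is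
    needed.\<close>
  define G where "G = (\<lambda>u. integral {-2..u} g)"
  have gc: "continuous_on S g" for S
    unfolding g_def by (rule continuous_on_UNIV_compose[OF f]) (intro continuous_intros)
  have G: "(G has_real_derivative g u) (at u)" if "-2 < u" for u
  proof -
    have "(G has_real_derivative g u) (at u within {-2..u+1})"
      unfolding G_def using that by (intro integral_has_real_derivative gc) auto
    then show ?thesis using that at_within_interior[of u "{-2..u+1}"] by (auto simp: interior_atLeastAtMost_real)
  qed
  have A: "avg i l f (x + t *\<^sub>R axis i 1) = (G (t + l) - G t) / l" if t: "\<bar>t\<bar> < 1" for t
  proof -
    have "((\<lambda>s. g (t + l * s)) has_integral (G (t + l * 1) / l - G (t + l * 0) / l)) {0..1}"
    proof (rule fundamental_theorem_of_calculus)
      fix s :: real assume s: "s \<in> {0..1}"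
      have "0 \<le> l * s" using s l by simp
      then have "-2 < t + l * s" using t by linarith
      from G[OF this] have "((\<lambda>s. G (t + l * s)) has_real_derivative g (t + l * s) * l) (at s)"
        by (intro DERIV_chain2[where f=G]) (auto intro!: derivative_eq_intros)
      from DERIV_cdivide[OF this, of l] have "((\<lambda>s. G (t + l * s) / l) has_real_derivative g (t + l * s)) (at s)"
        using l by simp
      then show "((\<lambda>s. G (t + l * s) / l) has_vector_derivative g (t + l * s)) (at s within {0..1})"
        using has_real_derivative_iff_has_vector_derivative has_vector_derivative_at_within by blast
    qed simp
    then have "integral (cbox 0 1) (\<lambda>s. g (t + l * s)) = (G (t + l) - G t) / l"
      by (auto simp: diff_divide_distrib intro: integral_unique)
    then show ?thesis by (simp add: avg_def g_def algebra_simps)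
  qed
  have "((\<lambda>t. (G (t + l) - G t) / l) has_real_derivative (g l - g 0) / l) (at 0)"
    using G[of l] G[of 0] l DERIV_shift[of G "g l" 0 l]
    by (auto intro!: DERIV_cdivide DERIV_diff simp: add.commute)
  then have "((\<lambda>t. avg i l f (x + t *\<^sub>R axis i 1)) has_real_derivative (g l - g 0) / l) (at 0)"
    by (rule DERIV_cong_ev[OF refl _ refl, THEN iffD1, rotated])
       (auto simp: A eventually_nhds intro!: exI[of _ "ball 0 1"])
  then show ?thesis by (simp add: g_def)
qed

lemma avg_dd:
  assumes d: "\<And>x. f differentiable (at x)" and c: "\<And>j. continuous_on UNIV (dd j f)"
  shows "avg i l f differentiable (at x)" "dd j (avg i l f) = avg i l (dd j f)"
proof -
  have "((\<lambda>t. avg i l f (x + t *\<^sub>R axis j 1)) has_real_derivative avg i l (dd j f) x) (at 0)" for j x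
  proof -
    have "((\<lambda>t. integral (cbox 0 1) (\<lambda>s. f ((x + (l * s) *\<^sub>R axis i 1) + t *\<^sub>R axis j 1)))
      has_real_derivative integral (cbox 0 1) (\<lambda>s. dd j f ((x + (l * s) *\<^sub>R axis i 1) + 0 *\<^sub>R axis j 1)))
      (at 0 within UNIV)"
    proof (rule leibniz_rule_field_derivative)
      show "((\<lambda>t. f ((x + (l * s) *\<^sub>R axis i 1) + t *\<^sub>R axis j 1)) has_real_derivative
          dd j f ((x + (l * s) *\<^sub>R axis i 1) + t *\<^sub>R axis j 1)) (at t within UNIV)" for t s
        using dd_line[OF d] by simp
      have "continuous_on UNIV f" by (rule differentiable_imp_cont[OF d])
      then show "(\<lambda>s. f (x + (l * s) *\<^sub>R axis i 1 + t *\<^sub>R axis j 1)) integrable_on cbox 0 1" for t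
        by (rule integrable_continuous[OF continuous_on_UNIV_compose[of f]]) (intro continuous_intros)
      show "continuous_on (UNIV \<times> cbox 0 1) (\<lambda>(t, s). dd j f (x + (l * s) *\<^sub>R axis i 1 + t *\<^sub>R axis j 1))"
        unfolding case_prod_beta' by (rule continuous_on_UNIV_compose[OF c]) (intro continuous_intros)
    qed auto
    then show ?thesis by (simp add: avg_def add_ac)
  qed
  from C1_partialsI[OF this avg_cont[OF c]]
  show "avg i l f differentiable (at x)" "dd j (avg i l f) = avg i l (dd j f)" by auto
qed

definition box_avg :: "real \<Rightarrow> (real^2 \<Rightarrow> real) \<Rightarrow> real^2 \<Rightarrow> real" where
  "box_avg l f = avg 1 l (avg 2 l f)"

lemma box_avg_cont: "continuous_on UNIV f \<Longrightarrow> continuous_on UNIV (box_avg l f)"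
  unfolding box_avg_def by (intro avg_cont)

lemma box_avg_dd:
  assumes d: "\<And>x. f differentiable (at x)" and c: "\<And>j. continuous_on UNIV (dd j f)"
  shows "box_avg l f differentiable (at x)" "dd j (box_avg l f) = box_avg l (dd j f)"
proof -
  note 1 = avg_dd[OF d c]
  have "continuous_on UNIV (dd j (avg i l f))" for i j by (auto simp: 1 intro: avg_cont c)
  from avg_dd[OF 1(1) this] show "box_avg l f differentiable (at x)" "dd j (box_avg l f) = box_avg l (dd j f)"
    by (auto simp: box_avg_def 1)
qed

lemma box_avg_near:
  assumes f: "continuous_on UNIV f" and l: "0 \<le> l"
    and b: "\<And>y. dist y x \<le> r + 2 * l \<Longrightarrow> \<bar>f y - c\<bar> \<le> s"
    and z: "dist z x \<le> r"
  shows "\<bar>box_avg l f z - c\<bar> \<le> s"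
  unfolding box_avg_def
  by (rule avg_near[OF avg_cont[OF f] l avg_near[OF f l b]]) (use z in auto)

lemma box_avg_bound:
  assumes "continuous_on UNIV f" "0 \<le> l" "\<And>y. \<bar>f y\<bar> \<le> s"
  shows "\<bar>box_avg l f z\<bar> \<le> s"
  using box_avg_near[OF assms(1,2), of z 0 0 s z] assms(3) by simp

text \<open>A partial derivative of the double average is a difference quotient of the average in
  the other direction, so it is continuous and at most \<open>2 * s / l\<close>; this fixes the
  frequency \<open>2/l\<close>. Higher derivatives pass through the averages onto
  \<open>f\<close>.\<close>

lemma bnd_box_avg:
  assumes l: "0 < l"
  shows "bnd k s (2/l) f \<Longrightarrow> bnd (Suc k) s (2/l) (box_avg l f)"
proof (induction k arbitrary: s f)
  case 0
  then have f: "continuous_on UNIV f" "\<And>x. \<bar>f x\<bar> \<le> s" by auto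
  \<comment> \<open>\<open>if i = 1 then 2 else 1\<close> is the other coordinate;
    \<open>avg_swap\<close> allows direction \<open>i\<close> to be taken outermost.\<close>
  define g where "g = (\<lambda>i x. (avg (if i = 1 then 2 else 1) l f (x + l *\<^sub>R axis i 1)
     - avg (if i = 1 then 2 else 1) l f x) / l)"
  have der: "((\<lambda>t. box_avg l f (x + t *\<^sub>R axis i 1)) has_real_derivative g i x) (at 0)" for i x
    using avg_deriv[OF avg_cont[OF f(1), of 2 l] l, of 1 x] avg_deriv[OF avg_cont[OF f(1), of 1 l] l, of 2 x]
      avg_swap[OF f(1), of 1 l 2] exhaust_2[of i]
    by (auto simp: box_avg_def g_def)
  have gc: "continuous_on UNIV (g i)" for i
    unfolding g_def using l
    by (intro continuous_on_divide continuous_on_diff continuous_on_UNIV_compose[OF avg_cont[OF f(1)]]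
        avg_cont f continuous_on_add continuous_on_id continuous_on_const) auto
  have ab: "\<bar>avg i l f x\<bar> \<le> s" for i x
    using avg_near[OF f(1), of l x 0 0 s x] l f(2) by auto
  have gb: "\<bar>g i x\<bar> \<le> s * (2/l)" for i x
  proof -
    have "\<bar>g i x\<bar> = \<bar>avg (if i = 1 then 2 else 1) l f (x + l *\<^sub>R axis i 1)
     - avg (if i = 1 then 2 else 1) l f x\<bar> / l" using l by (simp add: g_def)
    also have "\<dots> \<le> (s + s) / l"
      using l by (intro divide_right_mono order_trans[OF abs_triangle_ineq4] add_mono ab) auto
    finally show ?thesis by (simp add: mult.commute)
  qed
  have "dd i (box_avg l f) = g i" for i
    using C1_partialsI(2)[OF der gc] by auto
  then show ?case
    using C1_partialsI(1)[OF der gc] gc gb box_avg_bound[OF f(1) _ f(2)] l by auto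
next
  case (Suc k)
  have d: "\<And>x. f differentiable (at x)" "\<And>i. bnd k (s * (2/l)) (2/l) (dd i f)" using Suc.prems by auto
  note dd = box_avg_dd[OF d(1) bnd_cont[OF d(2)]]
  have "bnd (Suc k) (s * (2/l)) (2/l) (box_avg l (dd i f))" for i
    by (rule Suc.IH[OF d(2)])
  moreover have "\<bar>box_avg l f x\<bar> \<le> s" for x
    using l bnd_bound[OF Suc.prems] by (intro box_avg_bound bnd_cont[OF Suc.prems]) auto
  ultimately have "bnd (Suc (Suc k)) s (2/l) (box_avg l f)"
    using dd by (simp only: bnd.simps(2)[of "Suc k"]) simp
  then show ?case .
qed

text \<open>Each box average gains one derivative; three are taken because a corrugation uses its
  amplitude up to third derivatives.\<close>

definition moll :: "real \<Rightarrow> (real^2 \<Rightarrow> real) \<Rightarrow> real^2 \<Rightarrow> real" where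
  "moll l f = box_avg l (box_avg l (box_avg l f))"

lemma moll_cont: "continuous_on UNIV f \<Longrightarrow> continuous_on UNIV (moll l f)"
  unfolding moll_def by (intro box_avg_cont)

lemma moll_smooth:
  assumes "0 < l" "continuous_on UNIV f" "\<And>x. \<bar>f x\<bar> \<le> s"
  shows "bnd 3 s (2/l) (moll l f)"
  using assms(2,3) bnd_box_avg[OF assms(1)]
  unfolding moll_def numeral_3_eq_3 by (metis bnd.simps(1))

lemma moll_dd:
  assumes d: "\<And>x. f differentiable (at x)" and c: "\<And>j. continuous_on UNIV (dd j f)"
  shows "moll l f differentiable (at x)" "dd j (moll l f) = moll l (dd j f)"
proof -
  note 1 = box_avg_dd[where l=l, OF d c]
  have c1: "continuous_on UNIV (dd j (box_avg l f))" for j by (auto simp: 1 intro: box_avg_cont c)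
  note 2 = box_avg_dd[where l=l, OF 1(1) c1]
  have c2: "continuous_on UNIV (dd j (box_avg l (box_avg l f)))" for j by (auto simp: 1 2 intro: box_avg_cont c)
  note 3 = box_avg_dd[where l=l, OF 2(1) c2]
  show "moll l f differentiable (at x)" "dd j (moll l f) = moll l (dd j f)"
    unfolding moll_def by (auto simp: 1 2 3)
qed

text \<open>There are six averages, two per box average, and each shifts the argument by at most
  \<open>l\<close>.\<close>

lemma moll_near:
  assumes f: "continuous_on UNIV f" and l: "0 \<le> l"
    and b: "\<And>y. dist y x \<le> 6 * l \<Longrightarrow> \<bar>f y - c\<bar> \<le> s"
  shows "\<bar>moll l f x - c\<bar> \<le> s"
  unfolding moll_def
  by (rule box_avg_near[OF box_avg_cont[OF box_avg_cont[OF f]] l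
       box_avg_near[OF box_avg_cont[OF f] l box_avg_near[OF f l b]], of x 0]) auto

lemma moll_add:
  assumes "continuous_on UNIV f" "continuous_on UNIV g"
  shows "moll l (\<lambda>x. f x + g x) x = moll l f x + moll l g x"
  using assms by (simp add: moll_def box_avg_def avg_add avg_cont)

lemma moll_cmult: "moll l (\<lambda>x. c * f x) x = c * moll l f x"
  by (simp add: moll_def box_avg_def avg_cmult)

lemma moll_diff:
  assumes "continuous_on UNIV f" "continuous_on UNIV g"
  shows "moll l (\<lambda>x. f x - g x) x = moll l f x - moll l g x"
  using moll_add[of f "\<lambda>x. (-1) * g x" l x] moll_cmult[of l "-1" g x] assms
  by (simp add: continuous_on_minus)

lemma moll_const: "moll l (\<lambda>x. c) x = c"
  by (simp add: moll_def box_avg_def avg_def)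

lemma moll_bound:
  assumes "continuous_on UNIV f" "0 \<le> l" "\<And>y. \<bar>f y\<bar> \<le> s"
  shows "\<bar>moll l f x\<bar> \<le> s"
  using moll_near[OF assms(1,2), of x 0 s] assms(3) by simp

lemma moll_cong:
  assumes "continuous_on UNIV f" "continuous_on UNIV g" "0 \<le> l"
    and "\<And>y. dist y x \<le> 6 * l \<Longrightarrow> f y = g y"
  shows "moll l f x = moll l g x"
  using moll_near[of "\<lambda>x. f x - g x" l x 0 0] assms by (simp add: moll_diff continuous_on_diff)

section \<open>Corrugations\<close>

lemma lipschitz_dd:
  assumes d: "\<And>x. f differentiable (at x)" and b: "\<And>i x. \<bar>dd i f x\<bar> \<le> M"
  shows "\<bar>f x - f y\<bar> \<le> 2 * M * dist x y"
proof -
  have M: "0 \<le> M" using b[of 1 x] by linarith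
  have "norm (f x - f y) \<le> (2 * M) * norm (x - y)"
  proof (rule differentiable_bound[of UNIV f "\<lambda>x h. dd 1 f x * h$1 + dd 2 f x * h$2"])
    show "(f has_derivative (\<lambda>h. dd 1 f x * h$1 + dd 2 f x * h$2)) (at x within UNIV)" for x
      using has_derivative_dd[OF d] by simp
    show "onorm (\<lambda>h::real^2. dd 1 f x * h$1 + dd 2 f x * h$2) \<le> 2 * M" for x
    proof (rule onorm_le)
      fix h :: "real^2"
      have "\<bar>dd 1 f x * h$1 + dd 2 f x * h$2\<bar> \<le> \<bar>dd 1 f x\<bar> * \<bar>h$1\<bar> + \<bar>dd 2 f x\<bar> * \<bar>h$2\<bar>"
        by (metis abs_mult abs_triangle_ineq)
      also have "\<dots> \<le> M * norm h + M * norm h"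
        using b M component_le_norm_cart[of h] by (intro add_mono mult_mono) auto
      finally show "norm (dd 1 f x * h$1 + dd 2 f x * h$2) \<le> 2 * M * norm h" by simp
    qed
  qed auto
  then show ?thesis by (simp add: dist_norm)
qed

lemma moll_near_dd:
  assumes "\<And>x. f differentiable (at x)" "\<And>i x. \<bar>dd i f x\<bar> \<le> M" "0 \<le> l"
  shows "\<bar>moll l f x - f x\<bar> \<le> 12 * l * M"
proof (rule moll_near[OF differentiable_imp_cont[OF assms(1)] assms(3)])
  fix y assume y: "dist y x \<le> 6 * l"
  have M: "0 \<le> M" using assms(2)[of 1 x] by linarith
  have "\<bar>f y - f x\<bar> \<le> 2 * M * dist y x" by (rule lipschitz_dd[OF assms(1,2)])
  also have "\<dots> \<le> 2 * M * (6 * l)" using y M by (intro mult_left_mono) auto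
  finally show "\<bar>f y - f x\<bar> \<le> 12 * l * M" by (simp add: algebra_simps)
qed

text \<open>Near a point, \<open>f\<close> and \<open>g\<close> may be replaced by the truncations of their increments from that
  point, because the commutator does not see additive constants; the increments are \<open>O(l M)\<close>.\<close>

lemma bnd_moll_commutator:
  assumes l: "0 < l"
    and f: "\<And>x. f differentiable (at x)" "\<And>i x. \<bar>dd i f x\<bar> \<le> M"
    and g: "\<And>x. g differentiable (at x)" "\<And>i x. \<bar>dd i g x\<bar> \<le> M"
  shows "bnd 3 (1764 * (l * M)^2) (2/l) (\<lambda>x. moll l (\<lambda>y. f y * g y) x - moll l f x * moll l g x)"
proof (rule bnd_local)
  fix x0
  have M: "0 \<le> M" using f(2)[of 1 x0] by linarith
  \<comment> \<open>A point within \<open>6 * l\<close> of the ball of radius \<open>l\<close> lies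
    within \<open>7 * l\<close> of \<open>x0\<close>, and \<open>f\<close>, \<open>g\<close> have
    Lipschitz constant \<open>2 * M\<close>; so \<open>s\<close> bounds the increments. The final
    constant is 9 * 14^2: 1 from the mollified product and 8 from \<open>bnd_mult\<close>.\<close>
  define s where "s = 14 * (l * M)"
  have s: "0 \<le> s" using l M by (simp add: s_def)
  define T where "T = (\<lambda>(h :: real^2 \<Rightarrow> real) y. max (-s) (min s (h y - h x0 :: real)))"
  have fc: "continuous_on UNIV f" and gc: "continuous_on UNIV g"
    using f g differentiable_imp_cont by blast+
  have Tc: "continuous_on UNIV (T h)" if "continuous_on UNIV h" for h
    unfolding T_def by (intro continuous_intros that)
  have Tb: "\<bar>T h y\<bar> \<le> s" for h y unfolding T_def using s by (auto simp: max_def min_def)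
  have Te: "T h z = h z - h x0"
    if h: "\<And>x. h differentiable (at x)" "\<And>i x. \<bar>dd i h x\<bar> \<le> M"
      and y: "y \<in> ball x0 l" and z: "dist z y \<le> 6 * l" for h y z
  proof -
    have "dist z x0 \<le> 7 * l"
      using dist_triangle[of z x0 y] y z by (simp add: dist_commute)
    then have "2 * M * dist z x0 \<le> 2 * M * (7 * l)" using M by (intro mult_left_mono) auto
    then have "\<bar>h z - h x0\<bar> \<le> s" using lipschitz_dd[OF h, of z x0] by (simp add: s_def algebra_simps)
    then show ?thesis by (auto simp: T_def max_def min_def)
  qed
  let ?H = "\<lambda>x. moll l (\<lambda>y. T f y * T g y) x - moll l (T f) x * moll l (T g) x"
  have eq: "moll l (\<lambda>y. f y * g y) y - moll l f y * moll l g y = ?H y" if y: "y \<in> ball x0 l" for y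
  proof -
    have 1: "moll l (T h) y = moll l h y - h x0"
      if h: "\<And>x. h differentiable (at x)" "\<And>i x. \<bar>dd i h x\<bar> \<le> M" for h
    proof -
      have hc: "continuous_on UNIV h" using h differentiable_imp_cont by blast
      have "moll l (T h) y = moll l (\<lambda>z. h z - h x0) y"
        by (rule moll_cong[OF Tc[OF hc] _ _ Te[OF h y]]) (use l hc in \<open>auto intro!: continuous_intros\<close>)
      then show ?thesis by (simp add: moll_diff hc moll_const)
    qed
    have "moll l (\<lambda>z. T f z * T g z) y
        = moll l (\<lambda>z. (f z * g z - f x0 * g z) - (g x0 * f z - f x0 * g x0)) y"
      by (rule moll_cong)
         (use l in \<open>auto simp: Te[OF f y] Te[OF g y] algebra_simps intro!: continuous_intros Tc fc gc\<close>)
    also have "\<dots> = moll l (\<lambda>z. f z * g z) y - f x0 * moll l g y - (g x0 * moll l f y - f x0 * g x0)"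
      by (simp add: moll_diff moll_cmult moll_const continuous_intros fc gc)
    finally show ?thesis unfolding 1[OF f] 1[OF g] by (simp add: algebra_simps)
  qed
  have b1: "bnd 3 (s * s) (2/l) (moll l (\<lambda>y. T f y * T g y))"
    using Tb s by (intro moll_smooth l continuous_intros Tc fc gc) (auto simp: abs_mult intro!: mult_mono)
  have b2: "bnd 3 s (2/l) (moll l (T f))" "bnd 3 s (2/l) (moll l (T g))"
    using Tb by (auto intro!: moll_smooth l Tc fc gc)
  have "bnd 3 (s * s + 2^3 * (s * s)) (2/l) ?H"
    by (intro bnd_minus b1 bnd_mult b2)
  moreover have "s * s + 2^3 * (s * s) = 1764 * (l * M)^2"
    by (simp add: s_def power2_eq_square)
  ultimately have "bnd 3 (1764 * (l * M)^2) (2/l) ?H" by simp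
  with eq l show "\<exists>h S. open S \<and> x0 \<in> S \<and> (\<forall>y\<in>S. moll l (\<lambda>y. f y * g y) y - moll l f y * moll l g y = h y)
      \<and> bnd 3 (1764 * (l * M)^2) (2/l) h"
    by (intro exI[of _ ?H] exI[of _ "ball x0 l"]) auto
qed

section \<open>The von Karman strain and a single corrugation\<close>

definition vk_metric :: "(real^2 \<Rightarrow> real) \<Rightarrow> (2 \<Rightarrow> real^2 \<Rightarrow> real) \<Rightarrow> 2 \<Rightarrow> 2 \<Rightarrow> real^2 \<Rightarrow> real" where
  "vk_metric v w i j x = dd i v x * dd j v x / 2 + (dd j (w i) x + dd i (w j) x) / 2"

text \<open>The Hessian has its own bound \<open>s * L\<close> with the small amplitude
  \<open>s\<close>. Reading it off the gradient bound would give \<open>G * L\<close> and spoil the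
  error of a corrugation, which must be quadratic in \<open>s\<close>.\<close>

definition admissible :: "real \<Rightarrow> real \<Rightarrow> real \<Rightarrow> (real^2 \<Rightarrow> real) \<Rightarrow> bool" where
  "admissible s G L v \<longleftrightarrow> (\<forall>x. v differentiable (at x)) \<and> (\<forall>i. bnd 2 G L (dd i v))
     \<and> (\<forall>i j. bnd 1 (s * L) L (dd j (dd i v)))"

text \<open>Made for sums of oscillations of different frequencies: the lowest, \<open>L\<close>,
  governs the size and the highest, \<open>M\<close>, the second derivatives.\<close>

definition correction :: "real \<Rightarrow> real \<Rightarrow> real \<Rightarrow> (real^2 \<Rightarrow> real) \<Rightarrow> bool" where
  "correction s L M b \<longleftrightarrow> (\<forall>x. \<bar>b x\<bar> \<le> s / L \<and> b differentiable (at x)) \<and> (\<forall>i. bnd 1 s M (dd i b))"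

lemma correction_bnd:
  assumes "bnd 2 (s / M) M b" "0 < L" "L \<le> M" "0 \<le> s"
  shows "correction s L M b"
proof -
  have b: "bnd (Suc 1) (s / M) M b" using assms(1) by (simp add: numeral_2_eq_2)
  have "s / M \<le> s / L" using assms by (intro divide_left_mono) auto
  moreover have "bnd 1 s M (dd i b)" for i using bnd_dd[OF b, of i] assms by simp
  ultimately show ?thesis
    using bnd_bound[OF b] bnd_diff[OF b] unfolding correction_def by (meson order_trans)
qed

lemma correction_add:
  assumes b: "correction s L M b" and c: "correction s' L M' c" and M: "0 \<le> M" "M \<le> M'"
  shows "correction (s + s') L M' (\<lambda>x. b x + c x)"
proof -
  have "dd i (\<lambda>x. b x + c x) = (\<lambda>x. dd i b x + dd i c x)" for i
    using b c by (auto simp: correction_def dd_add)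
  moreover have "bnd 1 (s + s') M' (\<lambda>x. dd i b x + dd i c x)" for i
  proof (rule bnd_add)
    show "bnd 1 s M' (dd i b)" using b M bnd_mono[of 1 s M "dd i b" s M', OF _ order_refl] unfolding correction_def by blast
    show "bnd 1 s' M' (dd i c)" using c unfolding correction_def by blast
  qed
  moreover have "\<bar>b x + c x\<bar> \<le> (s + s') / L" for x
  proof -
    have "\<bar>b x\<bar> \<le> s / L" "\<bar>c x\<bar> \<le> s' / L" using b c by (auto simp: correction_def)
    then show ?thesis by (simp add: add_divide_distrib)
  qed
  ultimately show ?thesis using b c by (simp add: correction_def)
qed

lemma correction_mono: "correction s L M b \<Longrightarrow> s \<le> s' \<Longrightarrow> 0 < L \<Longrightarrow> 0 \<le> M \<Longrightarrow> correction s' L M b"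
  unfolding correction_def by (meson bnd_mono divide_right_mono less_imp_le order_refl order_trans)

lemma admissible_mono:
  assumes "admissible s G L v" "s \<le> s'" "G \<le> G'" "0 \<le> L" "L \<le> L'" "0 \<le> s"
  shows "admissible s' G' L' v"
proof -
  have "s * L \<le> s' * L'" using assms by (intro mult_mono) auto
  then show ?thesis using assms unfolding admissible_def by (meson bnd_mono)
qed

lemma admissible_add:
  assumes v: "admissible s G L v" and b: "bnd 3 (16 * s / M) M b" and h: "0 < s" "s \<le> G" "0 < L" "L \<le> M"
  shows "admissible (17 * s) (17 * G) M (\<lambda>x. v x + b x)"
proof -
  have b3: "bnd (Suc (Suc (Suc 0))) (16 * s / M) M b" using b by (simp add: numeral_3_eq_3)
  have b2: "bnd (Suc (Suc 0)) (16 * s) M (dd i b)" for i using bnd_dd[OF b3, of i] h by simp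
  have b1: "bnd (Suc 0) (16 * s * M) M (dd j (dd i b))" for i j using bnd_dd[OF b2] .
  have vd: "v differentiable (at x)" "bnd 2 G L (dd i v)" "bnd 1 (s * L) L (dd j (dd i v))" for x i j
    using v by (auto simp: admissible_def)
  have e1: "dd i (\<lambda>x. v x + b x) = (\<lambda>x. dd i v x + dd i b x)" for i
    using vd bnd_diff[OF b3] by (auto simp: dd_add)
  have e2: "dd j (\<lambda>x. dd i v x + dd i b x) = (\<lambda>x. dd j (dd i v) x + dd j (dd i b) x)" for i j
    using bnd_diff[OF vd(2)[unfolded numeral_2_eq_2]] bnd_diff[OF b2] by (auto simp: dd_add)
  have "bnd 2 (G + 16 * s) M (\<lambda>x. dd i v x + dd i b x)" for i
    using b2 by (intro bnd_add bnd_mono[OF vd(2)]) (use h in \<open>auto simp: numeral_2_eq_2\<close>)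
  then have 1: "bnd 2 (17 * G) M (\<lambda>x. dd i v x + dd i b x)" for i
    by (rule bnd_mono) (use h in auto)
  have "s * L \<le> s * M" using h by simp
  then have "bnd 1 (s * M + 16 * s * M) M (\<lambda>x. dd j (dd i v) x + dd j (dd i b) x)" for i j
    using b1 by (intro bnd_add bnd_mono[OF vd(3)]) (use h in \<open>auto\<close>)
  then have 2: "bnd 1 (17 * s * M) M (\<lambda>x. dd j (dd i v) x + dd j (dd i b) x)" for i j
    by (simp add: algebra_simps)
  show ?thesis
    unfolding admissible_def e1 e2 using 1 2 vd bnd_diff[OF b3] by auto
qed

text \<open>The algebra at one point: \<open>S\<close> and \<open>C\<close> are sine and cosine of a
  phase with gradient \<open>l z\<close>, suffixes denote derivatives, and \<open>k = 1 / l\<close>.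
  The terms in the gradient of \<open>v\<close> cancel because the in-plane part contains
  \<open>- b * vi\<close>; the terms in \<open>zi * zj\<close> add up to \<open>a^2\<close> by
  \<open>S^2 + C^2 = 1\<close>. Every remaining term contains a derivative of the amplitude or the
  Hessian of \<open>v\<close>, together with a factor \<open>k\<close>.\<close>

lemma corrugation_identity:
  fixes k l :: real
  assumes kl: "k * l = 1" and sc: "S^2 + C^2 = 1"
    and b: "b = 2 * k * (a * S)" and c: "c = a * C"
    and bi: "bi = 2 * k * (ai * S) + 2 * c * zi" and bj: "bj = 2 * k * (aj * S) + 2 * c * zj"
    and ci: "ci = ai * C - a * S * (l * zi)" and cj: "cj = aj * C - a * S * (l * zj)"
  shows "(vi + bi) * (vj + bj) / 2
    + ((wij - (bj * (vi + c * zi / 2) + b * (vij + cj * zi / 2)))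
     + (wji - (bi * (vj + c * zj / 2) + b * (vji + ci * zj / 2)))) / 2
    - (vi * vj / 2 + (wij + wji) / 2) - a^2 * zi * zj
    = 2 * (k * (ai * S) * (k * (aj * S))) + 3/2 * (c * (k * (ai * S) * zj + k * (aj * S) * zi))
      - 1/4 * (b * C * (aj * zi + ai * zj)) - 1/2 * (b * (vij + vji))"
proof -
  have "c^2 + b * a * S * l / 2 = a^2 * (S^2 * (k * l) + C^2)"
    unfolding b c by (simp add: power2_eq_square algebra_simps)
  then have e: "c^2 + b * a * S * l / 2 - a^2 = 0" using kl sc by simp
  have "(vi + bi) * (vj + bj) / 2
    + ((wij - (bj * (vi + c * zi / 2) + b * (vij + cj * zi / 2)))
     + (wji - (bi * (vj + c * zj / 2) + b * (vji + ci * zj / 2)))) / 2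
    - (vi * vj / 2 + (wij + wji) / 2) - a^2 * zi * zj
    - (2 * (k * (ai * S) * (k * (aj * S))) + 3/2 * (c * (k * (ai * S) * zj + k * (aj * S) * zi))
      - 1/4 * (b * C * (aj * zi + ai * zj)) - 1/2 * (b * (vij + vji)))
    = (c^2 + b * a * S * l / 2 - a^2) * zi * zj"
    unfolding bi bj ci cj by (simp add: field_simps power2_eq_square)
  then show ?thesis unfolding e by simp
qed


lemma abs_mult_le: "\<bar>x\<bar> \<le> p \<Longrightarrow> \<bar>y\<bar> \<le> q \<Longrightarrow> \<bar>x * y\<bar> \<le> p * q" for x :: real
  unfolding abs_mult by (intro mult_mono) auto

lemma abs_add_le: "\<bar>x\<bar> \<le> p \<Longrightarrow> \<bar>y\<bar> \<le> q \<Longrightarrow> \<bar>x + y\<bar> \<le> p + q" for x :: real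
  by linarith

text \<open>The constants are Leibniz factors: 16 is 2 * 2^3, and 192 is 2^2 * 16 * 3, where
  \<open>3 * G\<close> bounds \<open>e\<close>. The error is linear in the frequency ratio
  \<open>L / l\<close> and contains neither \<open>G\<close> nor any bound on
  \<open>w\<close>.\<close>

lemma corrugation_step:
  assumes h: "0 < s" "s \<le> G" "0 < L" "L \<le> l"
    and z: "\<And>i. \<bar>z $ i\<bar> \<le> 1"
    and a: "bnd 3 s L a"
    and v: "admissible s G L v"
    and w: "\<And>i x. w i differentiable (at x)"
  shows "\<exists>b \<omega>. bnd 3 (16 * s / l) l b \<and> (\<forall>i. bnd 2 (192 * s * G / l) l (\<omega> i)) \<and>
    (\<forall>i j x. \<bar>vk_metric (\<lambda>x. v x + b x) (\<lambda>i x. w i x + \<omega> i x) i j x - vk_metric v w i j x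
      - (a x)^2 * z $ i * z $ j\<bar> \<le> 8 * s^2 * L / l)"
proof -
  have l: "0 < l" using h by simp
  define S where "S = (\<lambda>x. sin (0 + x \<bullet> (l *\<^sub>R z)))"
  define C where "C = (\<lambda>x. cos (0 + x \<bullet> (l *\<^sub>R z)))"
  have zl: "\<bar>(l *\<^sub>R z) $ i\<bar> \<le> l" for i
    using z[of i] l by (simp add: abs_mult mult_left_le)
  have Sb: "bnd n 1 l S" and Cb: "bnd n 1 l C" for n
    using bnd_sin[OF zl] unfolding S_def C_def by blast+
  have Sd: "S differentiable (at x)" "dd i S x = C x * (l * z $ i)" for i x
    using dd_sin[where c=0 and z="l *\<^sub>R z"] by (simp_all add: S_def C_def)
  have Cd: "C differentiable (at x)" "dd i C x = - S x * (l * z $ i)" for i x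
    using dd_cos[where c=0 and z="l *\<^sub>R z"] by (simp_all add: S_def C_def)
  have SC: "(S x)^2 + (C x)^2 = 1" for x by (simp add: S_def C_def)
  have abl: "bnd 3 s l a" using a h by (auto intro: bnd_mono)
  have ad: "a differentiable (at x)" for x using a by (auto simp: numeral_3_eq_3)
  define b where "b = (\<lambda>x. 2 * (1/l) * (a x * S x))"
  define c where "c = (\<lambda>x. a x * C x)"
  have bb: "bnd 3 (16 * s / l) l b"
  proof -
    have "bnd 3 (\<bar>2 * (1/l)\<bar> * (2^3 * (s * 1))) l b"
      unfolding b_def by (intro bnd_cmult bnd_mult abl Sb)
    then show ?thesis using l by (simp add: mult.commute)
  qed
  have cb: "bnd 2 (4 * s) l c"
  proof -
    have "bnd 2 (2^2 * (s * 1)) l c"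
      unfolding c_def by (intro bnd_mult bnd_le[OF abl] Cb) simp
    then show ?thesis by simp
  qed
  have bd: "b differentiable (at x)" "dd i b x = 2 * (1/l) * (dd i a x * S x) + 2 * c x * z $ i" for i x
  proof -
    have *: "(\<lambda>x. a x * S x) differentiable (at x)" by (intro differentiable_mult ad Sd)
    then show "b differentiable (at x)" unfolding b_def by (rule differentiable_mult[OF differentiable_const])
    show "dd i b x = 2 * (1/l) * (dd i a x * S x) + 2 * c x * z $ i"
      unfolding b_def c_def dd_cmult[OF *] dd_mult[OF ad Sd(1)] Sd using l by (simp add: field_simps)
  qed
  have cd: "c differentiable (at x)" "dd i c x = dd i a x * C x - a x * S x * (l * z $ i)" for i x
    unfolding c_def by (auto simp: dd_mult ad Cd)
  have v1: "v differentiable (at x)" "bnd 2 G L (dd i v)" "bnd 1 (s * L) L (dd j (dd i v))" for x i j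
    using v by (auto simp: admissible_def)
  have v2: "dd i v differentiable (at x)" for i x
    using v1(2)[of i] by (auto simp: numeral_2_eq_2)
  \<comment> \<open>The product \<open>b * e i\<close> contains \<open>b * c * z $ i / 2\<close>,
    which is \<open>a^2 / (2 * l)\<close> times the sine of the double phase times
    \<open>z $ i\<close>. It removes the cosine of the double phase that squaring the gradient of
    \<open>b\<close> produces.\<close>
  define e where "e = (\<lambda>i x. dd i v x + (z $ i / 2) * c x)"
  have ed: "e i differentiable (at x)" "dd j (e i) x = dd j (dd i v) x + dd j c x * z $ i / 2" for i j x
  proof -
    have *: "(\<lambda>x. (z $ i / 2) * c x) differentiable (at x)"
      by (rule differentiable_mult[OF differentiable_const cd(1)])
    show "e i differentiable (at x)" unfolding e_def by (rule differentiable_add[OF v2 *])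
    show "dd j (e i) x = dd j (dd i v) x + dd j c x * z $ i / 2"
      unfolding e_def dd_add[OF v2 *] dd_cmult[OF cd(1)] by simp
  qed
  have eb: "bnd 2 (3 * G) l (e i)" for i
  proof -
    have "bnd 2 (G + \<bar>z $ i / 2\<bar> * (4 * s)) l (e i)"
      unfolding e_def using h by (intro bnd_add bnd_cmult cb bnd_mono[OF v1(2)]) auto
    moreover have "\<bar>z $ i / 2\<bar> * (4 * s) \<le> (1/2) * (4 * s)" 
      using z[of i] h by (intro mult_right_mono) auto
    then have "G + \<bar>z $ i / 2\<bar> * (4 * s) \<le> 3 * G" using h by linarith
    ultimately show ?thesis using l bnd_mono[of 2 _ l "e i" "3 * G" l] by simp
  qed
  define \<omega> where "\<omega> = (\<lambda>i x. - (b x * e i x))"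
  have wb: "bnd 2 (192 * s * G / l) l (\<omega> i)" for i
  proof -
    have "bnd 2 (2^2 * ((16 * s / l) * (3 * G))) l (\<omega> i)"
      unfolding \<omega>_def by (intro bnd_uminus bnd_mult bnd_le[OF bb] eb) simp
    then show ?thesis by (simp add: algebra_simps)
  qed
  have wd: "(\<lambda>x. w i x + \<omega> i x) differentiable (at x)"
    "dd j (\<lambda>x. w i x + \<omega> i x) x = dd j (w i) x - (dd j b x * (dd i v x + c x * z $ i / 2)
       + b x * (dd j (dd i v) x + dd j c x * z $ i / 2))" for i j x
  proof -
    have *: "(\<lambda>x. b x * e i x) differentiable (at x)" by (intro differentiable_mult bd ed)
    have "(\<lambda>x. - (b x * e i x)) differentiable (at x)"
      "dd j (\<lambda>x. - (b x * e i x)) x = - dd j (\<lambda>x. b x * e i x) x"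
      using differentiable_minus[OF *] dd_cmult[OF *, of j "-1"] by auto
    then have 1: "\<omega> i differentiable (at x)" "dd j (\<omega> i) x = - (b x * dd j (e i) x + dd j b x * e i x)"
      by (auto simp: \<omega>_def dd_mult bd ed)
    show "(\<lambda>x. w i x + \<omega> i x) differentiable (at x)" using 1 w by auto
    show "dd j (\<lambda>x. w i x + \<omega> i x) x = dd j (w i) x - (dd j b x * (dd i v x + c x * z $ i / 2)
       + b x * (dd j (dd i v) x + dd j c x * z $ i / 2))"
    proof -
      have "e i x = dd i v x + z $ i / 2 * c x" by (simp add: e_def)
      then show ?thesis using 1 w by (simp add: dd_add ed algebra_simps)
    qed
  qed
  have err: "\<bar>vk_metric (\<lambda>x. v x + b x) (\<lambda>i x. w i x + \<omega> i x) i j x - vk_metric v w i j x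
      - (a x)^2 * z $ i * z $ j\<bar> \<le> 8 * s^2 * L / l" for i j x
  proof -
    define k where "k = 1 / l"
    have k: "k * l = 1" "0 < k" using l by (auto simp: k_def)
    let ?t1 = "k * (dd i a x * S x) * (k * (dd j a x * S x))"
    let ?t2 = "c x * (k * (dd i a x * S x) * z $ j + k * (dd j a x * S x) * z $ i)"
    let ?t3 = "b x * C x * (dd j a x * z $ i + dd i a x * z $ j)"
    let ?t4 = "b x * (dd j (dd i v) x + dd i (dd j v) x)"
    have "vk_metric (\<lambda>x. v x + b x) (\<lambda>i x. w i x + \<omega> i x) i j x - vk_metric v w i j x
      - (a x)^2 * z $ i * z $ j = 2 * ?t1 + 3/2 * ?t2 - 1/4 * ?t3 - 1/2 * ?t4" (is "?E = _")
      unfolding vk_metric_def wd dd_add[OF v1(1) bd(1)]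
    proof (rule corrugation_identity[OF k(1) SC])
      show "b x = 2 * k * (a x * S x)" by (simp add: b_def k_def)
      show "c x = a x * C x" by (simp add: c_def)
    qed (simp_all only: bd(2) cd(2) k_def)
    then have E: "\<bar>?E\<bar> = \<bar>2 * ?t1 + 3/2 * ?t2 - 1/4 * ?t3 - 1/2 * ?t4\<bar>" by simp
    have sn: "\<bar>S x\<bar> \<le> 1" "\<bar>C x\<bar> \<le> 1" by (auto simp: S_def C_def)
    have a0: "\<bar>a x\<bar> \<le> s" using bnd_bound[OF a] .
    have a1: "\<bar>dd i a x\<bar> \<le> s * L" for i
      using a bnd_bound[of 2 "s * L" L "dd i a"] by (auto simp: numeral_3_eq_3 numeral_2_eq_2)
    have aS: "\<bar>k * (dd i a x * S x)\<bar> \<le> k * (s * L)" for i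
    proof -
      have "\<bar>dd i a x * S x\<bar> \<le> (s * L) * 1"
        unfolding abs_mult using a1 sn h by (intro mult_mono) auto
      then show ?thesis using k by (simp add: abs_mult)
    qed
    have c0: "\<bar>c x\<bar> \<le> s" unfolding c_def abs_mult using mult_mono[OF a0 sn(2)] h by auto
    have b0: "\<bar>b x\<bar> \<le> 2 * k * s"
    proof -
      have "\<bar>a x * S x\<bar> \<le> s * 1"
        unfolding abs_mult using a0 sn h by (intro mult_mono) auto
      then show ?thesis using k by (simp add: b_def k_def abs_mult divide_right_mono)
    qed
    have z1: "\<bar>z $ i\<bar> \<le> 1" "\<bar>z $ j\<bar> \<le> 1" using z by auto
    have v3: "\<bar>dd i (dd j v) x\<bar> \<le> s * L" for i j using bnd_bound[OF v1(3)] .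
    \<comment> \<open>The common size of the four error terms, which are at most 1, 2, 4 and 4 times
      \<open>q\<close>; with the weights 2, 3/2, 1/4 and 1/2 the total is 8.\<close>
    define q where "q = k * s^2 * L"
    have "k * L \<le> 1" using h l by (simp add: k_def)
    then have "(k * L) * (k * L * s^2) \<le> 1 * (k * L * s^2)" using k h by (intro mult_right_mono) auto
    then have "(k * (s * L)) * (k * (s * L)) \<le> q"
      by (simp add: q_def power2_eq_square algebra_simps)
    then have "\<bar>?t1\<bar> \<le> q"
      using abs_mult_le[OF aS[of i] aS[of j]] by linarith
    moreover have "\<bar>?t2\<bar> \<le> s * ((k * (s * L)) * 1 + (k * (s * L)) * 1)"
      by (intro abs_mult_le c0 abs_add_le aS z1)
    then have "\<bar>?t2\<bar> \<le> 2 * q" by (simp add: q_def power2_eq_square algebra_simps)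
    moreover have "\<bar>?t3\<bar> \<le> (2 * k * s) * 1 * ((s * L) * 1 + (s * L) * 1)"
      by (intro abs_mult_le b0 sn abs_add_le a1 z1)
    then have "\<bar>?t3\<bar> \<le> 4 * q" by (simp add: q_def power2_eq_square algebra_simps)
    moreover have "\<bar>?t4\<bar> \<le> (2 * k * s) * (s * L + s * L)"
      by (intro abs_mult_le b0 abs_add_le v3)
    then have "\<bar>?t4\<bar> \<le> 4 * q" by (simp add: q_def power2_eq_square algebra_simps)
    ultimately have "\<bar>2 * ?t1 + 3/2 * ?t2 - 1/4 * ?t3 - 1/2 * ?t4\<bar> \<le> 8 * q" by linarith
    moreover have "8 * s^2 * L / l = 8 * q" by (simp add: k_def q_def)
    ultimately show ?thesis unfolding E by linarith
  qed
  show ?thesis using bb wb err by blast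
qed


section \<open>Several corrugations in succession\<close>

definition corrugation_result where
  "corrugation_result C s G L K N a z v w b \<omega> \<longleftrightarrow>
     correction (C * s) L (K^N * L) b \<and> (\<forall>i. correction (C * s * G) L (K^N * L) (\<omega> i)) \<and>
     admissible (C * s) (C * G) (K^N * L) (\<lambda>x. v x + b x) \<and>
     (\<forall>i j x. \<bar>vk_metric (\<lambda>x. v x + b x) (\<lambda>i x. w i x + \<omega> i x) i j x - vk_metric v w i j x
        - (\<Sum>k<N. (a k x)^2 * z k $ i * z k $ j)\<bar> \<le> C * s^2 / K)"

text \<open>\<open>C\<close> may depend on the number of directions only. Uniformity in
  \<open>s\<close>, \<open>G\<close>, \<open>L\<close> and \<open>K\<close> lets one constant serve
  every stage.\<close>

definition corrugation_constant :: "nat \<Rightarrow> real \<Rightarrow> bool" where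
  "corrugation_constant N C \<longleftrightarrow> (\<forall>s G L K a z v w.
     0 < s \<longrightarrow> s \<le> G \<longrightarrow> 1 \<le> G \<longrightarrow> 0 < L \<longrightarrow> 1 \<le> K \<longrightarrow>
     (\<forall>k<N. bnd 3 s L (a k) \<and> (\<forall>i. \<bar>z k $ i\<bar> \<le> 1)) \<longrightarrow> admissible s G L v \<longrightarrow>
     (\<forall>i x. w i differentiable (at x)) \<longrightarrow> (\<exists>b \<omega>. corrugation_result C s G L K N a z v w b \<omega>))"

lemma corrugation_constantD:
  assumes "corrugation_constant N C" "0 < s" "s \<le> G" "1 \<le> G" "0 < L" "1 \<le> K"
    and "\<forall>k<N. bnd 3 s L (a k) \<and> (\<forall>i. \<bar>z k $ i\<bar> \<le> 1)" "admissible s G L v"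
    and "\<forall>i x. w i differentiable (at x)"
  obtains b \<omega> where "corrugation_result C s G L K N a z v w b \<omega>"
  using assms unfolding corrugation_constant_def by blast

text \<open>The directions are treated one after another at the frequencies \<open>K * L\<close>,
  ..., \<open>K^N * L\<close>. To each new oscillation the earlier ones look slow, with frequency
  ratio \<open>K\<close>, so every step errs by a multiple of \<open>s^2 / K\<close>; the price is
  the final frequency \<open>K^N * L\<close>.\<close>

lemma corrugation_steps: "\<exists>C\<ge>1. corrugation_constant N C"
proof (induction N)
  case 0
  have "correction s L L (\<lambda>x. 0)" if "0 < s" "0 < L" for s L
    using that bnd_const[of 0 s L 1] by (simp add: correction_def ext[of "dd i (\<lambda>x. 0)" "\<lambda>x. 0" for i])
  then show ?case
    unfolding corrugation_constant_def corrugation_result_def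
    by (intro exI[of _ 1] conjI allI impI exI[of _ "\<lambda>x. 0"] exI[of _ "\<lambda>i x. 0"]) auto
next
  case (Suc N)
  then obtain C where C: "1 \<le> C" and IH: "corrugation_constant N C" by blast
  have C2: "C \<le> C^2" using C by (simp add: power2_eq_square)
  show ?case
    unfolding corrugation_constant_def
  \<comment> \<open>Any factor from 193 on would do: the in-plane constant becomes
    \<open>C + 192 * C^2\<close>, and the others, \<open>17 * C\<close> and
    \<open>C + 8 * C^2\<close>, are smaller.\<close>
  proof (intro exI[of _ "300 * C^2"] conjI allI impI)
    show "1 \<le> 300 * C^2" using C C2 by linarith
    fix s G L K :: real and a :: "nat \<Rightarrow> real^2 \<Rightarrow> real" and z :: "nat \<Rightarrow> real^2"
      and v :: "real^2 \<Rightarrow> real" and w :: "2 \<Rightarrow> real^2 \<Rightarrow> real"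
    assume h: "0 < s" "s \<le> G" "1 \<le> G" "0 < L" "1 \<le> K"
      and a: "\<forall>k<Suc N. bnd 3 s L (a k) \<and> (\<forall>i. \<bar>z k $ i\<bar> \<le> 1)"
      and v: "admissible s G L v" and w: "\<forall>i x. w i differentiable (at x)"
    have a': "\<forall>k<N. bnd 3 s L (a k) \<and> (\<forall>i. \<bar>z k $ i\<bar> \<le> 1)" using a by simp
    obtain b \<omega> where R: "corrugation_result C s G L K N a z v w b \<omega>"
      by (rule corrugation_constantD[OF IH h a' v w])
    note R = R[unfolded corrugation_result_def]
    note b = R[THEN conjunct1] and \<omega> = R[THEN conjunct2, THEN conjunct1, rule_format]
      and v1 = R[THEN conjunct2, THEN conjunct2, THEN conjunct1]
      and E = R[THEN conjunct2, THEN conjunct2, THEN conjunct2, rule_format]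
    define s1 where "s1 = C * s"
    define G1 where "G1 = C * G"
    define L1 where "L1 = K^N * L"
    define l where "l = K^Suc N * L"
    have K1: "1 \<le> K^N" using h by simp
    have L1: "L \<le> L1" "0 < L1" "L1 \<le> l" "l = K * L1"
      using h K1 by (auto simp: L1_def l_def mult_le_cancel_right1)
    have s1: "s \<le> s1" "0 < s1" "s1 \<le> G1"
      using C h by (auto simp: s1_def G1_def)
    have w1: "(\<lambda>x. w i x + \<omega> i x) differentiable (at x)" for i x
      using w \<omega> by (auto simp: correction_def)
    have aN: "bnd 3 s1 L1 (a N)" using a L1 s1 h by (auto intro: bnd_mono)
    obtain b' \<omega>' where b': "bnd 3 (16 * s1 / l) l b'" and \<omega>': "\<And>i. bnd 2 (192 * s1 * G1 / l) l (\<omega>' i)"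
      and E': "\<And>i j x. \<bar>vk_metric (\<lambda>x. (v x + b x) + b' x) (\<lambda>i x. (w i x + \<omega> i x) + \<omega>' i x) i j x
          - vk_metric (\<lambda>x. v x + b x) (\<lambda>i x. w i x + \<omega> i x) i j x
          - (a N x)^2 * z N $ i * z N $ j\<bar> \<le> 8 * s1^2 * L1 / l"
      using corrugation_step[OF s1(2,3) L1(2,3) _ aN v1[folded s1_def G1_def L1_def], of "z N" "\<lambda>i x. w i x + \<omega> i x"]
        w1 a by blast
    have l0: "0 < l" using L1 by linarith
    have Ll: "L \<le> l" using L1 by linarith
    have Cs: "C * s \<le> C^2 * s" "0 \<le> C^2 * s" using C2 C h by (auto intro!: mult_right_mono)
    have CsG: "C * s * G \<le> C^2 * s * G" "0 \<le> C^2 * s * G" using Cs h by (auto intro!: mult_right_mono)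
    have "correction (C * s + 16 * s1) L l (\<lambda>x. b x + b' x)"
      using h L1 s1 Ll by (intro correction_add[OF b[folded L1_def]] correction_bnd bnd_le[OF b']) auto
    then have 1: "correction (300 * C^2 * s) L l (\<lambda>x. b x + b' x)"
    proof (rule correction_mono)
      show "C * s + 16 * s1 \<le> 300 * C^2 * s" using Cs unfolding s1_def by linarith
    qed (use h l0 in auto)
    have "correction (C * s * G + 192 * s1 * G1) L l (\<lambda>x. \<omega> i x + \<omega>' i x)" for i
      using h L1 s1 Ll by (intro correction_add[OF \<omega>[folded L1_def]] correction_bnd \<omega>') auto
    moreover have "C * s * G + 192 * s1 * G1 \<le> 300 * C^2 * s * G"
      using CsG by (simp add: s1_def G1_def power2_eq_square algebra_simps)
    ultimately have 2: "correction (300 * C^2 * s * G) L l (\<lambda>x. \<omega> i x + \<omega>' i x)" for i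
      using h l0 correction_mono less_imp_le by blast
    have "admissible (17 * s1) (17 * G1) l (\<lambda>x. (v x + b x) + b' x)"
      by (rule admissible_add[OF v1[folded s1_def G1_def L1_def] b' s1(2,3) L1(2,3)])
    moreover have "17 * s1 \<le> 300 * C^2 * s" using Cs by (simp add: s1_def)
    moreover have "C * G \<le> C^2 * G" using C2 h by (intro mult_right_mono) auto
    then have "17 * G1 \<le> 300 * C^2 * G" using h zero_le_power2[of C] mult_nonneg_nonneg[of "C^2" G]
      unfolding G1_def by linarith
    ultimately have 3: "admissible (300 * C^2 * s) (300 * C^2 * G) l (\<lambda>x. v x + (b x + b' x))"
      using admissible_mono[of "17 * s1" "17 * G1" l _ "300 * C^2 * s" "300 * C^2 * G" l] s1 l0
      unfolding add.assoc by simp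
    have 4: "\<bar>vk_metric (\<lambda>x. v x + (b x + b' x)) (\<lambda>i x. w i x + (\<omega> i x + \<omega>' i x)) i j x - vk_metric v w i j x
           - (\<Sum>k<Suc N. (a k x)^2 * z k $ i * z k $ j)\<bar> \<le> 300 * C^2 * s^2 / K" for i j x
    proof -
      have arith: "x \<le> y \<Longrightarrow> 0 \<le> y \<Longrightarrow> t = 8 * y \<Longrightarrow> x + t \<le> 300 * y" for x y t :: real
        by linarith
      define q where "q = s^2 / K"
      have "8 * s1^2 * L1 / l = 8 * (C^2 * q)"
        using L1 h by (simp add: s1_def q_def power_mult_distrib)
      moreover have "C * q \<le> C^2 * q" using C2 h by (intro mult_right_mono) (auto simp: q_def)
      moreover have "0 \<le> C^2 * q" using h by (simp add: q_def)
      ultimately have "C * q + 8 * s1^2 * L1 / l \<le> 300 * (C^2 * q)"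
        using arith[of "C * q" "C^2 * q" "8 * s1^2 * L1 / l"] by blast
      then have "C * s^2 / K + 8 * s1^2 * L1 / l \<le> 300 * C^2 * s^2 / K" by (simp add: q_def)
      with E[of i j x] E'[of i j x] show ?thesis
        unfolding add.assoc sum.lessThan_Suc by linarith
    qed
    show "\<exists>b \<omega>. corrugation_result (300 * C^2) s G L K (Suc N) a z v w b \<omega>"
      unfolding corrugation_result_def l_def[symmetric]
      by (intro exI[of _ "\<lambda>x. b x + b' x"] exI[of _ "\<lambda>i x. \<omega> i x + \<omega>' i x"] conjI allI 1 2 3 4)
  qed
qed

section \<open>One stage\<close>

text \<open>The regularity handed from stage to stage: bounds on first and second derivatives. The
  further derivatives that a corrugation asks for are regained by mollification.\<close>

definition C2b :: "real \<Rightarrow> real \<Rightarrow> (real^2 \<Rightarrow> real) \<Rightarrow> bool" where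
  "C2b G M f \<longleftrightarrow> (\<forall>x. f differentiable (at x)) \<and> (\<forall>i x. dd i f differentiable (at x) \<and> \<bar>dd i f x\<bar> \<le> G)
     \<and> (\<forall>i j. continuous_on UNIV (dd j (dd i f)) \<and> (\<forall>x. \<bar>dd j (dd i f) x\<bar> \<le> M))"

lemma C2bD:
  assumes "C2b G M f"
  shows "f differentiable (at x)" "dd i f differentiable (at x)" "\<bar>dd i f x\<bar> \<le> G"
    "continuous_on UNIV (dd j (dd i f))" "\<bar>dd j (dd i f) x\<bar> \<le> M" "continuous_on UNIV (dd i f)"
  using assms differentiable_imp_cont[of "dd i f"] unfolding C2b_def by blast+

lemma C2b_nonneg: assumes "C2b G M f" shows "0 \<le> G" "0 \<le> M"
  using C2bD(3)[OF assms, of 1 0] C2bD(5)[OF assms, of 1 1 0] by linarith+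

lemma C2b_mono: "C2b G M f \<Longrightarrow> G \<le> G' \<Longrightarrow> M \<le> M' \<Longrightarrow> C2b G' M' f"
  unfolding C2b_def by (meson order_trans)

lemma C2b_add_correction:
  assumes f: "C2b G M f" and b: "correction s L M' b"
  shows "C2b (G + s) (M + s * M') (\<lambda>x. f x + b x)"
proof -
  have bd: "b differentiable (at x)" "bnd (Suc 0) s M' (dd i b)" for x i using b by (auto simp: correction_def)
  have b2: "dd i b differentiable (at x)" "\<bar>dd i b x\<bar> \<le> s" "continuous_on UNIV (dd j (dd i b))"
      "\<bar>dd j (dd i b) x\<bar> \<le> s * M'" for i j x
    using bd(2)[of i] by auto
  have e1: "dd i (\<lambda>x. f x + b x) = (\<lambda>x. dd i f x + dd i b x)" for i
    using bd C2bD[OF f] by (auto simp: dd_add)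
  have e2: "dd j (\<lambda>x. dd i f x + dd i b x) = (\<lambda>x. dd j (dd i f) x + dd j (dd i b) x)" for i j
    using b2 C2bD[OF f] by (auto simp: dd_add)
  show ?thesis
    unfolding C2b_def e1 e2
    using bd(1) b2 C2bD[OF f] by (auto intro!: continuous_on_add abs_add_le)
qed

lemma C2b_moll:
  assumes f: "C2b G M f" and l: "0 < l"
  shows "dd i (moll l f) = moll l (dd i f)" "dd j (dd i (moll l f)) = moll l (dd j (dd i f))"
    "C2b G M (moll l f)" "bnd 3 G (2/l) (dd i (moll l f))" "bnd 3 M (2/l) (dd j (dd i (moll l f)))"
    "\<bar>moll l f x - f x\<bar> \<le> 12 * l * G" "\<bar>dd i (moll l f) x - dd i f x\<bar> \<le> 12 * l * M"
proof -
  note D = C2bD[OF f]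
  note 1 = moll_dd[where l=l, OF D(1) D(6)]
  note 2 = moll_dd[where l=l, OF D(2) D(4)]
  show e1: "dd i (moll l f) = moll l (dd i f)" for i by (rule 1)
  show e2: "dd j (dd i (moll l f)) = moll l (dd j (dd i f))" for i j by (simp add: 1 2)
  show "C2b G M (moll l f)"
    unfolding C2b_def e2 unfolding e1 using 1 2 l D
    by (auto intro!: moll_cont moll_bound)
  show "bnd 3 G (2/l) (dd i (moll l f))" unfolding e1 using D by (intro moll_smooth l) auto
  show "bnd 3 M (2/l) (dd j (dd i (moll l f)))" unfolding e2 using D by (intro moll_smooth l) auto
  show "\<bar>moll l f x - f x\<bar> \<le> 12 * l * G" using D l by (intro moll_near_dd) auto
  show "\<bar>dd i (moll l f) x - dd i f x\<bar> \<le> 12 * l * M" unfolding e1 using D l by (intro moll_near_dd) auto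
qed

definition moll_commutator :: "real \<Rightarrow> (real^2 \<Rightarrow> real) \<Rightarrow> (real^2 \<Rightarrow> real) \<Rightarrow> real^2 \<Rightarrow> real" where
  "moll_commutator l f g x = moll l (\<lambda>y. f y * g y) x - moll l f x * moll l g x"

lemma vk_metric_cont:
  assumes "C2b G M v" "\<And>i. C2b G' M' (w i)"
  shows "continuous_on UNIV (vk_metric v w i j)"
  unfolding vk_metric_def[abs_def] using C2bD(6)[OF assms(1)] C2bD(6)[OF assms(2)]
  by (intro continuous_intros) auto

text \<open>The part in \<open>w\<close> is linear and commutes with mollification. Only the
  quadratic part does not, and its commutator gains two powers of \<open>l\<close>.\<close>

lemma vk_metric_moll:
  assumes v: "C2b G M v" and w: "\<And>i. C2b G' M' (w i)" and l: "0 < l" and A: "continuous_on UNIV A"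
  shows "moll l A x - vk_metric (moll l v) (\<lambda>i. moll l (w i)) i j x
    = moll l (\<lambda>x. A x - vk_metric v w i j x) x + 1/2 * moll_commutator l (dd i v) (dd j v) x"
proof -
  note vc = C2bD(6)[OF v] and wc = C2bD(6)[OF w]
  have "vk_metric v w i j = (\<lambda>x. 1/2 * (dd i v x * dd j v x) + (1/2 * dd j (w i) x + 1/2 * dd i (w j) x))"
    by (auto simp: vk_metric_def)
  then have "moll l (vk_metric v w i j) x = 1/2 * moll l (\<lambda>x. dd i v x * dd j v x) x
      + (1/2 * moll l (dd j (w i)) x + 1/2 * moll l (dd i (w j)) x)"
    by (simp only: moll_add[OF continuous_on_mult[OF continuous_on_const] continuous_on_add[OF continuous_on_mult[OF continuous_on_const] continuous_on_mult[OF continuous_on_const]]]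
        moll_add[OF continuous_on_mult[OF continuous_on_const] continuous_on_mult[OF continuous_on_const]]
        moll_cmult vc wc continuous_on_mult)
  moreover have "moll l (\<lambda>x. A x - vk_metric v w i j x) x = moll l A x - moll l (vk_metric v w i j) x"
    by (rule moll_diff[OF A vk_metric_cont[OF v w]])
  ultimately show ?thesis
    unfolding vk_metric_def[of "moll l v"] C2b_moll(1)[OF v l] C2b_moll(1)[OF w l] moll_commutator_def
    by (simp add: field_simps)
qed

text \<open>The squares of these directions form a basis of the symmetric matrices in which the
  identity has the coefficients 3/4, 1/2, 1/2. All are positive, so they remain positive for
  matrices near the identity.\<close>

definition basic_dir :: "nat \<Rightarrow> real^2" where
  "basic_dir k = (if k = 0 then vector [1, 0] else if k = 1 then vector [1/2, 1] else vector [1/2, -1])"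

definition basic_coeff :: "(2 \<Rightarrow> 2 \<Rightarrow> real) \<Rightarrow> nat \<Rightarrow> real" where
  "basic_coeff N k = (if k = 0 then N 1 1 - N 2 2 / 4 else if k = 1 then N 2 2 / 2 + N 1 2 else N 2 2 / 2 - N 1 2)"

lemma basic_dir_le: "\<bar>basic_dir k $ i\<bar> \<le> 1"
  using exhaust_2[of i] by (auto simp: basic_dir_def)

lemma basic_decomposition:
  assumes "N 2 1 = N 1 2"
  shows "(\<Sum>k<3. basic_coeff N k * basic_dir k $ i * basic_dir k $ j) = N i j"
  using exhaust_2[of i] exhaust_2[of j] assms
  by (auto simp: basic_dir_def basic_coeff_def numeral_3_eq_3 field_simps)

text \<open>The smallest coefficient is at least 63/128 - 1/64 - 1/32, well above 1/4; the distance
  from 0 makes its square root as regular as \<open>N\<close>.\<close>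

lemma basic_coeff_bnd:
  assumes N: "\<And>i j. bnd n (1/32) L (\<lambda>x. N x i j - (if i = j then q else 0))" and q: "63/64 \<le> q" "q \<le> 1" and L: "0 \<le> L"
  shows "bnd n 2 L (\<lambda>x. basic_coeff (N x) k)" "1/4 \<le> basic_coeff (N x) k"
proof -
  define e where "e = (\<lambda>i j x. N x i j - (if i = j then q else 0))"
  have e: "bnd n (1/32) L (e i j)" for i j using N by (simp add: e_def)
  have e': "\<bar>e i j x\<bar> \<le> 1/32" for i j using bnd_bound[OF e] .
  have N1: "N x 1 1 = q + e 1 1 x" "N x 2 2 = q + e 2 2 x" "N x 1 2 = e 1 2 x" for x by (auto simp: e_def)
  show "1/4 \<le> basic_coeff (N x) k"
  proof -
    note e'' = e'[of 1 1] e'[of 2 2] e'[of 1 2] q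
    have "1/4 \<le> q + e 1 1 x - (q + e 2 2 x) / 4" using e'' by argo
    moreover have "1/4 \<le> (q + e 2 2 x) / 2 + e 1 2 x" using e'' by argo
    moreover have "1/4 \<le> (q + e 2 2 x) / 2 - e 1 2 x" using e'' by argo
    ultimately show ?thesis by (simp add: basic_coeff_def N1 split: if_split)
  qed
  have c: "bnd n 1 L (\<lambda>x. q)" using q L by (intro bnd_const) auto
  have 0: "bnd n ((1 + 1/32) + \<bar>-1/4\<bar> * (1 + 1/32)) L (\<lambda>x. (q + e 1 1 x) + (-1/4) * (q + e 2 2 x))"
    by (intro bnd_add bnd_cmult c e)
  have 1: "bnd n (\<bar>1/2\<bar> * (1 + 1/32) + 1/32) L (\<lambda>x. (1/2) * (q + e 2 2 x) + e 1 2 x)"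
    by (intro bnd_add bnd_cmult c e)
  have 2: "bnd n (\<bar>1/2\<bar> * (1 + 1/32) + 1/32) L (\<lambda>x. (1/2) * (q + e 2 2 x) - e 1 2 x)"
    by (intro bnd_add bnd_minus bnd_cmult c e)
  consider "k = 0" | "k = 1" | "k \<noteq> 0" "k \<noteq> 1" by blast
  then show "bnd n 2 L (\<lambda>x. basic_coeff (N x) k)"
  proof cases
    case 1 then show ?thesis using bnd_mono[OF 0 _ L order_refl, of 2] by (simp add: basic_coeff_def N1)
  next
    case 2 then show ?thesis using bnd_mono[OF \<open>bnd n _ L (\<lambda>x. (1/2) * (q + e 2 2 x) + e 1 2 x)\<close> _ L order_refl, of 2] by (simp add: basic_coeff_def N1)
  next
    case 3 then show ?thesis using bnd_mono[OF 2 _ L order_refl, of 2] by (simp add: basic_coeff_def N1)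
  qed
qed


definition stage_result where
  "stage_result C G H \<delta> K l A v w v' w' \<longleftrightarrow>
     C2b (G + C * sqrt \<delta>) (C * G * K^3 * sqrt \<delta> / l) v' \<and>
     (\<forall>i. C2b (H + C * G * sqrt \<delta>) (C * G * K^3 * sqrt \<delta> / l) (w' i)) \<and>
     (\<forall>x. \<bar>v' x - v x\<bar> \<le> C * l * G) \<and> (\<forall>i x. \<bar>w' i x - w i x\<bar> \<le> C * l * (G + H)) \<and>
     (\<forall>i x. \<bar>dd i v' x - dd i v x\<bar> \<le> C * sqrt \<delta>) \<and>
     (\<forall>i j x. \<bar>dd j (w' i) x - dd j (w i) x\<bar> \<le> C * G * sqrt \<delta>) \<and>
     (\<forall>i j x. \<bar>A i j x - vk_metric v' w' i j x - (if i = j then \<delta> / K else 0)\<bar> \<le> \<delta> / K / 64)"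

text \<open>The factor 300 keeps half the mollification commutator, \<open>882 (l M)\<^sup>2\<close>, below \<open>\<delta> / 64\<close>.\<close>

definition stage_constant :: "real \<Rightarrow> bool" where
  "stage_constant C \<longleftrightarrow> (\<forall>G H \<delta> K l M A v w.
    1 \<le> G \<longrightarrow> 0 < \<delta> \<longrightarrow> \<delta> \<le> 1 \<longrightarrow> 64 \<le> K \<longrightarrow> 0 < l \<longrightarrow> 300 * (l * M) \<le> sqrt \<delta> \<longrightarrow>
    (\<forall>i j. continuous_on UNIV (A i j) \<and> A i j = A j i) \<longrightarrow>
    C2b G M v \<longrightarrow> (\<forall>i. C2b H M (w i)) \<longrightarrow>
    (\<forall>i j x. \<bar>A i j x - vk_metric v w i j x - (if i = j then \<delta> else 0)\<bar> \<le> \<delta> / 64) \<longrightarrow>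
    (\<forall>i j x. \<bar>moll l (A i j) x - A i j x\<bar> \<le> \<delta> / (128 * K)) \<longrightarrow>
    (\<exists>v' w'. stage_result C G H \<delta> K l A v w v' w'))"

lemma stage_constantD:
  assumes "stage_constant C" "1 \<le> G" "0 < \<delta>" "\<delta> \<le> 1" "64 \<le> K" "0 < l" "300 * (l * M) \<le> sqrt \<delta>"
    and "\<forall>i j. continuous_on UNIV (A i j) \<and> A i j = A j i" "C2b G M v" "\<forall>i. C2b H M (w i)"
    and "\<forall>i j x. \<bar>A i j x - vk_metric v w i j x - (if i = j then \<delta> else 0)\<bar> \<le> \<delta> / 64"
    and "\<forall>i j x. \<bar>moll l (A i j) x - A i j x\<bar> \<le> \<delta> / (128 * K)"
  obtains v' w' where "stage_result C G H \<delta> K l A v w v' w'"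
  using assms(1)[unfolded stage_constant_def, THEN spec[of _ G], THEN spec[of _ H], THEN spec[of _ \<delta>],
      THEN spec[of _ K], THEN spec[of _ l], THEN spec[of _ M], THEN spec[of _ A], THEN spec[of _ v], THEN spec[of _ w]]
    assms(2-) that by blast

text \<open>A part \<open>(\<delta> / K) Id\<close> of the defect is deliberately kept as room for
  the next stage: only the mollified defect minus this part is decomposed, and exactly so. The new
  defect then differs from \<open>(\<delta> / K) Id\<close> by two errors of at most
  \<open>\<delta> / (128 * K)\<close>, one from mollifying \<open>A\<close> and one from the
  corrugations.\<close>

lemma stage: "\<exists>C\<ge>1. stage_constant C"
proof -
  obtain C2' where C2': "C2' \<ge> 0" "\<And>L f. 0 \<le> L \<Longrightarrow> bnd 3 2 L f \<Longrightarrow> (\<forall>x. 1/4 \<le> f x) \<Longrightarrow> bnd 3 C2' L (\<lambda>x. f x powr (1/2))"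
    using bnd_powr[of "1/4" 2 3 "1/2"] by auto
  define C2 where "C2 = max 1 C2'"
  have C2: "1 \<le> C2" "\<And>L f. 0 \<le> L \<Longrightarrow> bnd 3 2 L f \<Longrightarrow> (\<forall>x. 1/4 \<le> f x) \<Longrightarrow> bnd 3 C2 L (\<lambda>x. f x powr (1/2))"
    using bnd_mono[OF C2'(2) _ _ order_refl, of _ _ C2] by (simp_all add: C2_def)
  obtain C3 where C3: "1 \<le> C3" and steps: "corrugation_constant 3 C3"
    using corrugation_steps by blast
  define D where "D = C3 * C2^2"
  have D: "1 \<le> D" "C3 * C2 \<le> D" "0 < D"
  proof -
    have "1 * 1 \<le> C3 * C2^2" using C2 C3 by (intro mult_mono one_le_power) auto
    then show "1 \<le> D" by (simp add: D_def)
    show "C3 * C2 \<le> D" unfolding D_def using C2 C3 by (simp add: power2_eq_square)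
    show "0 < D" using \<open>1 \<le> D\<close> by simp
  qed
  \<comment> \<open>The 13 covers the mollification errors and the old second derivatives,
    \<open>D\<close> the corrections, and the last summand their second derivatives, of frequency
    \<open>K'^3 * L\<close> with \<open>K' = 128 * D * K\<close> and
    \<open>L = 2 / l\<close>.\<close>
  define C where "C = 13 + D + 2 * D * (128 * D)^3"
  have C: "13 + D \<le> C" using D by (simp add: C_def)
  show ?thesis
    unfolding stage_constant_def
  proof (intro exI[of _ C] conjI allI impI)
    show "1 \<le> C" using C D by linarith
    fix G H \<delta> K l M :: real and A v w
    assume G: "1 \<le> G" and \<delta>: "0 < \<delta>" "\<delta> \<le> 1" and K: "64 \<le> K" and l: "0 < l"
      and lM: "300 * (l * M) \<le> sqrt \<delta>"
      and A: "\<forall>i j. continuous_on UNIV (A i j) \<and> A i j = A j i"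
      and v: "C2b G M v" and w0: "\<forall>i. C2b H M (w i)"
      and def0: "\<forall>i j x. \<bar>A i j x - vk_metric v w i j x - (if i = j then \<delta> else 0)\<bar> \<le> \<delta> / 64"
      and mA: "\<forall>i j x. \<bar>moll l (A i j) x - A i j x\<bar> \<le> \<delta> / (128 * K)"
    have w: "C2b H M (w i)" for i using w0 by simp
    have Ac: "continuous_on UNIV (A i j)" for i j using A by blast
    have M: "0 \<le> M" using C2b_nonneg[OF v] by simp
    have sd: "0 < sqrt \<delta>" "sqrt \<delta> \<le> 1" "sqrt \<delta> * sqrt \<delta> = \<delta>" using \<delta> by auto
    define L where "L = 2 / l"
    have L: "0 < L" using l by (simp add: L_def)
    define V where "V = moll l v"
    define W where "W = (\<lambda>i. moll l (w i))"
    define E where "E = (\<lambda>i j x. moll l (\<lambda>x. A i j x - vk_metric v w i j x) x + 1/2 * moll_commutator l (dd i v) (dd j v) x)"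
    have E: "E i j x = moll l (A i j) x - vk_metric V W i j x" for i j x
      unfolding E_def V_def W_def by (rule vk_metric_moll[OF v w l Ac, symmetric])
    define q where "q = 1 - 1 / K"
    have q: "63/64 \<le> q" "q \<le> 1" using K by (auto simp: q_def field_simps)
    \<comment> \<open>After division by \<delta> the part to be removed is within 1/32 of
      \<open>q Id\<close>: 1/64 is due to the old defect, and less than 1/64 to the
      commutator.\<close>
    define N where "N = (\<lambda>x i j. (E i j x - (if i = j then \<delta> / K else 0)) / \<delta>)"
    have Nsym: "N x 2 1 = N x 1 2" for x
      using A by (simp add: N_def E vk_metric_def mult.commute add.commute)
    have Nb: "bnd 3 (1/32) L (\<lambda>x. N x i j - (if i = j then q else 0))" for i j
    proof -
      define h where "h = (\<lambda>x. A i j x - vk_metric v w i j x - (if i = j then \<delta> else 0))"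
      have c: "continuous_on UNIV (\<lambda>x. A i j x - vk_metric v w i j x)"
        by (intro continuous_on_diff Ac vk_metric_cont[OF v w])
      have hc: "continuous_on UNIV h" unfolding h_def by (intro continuous_on_diff c continuous_on_const)
      have 1: "bnd 3 (\<delta> / 64) L (moll l h)"
        unfolding L_def using def0 by (intro moll_smooth l hc) (simp add: h_def)
      have 2: "bnd 3 (1764 * (l * M)^2) L (moll_commutator l (dd i v) (dd j v))"
        unfolding L_def moll_commutator_def[abs_def] using C2bD[OF v] by (intro bnd_moll_commutator l) auto
      have "bnd 3 (\<bar>1/\<delta>\<bar> * (\<delta> / 64 + \<bar>1/2\<bar> * (1764 * (l * M)^2))) L (\<lambda>x. (1/\<delta>) * (moll l h x + (1/2) * moll_commutator l (dd i v) (dd j v) x))"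
        by (intro bnd_cmult bnd_add 1 2)
      moreover have "\<bar>1/\<delta>\<bar> * (\<delta> / 64 + \<bar>1/2\<bar> * (1764 * (l * M)^2)) \<le> 1/32"
      proof -
        have "(300 * (l * M))^2 \<le> (sqrt \<delta>)^2" using lM l M by (intro power_mono) auto
        then have "90000 * (l * M)^2 \<le> \<delta>" using \<delta> by (simp add: power_mult_distrib)
        then show ?thesis using \<delta> by (simp add: field_simps)
      qed
      moreover have "(1/\<delta>) * (moll l h x + (1/2) * moll_commutator l (dd i v) (dd j v) x) = N x i j - (if i = j then q else 0)" for x
      proof -
        have "moll l h x = moll l (\<lambda>x. A i j x - vk_metric v w i j x) x - (if i = j then \<delta> else 0)"
          unfolding h_def by (simp add: moll_diff c moll_const)
        then show ?thesis unfolding N_def E_def q_def using \<delta> K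
          by (cases "i = j") (simp_all only: if_True if_False, simp_all add: diff_divide_distrib add_divide_distrib)
      qed
      ultimately show ?thesis using bnd_mono[of 3 _ L _ "1/32" L] L by simp
    qed
    define a where "a = (\<lambda>k x. sqrt \<delta> * (basic_coeff (N x) k) powr (1/2))"
    note cc = basic_coeff_bnd[OF Nb q less_imp_le[OF L]]
    define s where "s = C2 * sqrt \<delta>"
    have "sqrt \<delta> \<le> G" using sd(2) G by linarith
    then have s: "0 < s" "sqrt \<delta> \<le> s" "s \<le> C2 * G"
      using sd C2(1) mult_left_mono[of "sqrt \<delta>" G C2] by (auto simp: s_def mult_le_cancel_right1)
    have ab: "bnd 3 s L (a k)" for k
    proof -
      have "bnd 3 C2 L (\<lambda>x. basic_coeff (N x) k powr (1/2))"
        using cc L by (intro C2(2)) auto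
      from bnd_cmult[OF this] have "bnd 3 (\<bar>sqrt \<delta>\<bar> * C2) L (a k)" unfolding a_def .
      then show ?thesis using sd by (simp add: s_def mult.commute)
    qed
    have a2: "(\<Sum>k<3. (a k x)^2 * basic_dir k $ i * basic_dir k $ j) = E i j x - (if i = j then \<delta> / K else 0)" for i j x
    proof -
      have "(a k x)^2 = \<delta> * basic_coeff (N x) k" for k
      proof -
        have "0 \<le> basic_coeff (N x) k" using cc(2)[of x k] by linarith
        then have "(basic_coeff (N x) k powr (1/2))^2 = basic_coeff (N x) k" by (simp add: powr_half_sqrt)
        then show ?thesis using \<delta> by (simp add: a_def power_mult_distrib)
      qed
      then have "(\<Sum>k<3. (a k x)^2 * basic_dir k $ i * basic_dir k $ j)
          = \<delta> * (\<Sum>k<3. basic_coeff (N x) k * basic_dir k $ i * basic_dir k $ j)"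
        by (simp add: sum_distrib_left mult.assoc)
      also have "\<dots> = \<delta> * N x i j" by (simp add: basic_decomposition[OF Nsym])
      finally show ?thesis using \<delta> by (simp add: N_def)
    qed
    \<comment> \<open>The smallness of \<open>l * M\<close> serves a second time: it puts the
      Hessian of \<open>V\<close> below \<open>s * L\<close>, as \<open>admissible\<close>
      demands.\<close>
    have MsL: "M \<le> s * L"
    proof -
      have "l * M \<le> sqrt \<delta>" using lM l M mult_nonneg_nonneg[of l M] by linarith
      also have "\<dots> \<le> 2 * s" using s by linarith
      finally show ?thesis using l by (simp add: L_def field_simps)
    qed
    have V: "admissible s (C2 * G) L V"
    proof -
      have "G \<le> C2 * G" using C2 G by simp
      then have "bnd 2 (C2 * G) L (dd i V)" for i
      proof -
        have "bnd 2 G L (dd i V)"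
          unfolding V_def L_def by (rule bnd_le[OF C2b_moll(4)[OF v l]]) simp
        then show ?thesis by (rule bnd_mono[OF _ \<open>G \<le> C2 * G\<close>]) (use L in auto)
      qed
      moreover have "bnd 1 (s * L) L (dd j (dd i V))" for i j
      proof -
        have "bnd 1 M L (dd j (dd i V))"
          unfolding V_def L_def by (rule bnd_le[OF C2b_moll(5)[OF v l]]) simp
        then show ?thesis by (rule bnd_mono[OF _ MsL]) (use L in auto)
      qed
      ultimately show ?thesis using C2b_moll(3)[OF v l] by (simp add: admissible_def C2b_def V_def)
    qed
    \<comment> \<open>Chosen so that the corrugation error \<open>C3 * s^2 / K'\<close> equals
      \<open>\<delta> / (128 * K)\<close>.\<close>
    define K' where "K' = 128 * D * K"
    have K': "1 \<le> K'" using mult_mono[of 1 D 64 K] D K by (simp add: K'_def)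
    have Wd: "\<forall>i x. W i differentiable (at x)" using C2b_moll(3)[OF w l] by (simp add: C2b_def W_def)
    have G2: "1 \<le> C2 * G" using C2 G mult_mono[of 1 C2 1 G] by simp
    have aa: "\<forall>k<3. bnd 3 s L (a k) \<and> (\<forall>i. \<bar>basic_dir k $ i\<bar> \<le> 1)" using ab basic_dir_le by blast
    obtain b \<omega> where R: "corrugation_result C3 s (C2 * G) L K' 3 a basic_dir V W b \<omega>"
      by (rule corrugation_constantD[OF steps s(1,3) G2 L K' aa V Wd])
    note R = R[unfolded corrugation_result_def]
    note b = R[THEN conjunct1] and \<omega> = R[THEN conjunct2, THEN conjunct1, rule_format]
      and err = R[THEN conjunct2, THEN conjunct2, THEN conjunct2, rule_format]
    have C3s: "C3 * s \<le> D * sqrt \<delta>" using D(2) sd by (simp add: s_def)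
    have C3G: "C3 * s * (C2 * G) = D * G * sqrt \<delta>" by (simp add: s_def D_def power2_eq_square)
    define M' where "M' = C * G * K^3 * sqrt \<delta> / l"
    have M'ge: "M + (D * G * sqrt \<delta>) * (K'^3 * L) \<le> M'"
    proof -
      define T where "T = G * K^3 * sqrt \<delta> / l"
      have "300 * M \<le> sqrt \<delta> / l" using lM l by (simp add: field_simps)
      then have "M \<le> sqrt \<delta> / l" using M by linarith
      also have "\<dots> = 1 * (sqrt \<delta> / l)" by simp
      also have "\<dots> \<le> (G * K^3) * (sqrt \<delta> / l)"
        using mult_mono[of 1 G 1 "K^3"] G K l sd by (intro mult_right_mono) (auto simp: one_le_power)
      finally have MT: "M \<le> T" by (simp add: T_def)
      have T: "0 \<le> T" using G K l sd by (simp add: T_def)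
      have "(D * G * sqrt \<delta>) * (K'^3 * L) = (2 * D * (128 * D)^3) * T"
        by (simp add: K'_def L_def T_def power_mult_distrib)
      moreover have "M' = C * T" by (simp add: M'_def T_def)
      then have "M' = 13 * T + D * T + (2 * D * (128 * D)^3) * T" unfolding C_def by (simp only: distrib_right)
      moreover have "0 \<le> D * T" using T D by simp
      ultimately show ?thesis using MT T by linarith
    qed
    have KL: "0 \<le> K'^3 * L" using K' L by simp
    have GD: "D * sqrt \<delta> \<le> D * G * sqrt \<delta>" using G D sd by simp
    have b': "correction (D * G * sqrt \<delta>) L (K'^3 * L) b" "correction (D * sqrt \<delta>) L (K'^3 * L) b"
      using correction_mono[OF b _ L KL] C3s GD by auto
    have \<omega>': "correction (D * G * sqrt \<delta>) L (K'^3 * L) (\<omega> i)" for i using \<omega>[of i] unfolding C3G .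
    define v' where "v' = (\<lambda>x. V x + b x)"
    define w' where "w' = (\<lambda>i x. W i x + \<omega> i x)"
    have bd: "b differentiable (at x)" "\<omega> i differentiable (at x)" for i x using b \<omega>[of i] by (auto simp: correction_def)
    have Vd: "V differentiable (at x)" for x using V by (simp add: admissible_def)
    have bb: "\<bar>b x\<bar> \<le> D * G * sqrt \<delta> / L" "\<bar>\<omega> i x\<bar> \<le> D * G * sqrt \<delta> / L" 
       "\<bar>dd i b x\<bar> \<le> D * sqrt \<delta>" "\<bar>dd j (\<omega> i) x\<bar> \<le> D * G * sqrt \<delta>" for i j x
      using b' \<omega>'[of i] bnd_bound unfolding correction_def by blast+
    have bsm: "D * G * sqrt \<delta> / L \<le> D * l * G"
    proof -
      have "D * G * sqrt \<delta> / L = (D * l * G) * (sqrt \<delta> / 2)" by (simp add: L_def)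
      also have "sqrt \<delta> / 2 \<le> 1" using sd by linarith
      then have "(D * l * G) * (sqrt \<delta> / 2) \<le> (D * l * G) * 1"
        using D l G by (intro mult_left_mono) auto
      finally show ?thesis by simp
    qed
    have lM': "12 * l * M \<le> sqrt \<delta>" using lM l M mult_nonneg_nonneg[of l M] by linarith
    have DC: "D * x + 13 * x \<le> C * x" if "0 \<le> x" for x
      using mult_right_mono[OF C that] by (simp add: distrib_right)
    have P1: "C2b (G + C * sqrt \<delta>) M' v'"
    proof -
      have "C2b (G + D * sqrt \<delta>) (M + D * sqrt \<delta> * (K'^3 * L)) v'"
        unfolding v'_def V_def by (rule C2b_add_correction[OF C2b_moll(3)[OF v l] b'(2)])
      moreover have "D * sqrt \<delta> * (K'^3 * L) \<le> D * G * sqrt \<delta> * (K'^3 * L)"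
        using GD KL by (rule mult_right_mono)
      then have "M + D * sqrt \<delta> * (K'^3 * L) \<le> M'" using M'ge by linarith
      moreover have "G + D * sqrt \<delta> \<le> G + C * sqrt \<delta>" using DC[of "sqrt \<delta>"] sd by linarith
      ultimately show ?thesis using C2b_mono by blast
    qed
    have P2: "C2b (H + C * G * sqrt \<delta>) M' (w' i)" for i
    proof -
      have "C2b (H + D * G * sqrt \<delta>) (M + D * G * sqrt \<delta> * (K'^3 * L)) (w' i)"
        unfolding w'_def W_def by (rule C2b_add_correction[OF C2b_moll(3)[OF w l] \<omega>'])
      moreover have "0 \<le> G * sqrt \<delta>" using G sd by simp
      then have "H + D * G * sqrt \<delta> \<le> H + C * G * sqrt \<delta>"
        using DC[of "G * sqrt \<delta>"] unfolding mult.assoc by linarith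
      ultimately show ?thesis using M'ge C2b_mono by blast
    qed
    have P3: "\<bar>v' x - v x\<bar> \<le> C * l * G" for x
    proof -
      have "\<bar>v' x - v x\<bar> \<le> 12 * l * G + D * l * G"
        using C2b_moll(6)[OF v l, of x] bb(1)[of x] bsm unfolding v'_def V_def by linarith
      also have "\<dots> \<le> C * l * G"
      proof -
        have "0 \<le> l * G" using l G by simp
        then show ?thesis using DC[of "l * G"] unfolding mult.assoc by linarith
      qed
      finally show ?thesis .
    qed
    have P4: "\<bar>w' i x - w i x\<bar> \<le> C * l * (G + H)" for i x
    proof -
      have H: "0 \<le> H" using C2b_nonneg[OF w] by simp
      have "\<bar>w' i x - w i x\<bar> \<le> 12 * l * H + D * l * G"
        using C2b_moll(6)[OF w l, of i x] bb(2)[of i x] bsm unfolding w'_def W_def by linarith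
      also have "\<dots> \<le> D * (l * (G + H)) + 13 * (l * (G + H))" 
        using D l G H by (simp add: algebra_simps)
      also have "\<dots> \<le> C * l * (G + H)" using DC[of "l * (G + H)"] l G H by (simp add: mult.assoc)
      finally show ?thesis .
    qed
    have P5: "\<bar>dd i v' x - dd i v x\<bar> \<le> C * sqrt \<delta>" for i x
    proof -
      have "dd i v' x = dd i V x + dd i b x" unfolding v'_def by (rule dd_add[OF Vd bd(1)])
      then have "\<bar>dd i v' x - dd i v x\<bar> \<le> sqrt \<delta> + D * sqrt \<delta>"
        using C2b_moll(7)[OF v l, of i x] bb(3)[of i x] lM' unfolding V_def by linarith
      then show ?thesis using DC[of "sqrt \<delta>"] sd by linarith
    qed
    have P6: "\<bar>dd j (w' i) x - dd j (w i) x\<bar> \<le> C * G * sqrt \<delta>" for i j x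
    proof -
      have "dd j (w' i) x = dd j (W i) x + dd j (\<omega> i) x" unfolding w'_def using Wd by (intro dd_add bd(2)) auto
      then have "\<bar>dd j (w' i) x - dd j (w i) x\<bar> \<le> sqrt \<delta> + D * (G * sqrt \<delta>)"
        using C2b_moll(7)[OF w l, of j i x] bb(4)[of j i x] lM' unfolding W_def by linarith
      moreover have "sqrt \<delta> \<le> G * sqrt \<delta>" using G sd by simp
      moreover have "0 \<le> G * sqrt \<delta>" using G sd by simp
      ultimately show ?thesis using DC[of "G * sqrt \<delta>"] unfolding mult.assoc by linarith
    qed
    have P7: "\<bar>A i j x - vk_metric v' w' i j x - (if i = j then \<delta> / K else 0)\<bar> \<le> \<delta> / K / 64" for i j x
    proof -
      have e: "C3 * s^2 / K' = \<delta> / (128 * K)"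
      proof -
        have "C3 * s^2 = D * \<delta>" using \<delta> by (simp add: s_def D_def power_mult_distrib)
        then show ?thesis using D(3) by (simp add: K'_def)
      qed
      have "\<bar>vk_metric v' w' i j x - vk_metric V W i j x - (E i j x - (if i = j then \<delta> / K else 0))\<bar> \<le> \<delta> / (128 * K)"
        using err[of i j x] unfolding a2 e v'_def w'_def .
      moreover have "\<bar>moll l (A i j) x - A i j x\<bar> \<le> \<delta> / (128 * K)" using mA by blast
      moreover have "\<delta> / K / 64 = 2 * (\<delta> / (128 * K))" by simp
      moreover have "\<bar>m' - m - (u - m - e)\<bar> \<le> t \<Longrightarrow> \<bar>u - a\<bar> \<le> t \<Longrightarrow> \<bar>a - m' - e\<bar> \<le> 2 * t" for m' m u e a t :: real
        by linarith
      ultimately show ?thesis unfolding E by metis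
    qed
    show "\<exists>v' w'. stage_result C G H \<delta> K l A v w v' w'"
      unfolding stage_result_def
      using P1 P2 P3 P4 P5 P6 P7 unfolding M'_def by blast
  qed
qed

section \<open>Iteration\<close>

lemma geometric_limit:
  fixes u :: "nat \<Rightarrow> real"
  assumes u: "\<And>n. \<bar>u (Suc n) - u n\<bar> \<le> a * q^n" and q: "0 \<le> q" "q < 1"
  obtains l where "u \<longlonglongrightarrow> l" "\<And>n. \<bar>u n - l\<bar> \<le> a * q^n / (1 - q)"
proof -
  have "summable (\<lambda>n. u (Suc n) - u n)"
    by (rule summable_comparison_test'[of "\<lambda>n. a * q^n" 0]) (use u q in \<open>auto intro: summable_mult summable_geometric\<close>)
  then have "(\<lambda>n. \<Sum>k<n. u (Suc k) - u k) \<longlonglongrightarrow> (\<Sum>k. u (Suc k) - u k)"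
    by (rule summable_LIMSEQ)
  then have "(\<lambda>n. u n - u 0) \<longlonglongrightarrow> (\<Sum>k. u (Suc k) - u k)"
    by (simp add: sum_lessThan_telescope)
  from tendsto_add[OF this tendsto_const[of "u 0"]]
  have l: "u \<longlonglongrightarrow> (\<Sum>k. u (Suc k) - u k) + u 0" (is "_ \<longlonglongrightarrow> ?l") by simp
  have "\<bar>u n - ?l\<bar> \<le> a * q^n / (1 - q)" for n
  proof -
    have a: "0 \<le> a" using order_trans[OF abs_ge_zero u[of 0]] by simp
    have 1: "\<bar>u (n + m) - u n\<bar> \<le> a * q^n * (\<Sum>k<m. q^k)" for m
    proof (induction m)
      case (Suc m)
      have "\<bar>u (n + Suc m) - u (n + m)\<bar> \<le> a * q^n * q^m" using u[of "n + m"] by (simp add: power_add)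
      with Suc show ?case by (simp add: distrib_left)
    qed simp
    have "\<bar>u (m + n) - u n\<bar> \<le> a * q^n / (1 - q)" for m
    proof -
      have "(\<Sum>k<m. q^k) \<le> 1 / (1 - q)"
        using q sum_le_suminf[OF summable_geometric[of q], of "{..<m}"] by (simp add: suminf_geometric)
      then have "a * q^n * (\<Sum>k<m. q^k) \<le> a * q^n * (1 / (1 - q))"
        using a q by (intro mult_left_mono) auto
      with 1[of m] show ?thesis by (simp add: add.commute)
    qed
    moreover have "(\<lambda>m. \<bar>u (m + n) - u n\<bar>) \<longlonglongrightarrow> \<bar>?l - u n\<bar>"
      by (intro tendsto_intros LIMSEQ_ignore_initial_segment l)
    ultimately have "\<bar>?l - u n\<bar> \<le> a * q^n / (1 - q)"
      by (intro LIMSEQ_le_const2[of _ "\<bar>?l - u n\<bar>"]) auto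
    then show ?thesis by (simp add: abs_minus_commute)
  qed
  with l show thesis by (rule that)
qed

lemma power_powr_swap: "0 < x \<Longrightarrow> (x ^ n) powr a = (x powr a) ^ n" for x a :: real
  by (induction n) (simp_all add: powr_mult)

lemma interpolate_powr:
  fixes x p r \<alpha> :: real
  assumes "\<bar>x\<bar> \<le> p" "\<bar>x\<bar> \<le> r" "0 \<le> \<alpha>" "\<alpha> \<le> 1"
  shows "\<bar>x\<bar> \<le> p powr (1 - \<alpha>) * r powr \<alpha>"
proof (cases "x = 0")
  case False
  then have "\<bar>x\<bar> = \<bar>x\<bar> powr (1 - \<alpha>) * \<bar>x\<bar> powr \<alpha>" by (simp flip: powr_add)
  also have "\<dots> \<le> p powr (1 - \<alpha>) * r powr \<alpha>"
    using assms by (intro mult_mono powr_mono2) auto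
  finally show ?thesis .
qed simp

lemma C2b_lipschitz:
  assumes "C2b G M f" shows "\<bar>dd i f x - dd i f y\<bar> \<le> 2 * M * dist x y"
  using C2bD[OF assms] by (intro lipschitz_dd) auto

text \<open>Increments of the gradient are at most \<open>a * q^n\<close>, and they are Lipschitz
  with a constant of order \<open>m * t^n\<close>. Interpolating between these bounds gives Hoelder
  increments of ratio \<open>q powr (1 - \<alpha>) * t powr \<alpha>\<close>, which is summable even
  when the Lipschitz constants diverge.\<close>

lemma C1_limit:
  fixes f :: "nat \<Rightarrow> real^2 \<Rightarrow> real"
  assumes f: "\<And>n. C2b G (m * t^n) (f n)"
    and e: "\<And>n x. \<bar>f (Suc n) x - f n x\<bar> \<le> e * (1/2)^n"
    and d: "\<And>n i x. \<bar>dd i (f (Suc n)) x - dd i (f n) x\<bar> \<le> a * q^n"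
    and q: "0 < q" "q < 1" and t: "1 \<le> t" and m: "0 \<le> m" and \<alpha>: "0 < \<alpha>" "\<alpha> < 1"
    and s: "q powr (1 - \<alpha>) * t powr \<alpha> < 1"
  shows "\<exists>g. (\<forall>x. \<bar>g x - f 0 x\<bar> \<le> 2 * e \<and> g differentiable (at x)) \<and> (\<forall>i x. \<bar>dd i g x\<bar> \<le> G)
    \<and> (\<forall>i. \<exists>C. \<forall>x y. \<bar>dd i g x - dd i g y\<bar> \<le> C * dist x y powr \<alpha>)
    \<and> (\<forall>i x. (\<lambda>n. dd i (f n) x) \<longlonglongrightarrow> dd i g x)"
proof -
  have "\<exists>l. (\<lambda>n. dd i (f n) x) \<longlonglongrightarrow> l \<and> (\<forall>n. \<bar>dd i (f n) x - l\<bar> \<le> a * q^n / (1 - q))" for i x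
    by (rule geometric_limit[of "\<lambda>n. dd i (f n) x" a q]) (use d q in auto)
  then obtain g' where g': "\<And>i x. (\<lambda>n. dd i (f n) x) \<longlonglongrightarrow> g' i x"
      "\<And>i x n. \<bar>dd i (f n) x - g' i x\<bar> \<le> a * q^n / (1 - q)" by metis
  have "\<exists>l. (\<lambda>n. f n x) \<longlonglongrightarrow> l \<and> (\<forall>n. \<bar>f n x - l\<bar> \<le> e * (1/2)^n / (1 - 1/2))" for x
    by (rule geometric_limit[of "\<lambda>n. f n x" e "1/2"]) (use e in auto)
  then obtain g0 where g0: "\<And>x. (\<lambda>n. f n x) \<longlonglongrightarrow> g0 x"
      "\<And>x n. \<bar>f n x - g0 x\<bar> \<le> e * (1/2)^n / (1 - 1/2)" by metis
  have "\<exists>g. \<forall>x\<in>UNIV. (\<lambda>n. f n x) \<longlonglongrightarrow> g x \<and> (g has_derivative (\<lambda>h. g' 1 x * h$1 + g' 2 x * h$2)) (at x within UNIV)"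
  proof (rule has_derivative_sequence)
    show "(f n has_derivative (\<lambda>h. dd 1 (f n) x * h$1 + dd 2 (f n) x * h$2)) (at x within UNIV)" for n x
      using has_derivative_dd[OF C2bD(1)[OF f]] by simp
    fix r :: real assume r: "0 < r"
    have "(\<lambda>n. a * q^n / (1 - q)) \<longlonglongrightarrow> a * 0 / (1 - q)"
      using q by (intro tendsto_intros LIMSEQ_power_zero) auto
    then have "\<forall>\<^sub>F n in sequentially. a * q^n / (1 - q) < r / 2"
      using r by (intro order_tendstoD) auto
    then show "\<forall>\<^sub>F n in sequentially. \<forall>x\<in>UNIV. \<forall>h::real^2. norm ((dd 1 (f n) x * h$1 + dd 2 (f n) x * h$2) - (g' 1 x * h$1 + g' 2 x * h$2)) \<le> r * norm h"
    proof eventually_elim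
      case (elim n)
      show ?case
      proof (intro ballI allI)
        fix x h :: "real^2"
        have *: "\<bar>(dd i (f n) x - g' i x) * h $ i\<bar> \<le> r / 2 * norm h" for i
        proof (rule abs_mult_le)
          show "\<bar>dd i (f n) x - g' i x\<bar> \<le> r / 2"
            using g'(2)[where i=i and x=x and n=n] elim by linarith
        qed (rule component_le_norm_cart)
        have "(dd 1 (f n) x * h$1 + dd 2 (f n) x * h$2) - (g' 1 x * h$1 + g' 2 x * h$2)
          = (dd 1 (f n) x - g' 1 x) * h$1 + (dd 2 (f n) x - g' 2 x) * h$2" by (simp add: algebra_simps)
        then show "norm ((dd 1 (f n) x * h$1 + dd 2 (f n) x * h$2) - (g' 1 x * h$1 + g' 2 x * h$2)) \<le> r * norm h"
          using abs_add_le[OF *[of 1] *[of 2]] by simp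
      qed
    qed
  qed (use g0(1)[of 0] in auto)
  then obtain g where g: "\<And>x. (\<lambda>n. f n x) \<longlonglongrightarrow> g x"
      "\<And>x. (g has_derivative (\<lambda>h. g' 1 x * h$1 + g' 2 x * h$2)) (at x)" by auto
  have gg: "g x = g0 x" for x using g(1) g0(1) LIMSEQ_unique by blast
  have ddg: "dd i g x = g' i x" for i x
    using dd_eqI[OF g(2), of i x] exhaust_2[of i] by (auto simp: axis_def)
  show ?thesis
  proof (intro exI[of _ g] conjI allI)
    show "\<bar>g x - f 0 x\<bar> \<le> 2 * e" for x
      using g0(2)[where x=x and n=0] by (simp add: gg abs_minus_commute)
    show "g differentiable (at x)" for x using g(2) by (auto simp: differentiable_def)
    show lim: "(\<lambda>n. dd i (f n) x) \<longlonglongrightarrow> dd i g x" for i x using g' ddg by simp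
    show "\<bar>dd i g x\<bar> \<le> G" for i x
      using tendsto_rabs[OF lim[of i x]] C2bD(3)[OF f] by (intro LIMSEQ_le_const2) auto
    define c where "c = (2 * a) powr (1 - \<alpha>) * (4 * (m * t)) powr \<alpha>"
    define \<sigma> where "\<sigma> = q powr (1 - \<alpha>) * t powr \<alpha>"
    have a0: "0 \<le> a" using order_trans[OF abs_ge_zero d[of 1 0 0]] by simp
    have \<sigma>: "0 \<le> \<sigma>" "\<sigma> < 1" using s by (auto simp: \<sigma>_def)
    show "\<exists>C. \<forall>x y. \<bar>dd i g x - dd i g y\<bar> \<le> C * dist x y powr \<alpha>" for i
    proof (intro exI allI)
      fix x y :: "real^2"
      define \<rho> where "\<rho> = dist x y"
      define u where "u = (\<lambda>n. dd i (f n) x - dd i (f n) y)"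
      have u: "\<bar>u (Suc n) - u n\<bar> \<le> (c * \<rho> powr \<alpha>) * \<sigma>^n" for n
      proof -
        have "\<bar>u (Suc n) - u n\<bar> \<le> 2 * (a * q^n)"
          using d[of i n x] d[of i n y] unfolding u_def by linarith
        moreover have "\<bar>u (Suc n) - u n\<bar> \<le> 4 * (m * t^Suc n) * \<rho>"
        proof -
          have "m * t^n * \<rho> \<le> m * t^Suc n * \<rho>"
            using m t by (intro mult_right_mono mult_left_mono power_increasing) (auto simp: \<rho>_def)
          moreover have "\<bar>u (Suc n)\<bar> \<le> 2 * (m * t^Suc n * \<rho>)" "\<bar>u n\<bar> \<le> 2 * (m * t^n * \<rho>)"
            using C2b_lipschitz[OF f[of "Suc n"], of i x y] C2b_lipschitz[OF f[of n], of i x y]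
            by (simp_all only: u_def \<rho>_def mult.assoc)
          ultimately show ?thesis by linarith
        qed
        ultimately have "\<bar>u (Suc n) - u n\<bar> \<le> (2 * (a * q^n)) powr (1 - \<alpha>) * (4 * (m * t^Suc n) * \<rho>) powr \<alpha>"
          using \<alpha> by (intro interpolate_powr) auto
        also have "\<dots> = (c * \<rho> powr \<alpha>) * ((q^n) powr (1 - \<alpha>) * (t^n) powr \<alpha>)"
          using a0 q m t by (simp add: c_def \<rho>_def powr_mult)
        also have "(q^n) powr (1 - \<alpha>) * (t^n) powr \<alpha> = \<sigma>^n"
          using q t by (simp add: \<sigma>_def power_mult_distrib power_powr_swap)
        finally show ?thesis .
      qed
      obtain l where l: "u \<longlonglongrightarrow> l" "\<And>n. \<bar>u n - l\<bar> \<le> (c * \<rho> powr \<alpha>) * \<sigma>^n / (1 - \<sigma>)"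
        using geometric_limit[OF u \<sigma>] by blast
      have "u \<longlonglongrightarrow> dd i g x - dd i g y" unfolding u_def by (intro tendsto_diff lim)
      then have leq: "l = dd i g x - dd i g y" using l(1) LIMSEQ_unique by blast
      have G0: "0 \<le> G" using C2b_nonneg[OF f] by blast
      \<comment> \<open>The series starts from \<open>f 0\<close>, whose own Hoelder bound
        interpolates between \<open>G\<close> and the Lipschitz constant at
        \<open>n = 0\<close>.\<close>
      have "\<bar>u 0\<bar> \<le> 2 * G" using C2bD(3)[OF f, of i 0 x] C2bD(3)[OF f, of i 0 y] unfolding u_def by linarith
      moreover have "\<bar>u 0\<bar> \<le> 2 * m * \<rho>" using C2b_lipschitz[OF f, of i 0 x y] by (simp add: u_def \<rho>_def)
      ultimately have "\<bar>u 0\<bar> \<le> (2 * G) powr (1 - \<alpha>) * (2 * m * \<rho>) powr \<alpha>"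
        using \<alpha> by (intro interpolate_powr) auto
      also have "\<dots> = (2 * G) powr (1 - \<alpha>) * (2 * m) powr \<alpha> * \<rho> powr \<alpha>"
        using m by (simp add: powr_mult \<rho>_def)
      finally have "\<bar>l\<bar> \<le> (2 * G) powr (1 - \<alpha>) * (2 * m) powr \<alpha> * \<rho> powr \<alpha> + c * \<rho> powr \<alpha> / (1 - \<sigma>)"
        using l(2)[of 0] by simp
      also have "\<dots> = ((2 * G) powr (1 - \<alpha>) * (2 * m) powr \<alpha> + c / (1 - \<sigma>)) * \<rho> powr \<alpha>"
        by (simp add: distrib_right)
      finally show "\<bar>dd i g x - dd i g y\<bar> \<le> ((2 * G) powr (1 - \<alpha>) * (2 * m) powr \<alpha> + c / (1 - \<sigma>)) * dist x y powr \<alpha>"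
        by (simp add: leq \<rho>_def)
    qed
  qed
qed

lemma moll_hoelder:
  assumes A: "\<And>x y. \<bar>A x - A y\<bar> \<le> H * dist x y powr \<beta>" and c: "continuous_on UNIV A"
    and b: "0 < \<beta>" "\<beta> < 1" and l: "0 < l" and H: "0 \<le> H"
  shows "\<bar>moll l A x - A x\<bar> \<le> 6 * H * l powr \<beta>"
proof (rule moll_near[OF c])
  fix y assume y: "dist y x \<le> 6 * l"
  have "\<bar>A y - A x\<bar> \<le> H * dist y x powr \<beta>" by (rule A)
  also have "\<dots> \<le> H * (6 * l) powr \<beta>"
    using y H b by (intro mult_left_mono powr_mono2) auto
  also have "\<dots> = H * (6 powr \<beta> * l powr \<beta>)" using l by (simp add: powr_mult)
  also have "(6::real) powr \<beta> \<le> 6 powr 1" using b by (intro powr_mono) auto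
  then have "H * (6 powr \<beta> * l powr \<beta>) \<le> H * (6 * l powr \<beta>)"
    using H by (intro mult_left_mono mult_right_mono) auto
  finally show "\<bar>A y - A x\<bar> \<le> 6 * H * l powr \<beta>" by simp
qed (use l in auto)

lemma hoelder_continuous:
  fixes A :: "real^2 \<Rightarrow> real"
  assumes A: "\<And>x y. \<bar>A x - A y\<bar> \<le> H * dist x y powr \<beta>" and b: "0 < \<beta>"
  shows "continuous_on UNIV A"
proof -
  have "(A \<longlongrightarrow> A x) (at x)" for x
  proof -
    have "((\<lambda>y. H * dist y x powr \<beta>) \<longlongrightarrow> H * 0 powr \<beta>) (at x)"
      using b by (intro tendsto_intros tendsto_powr') (auto intro!: tendsto_eq_intros)
    then have "((\<lambda>y. H * dist y x powr \<beta>) \<longlongrightarrow> 0) (at x)" by simp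
    then have "((\<lambda>y. A y - A x) \<longlongrightarrow> 0) (at x)"
      by (rule Lim_null_comparison[rotated]) (use A in auto)
    then show ?thesis by (simp add: LIM_zero_iff)
  qed
  then show ?thesis by (simp add: continuous_on_def continuous_at_imp_continuous_on isCont_def)
qed


definition C1h :: "real \<Rightarrow> (real^2 \<Rightarrow> real) \<Rightarrow> bool" where
  "C1h \<alpha> f \<longleftrightarrow> (\<forall>x. f differentiable (at x)) \<and> (\<exists>G. \<forall>i x. \<bar>dd i f x\<bar> \<le> G)
     \<and> (\<forall>i. \<exists>C. \<forall>x y. \<bar>dd i f x - dd i f y\<bar> \<le> C * dist x y powr \<alpha>)"

text \<open>All quantities are geometric: \<open>\<delta> n\<close> has ratio \<open>1/K\<close>,
  \<open>l n\<close> has ratio \<open>r\<close>, and the second derivatives have ratio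
  \<open>t\<close>. Since \<open>r * t = q\<close> is also the ratio of
  \<open>sqrt (\<delta> n)\<close>, the condition \<open>300 * (l * M) \<le> sqrt \<delta>\<close>
  holds with equality at every stage.\<close>

lemma iteration:
  fixes A :: "2 \<Rightarrow> 2 \<Rightarrow> real^2 \<Rightarrow> real"
  assumes A: "\<And>i j x y. \<bar>A i j x - A i j y\<bar> \<le> Hc * dist x y powr \<beta>" and As: "\<And>i j. A i j = A j i"
    and \<beta>: "0 < \<beta>" "\<beta> < 1" and \<alpha>: "0 < \<alpha>" "\<alpha> < 1/7" "\<alpha> < \<beta>/2"
    and v0: "C2b G0 M0 v0" and w0: "\<And>i. C2b G0 M0 (w0 i)" and \<delta>0: "0 < \<delta>0" "\<delta>0 \<le> 1"
    and def0: "\<And>i j x. \<bar>A i j x - vk_metric v0 w0 i j x - (if i = j then \<delta>0 else 0)\<bar> \<le> \<delta>0 / 64"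
    and \<epsilon>: "0 < \<epsilon>"
  shows "\<exists>v w. C1h \<alpha> v \<and> (\<forall>i. C1h \<alpha> (w i)) \<and> (\<forall>x. \<bar>v x - v0 x\<bar> \<le> \<epsilon>) \<and> (\<forall>i x. \<bar>w i x - w0 i x\<bar> \<le> \<epsilon>)
    \<and> (\<forall>i j x. A i j x = vk_metric v w i j x)"
proof -
  have Hc: "0 \<le> Hc"
    using order_trans[OF abs_ge_zero A[of 1 1 0 "axis 1 1"]] by (simp add: zero_le_mult_iff)
  have Ac: "continuous_on UNIV (A i j)" for i j by (rule hoelder_continuous[OF A \<beta>(1)])
  \<comment> \<open>The two upper bounds on \<alpha> say exactly that this interval is
    nonempty.\<close>
  obtain \<rho> where \<rho>: "7/2 < \<rho>" "1/\<beta> < \<rho>" "\<rho> < 1/(2*\<alpha>)"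
  proof -
    have "7/2 < 1/(2*\<alpha>)" "1/\<beta> < 1/(2*\<alpha>)" using \<alpha> \<beta> by (auto simp: field_simps)
    then have "max (7/2) (1/\<beta>) < 1/(2*\<alpha>)" by simp
    then show ?thesis using that by (meson dense max_less_iff_conj)
  qed
  have \<rho>': "1 < \<rho> * \<beta>" "\<alpha> * \<rho> < 1/2" using \<rho> \<alpha> \<beta> by (auto simp: field_simps)
  obtain C where C: "1 \<le> C" and stage: "stage_constant C" using stage by blast
  have G0: "0 \<le> G0" "0 \<le> M0" using C2b_nonneg[OF v0] by auto
  \<comment> \<open>The powers of 1/2 sum to 2, so \<open>2 * C\<close> bounds the total growth of
    the gradient bound; the 1 keeps that bound at least 1, as \<open>stage_constant\<close>
    requires. \<open>H\<close> does the same for \<open>w\<close>, whose increments carry a further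
    factor \<open>G\<close>.\<close>
  define G where "G = G0 + 1 + 2 * C"
  define H where "H = G0 + 2 * C * G"
  have G: "1 \<le> G" "0 < G" "2 * C \<le> G - 1" using G0 C by (auto simp: G_def)
  have H: "0 \<le> H" using G0 C G by (simp add: H_def)
  \<comment> \<open>Large enough for \<open>K powr (\<rho> - 7/2)\<close> to absorb the constant
    \<open>300 * C * G\<close> by which a stage multiplies second derivatives; 64 is required by
    \<open>stage_constant\<close>.\<close>
  define K where "K = max 64 ((300 * C * G) powr (1/(\<rho> - 7/2)))"
  have K: "64 \<le> K" "300 * C * G \<le> K powr (\<rho> - 7/2)"
  proof -
    show "64 \<le> K" by (simp add: K_def)
    have "300 * C * G = ((300 * C * G) powr (1/(\<rho> - 7/2))) powr (\<rho> - 7/2)"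
      using C G \<rho> by (simp add: powr_powr)
    also have "\<dots> \<le> K powr (\<rho> - 7/2)" using \<rho> by (intro powr_mono2) (auto simp: K_def)
    finally show "300 * C * G \<le> K powr (\<rho> - 7/2)" .
  qed
  \<comment> \<open>Ratios per stage of the amplitude \<open>sqrt \<delta>\<close>, of the
    mollification length and of the second derivatives, in this order.\<close>
  define q where "q = K powr (-1/2)"
  define r where "r = K powr (-\<rho>)"
  define t where "t = K powr (\<rho> - 1/2)"
  have pos: "0 < q" "0 < r" "0 < t" "0 < K" using K by (auto simp: q_def r_def t_def)
  have qq: "q^2 = 1/K"
  proof -
    have "q^2 = K powr (-1/2 + -1/2)" unfolding q_def power2_eq_square powr_add by simp
    then show ?thesis using K by (simp add: powr_minus_divide)
  qed
  have q2: "q \<le> 1/2"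
  proof (rule power2_le_imp_le)
    show "q^2 \<le> (1/2)^2" unfolding qq using K by (simp add: field_simps)
  qed simp
  have rt: "r * t = q" unfolding q_def r_def t_def powr_add[symmetric] by simp
  have rK: "r \<le> 1/K"
    using powr_mono[of "-\<rho>" "-1" K] \<rho> K by (simp add: r_def powr_minus_divide)
  have "1/K \<le> 1/2" using K by (simp add: field_simps)
  then have r2: "r \<le> 1/2" using rK by linarith
  have t1: "1 \<le> t" using K \<rho> by (auto simp: t_def intro: ge_one_powr_ge_zero)
  have tK: "300 * C * G * K^3 \<le> t"
  proof -
    have "K^3 = K powr 3" using K powr_realpow[of K 3] by simp
    moreover have "300 * C * G * K^3 \<le> K powr (\<rho> - 7/2) * K^3" using K by (intro mult_right_mono) auto
    ultimately have "300 * C * G * K^3 \<le> K powr (\<rho> - 7/2) * K powr 3" by simp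
    also have "K powr (\<rho> - 7/2) * K powr 3 = t" unfolding t_def powr_add[symmetric] by simp
    finally show ?thesis .
  qed
  have rb: "r powr \<beta> \<le> 1/K"
  proof -
    have "r powr \<beta> = K powr (-(\<rho> * \<beta>))" unfolding r_def powr_powr by simp
    also have "\<dots> \<le> K powr (-1)" using \<rho>' K by (intro powr_mono) auto
    finally show ?thesis using K by (simp add: powr_minus_divide)
  qed
  \<comment> \<open>Here \<open>\<rho> < 1/(2*\<alpha>)\<close> enters: the exponent of
    \<open>K\<close> is \<open>\<alpha> * \<rho> - 1/2\<close>.\<close>
  have \<sigma>: "q powr (1 - \<alpha>) * t powr \<alpha> < 1"
  proof -
    have "q powr (1 - \<alpha>) * t powr \<alpha> = K powr ((-1/2) * (1 - \<alpha>) + (\<rho> - 1/2) * \<alpha>)"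
      unfolding q_def t_def powr_powr powr_add ..
    also have "(-1/2) * (1 - \<alpha>) + (\<rho> - 1/2) * \<alpha> = \<alpha> * \<rho> - 1/2" by (simp add: field_simps)
    also have "K powr (\<alpha> * \<rho> - 1/2) < K powr 0" using K \<rho>' by (intro powr_less_mono) auto
    finally show ?thesis using K by simp
  qed
  \<comment> \<open>One entry per constraint: \<open>M0\<close> must be at most \<open>m\<close>,
    the total displacement \<open>2 * C * l0 * (G + H)\<close> at most \<epsilon>, and the
    mollification error of \<open>A\<close> at most \<open>\<delta>0 / (128 * K)\<close>, where 768
    is 6 * 128.\<close>
  define l0 where "l0 = min (sqrt \<delta>0 / (300 * (M0 + 1))) (min (\<epsilon> / (2 * C * (G + H)))
      ((\<delta>0 / (768 * K * (Hc + 1))) powr (1/\<beta>)))"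
  have l0: "0 < l0" "l0 \<le> sqrt \<delta>0 / (300 * (M0 + 1))" "l0 \<le> \<epsilon> / (2 * C * (G + H))"
      "l0 \<le> (\<delta>0 / (768 * K * (Hc + 1))) powr (1/\<beta>)"
    using \<delta>0 G0 C G H \<epsilon> K Hc by (auto simp: l0_def)
  have l0M: "M0 \<le> sqrt \<delta>0 / (300 * l0)"
  proof -
    have "300 * (M0 + 1) * l0 \<le> sqrt \<delta>0" using l0(2) G0 by (simp add: field_simps)
    then have "M0 + 1 \<le> sqrt \<delta>0 / (300 * l0)" using l0(1) by (simp add: field_simps)
    then show ?thesis by linarith
  qed
  have l0e: "2 * (C * l0 * (G + H)) \<le> \<epsilon>"
  proof -
    have "0 < 2 * C * (G + H)" using C G H by simp
    then show ?thesis using l0(3) by (simp add: field_simps)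
  qed
  have l0b: "6 * Hc * l0 powr \<beta> \<le> \<delta>0 / (128 * K)"
  proof -
    have "l0 powr \<beta> \<le> ((\<delta>0 / (768 * K * (Hc + 1))) powr (1/\<beta>)) powr \<beta>"
      using l0 \<beta> by (intro powr_mono2) auto
    also have "\<dots> = \<delta>0 / (768 * K * (Hc + 1))" using \<beta> \<delta>0 K Hc by (simp add: powr_powr)
    finally have "6 * Hc * l0 powr \<beta> \<le> 6 * Hc * (\<delta>0 / (768 * K * (Hc + 1)))"
      using Hc by (intro mult_left_mono) auto
    also have "\<dots> = (Hc / (Hc + 1)) * (\<delta>0 / (128 * K))" by simp
    also have "\<dots> \<le> 1 * (\<delta>0 / (128 * K))" using Hc \<delta>0 K by (intro mult_right_mono) auto
    finally show ?thesis by simp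
  qed
  define m where "m = sqrt \<delta>0 / (300 * l0)"
  have m: "0 \<le> m" "M0 \<le> m" using l0 l0M \<delta>0 by (auto simp: m_def)
  define \<delta> where "\<delta> = (\<lambda>n::nat. \<delta>0 / K^n)"
  define l where "l = (\<lambda>n::nat. l0 * r^n)"
  have sq: "sqrt (\<delta> n) = sqrt \<delta>0 * q^n" for n
  proof -
    have "\<delta> n = \<delta>0 * (q^2)^n" by (simp add: \<delta>_def qq power_divide)
    also have "(q^2)^n = (q^n)^2" by (simp add: mult.commute flip: power_mult)
    finally have "\<delta> n = \<delta>0 * (q^n)^2" .
    then show ?thesis using pos by (simp add: real_sqrt_mult)
  qed
  have qh: "q^n \<le> (1/2)^n" for n using q2 pos by (intro power_mono) auto
  have sd1: "sqrt \<delta>0 \<le> 1" "0 < sqrt \<delta>0" using \<delta>0 by auto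
  have sh: "sqrt (\<delta> n) \<le> (1/2)^n" for n
    unfolding sq using mult_mono[of "sqrt \<delta>0" 1 "q^n" "(1/2)^n"] sd1 qh[of n] pos by simp
  \<comment> \<open>Bounds that increase towards \<open>G\<close> and \<open>H\<close> and leave
    stage \<open>n\<close> the increments \<open>C * (1/2)^n\<close> and
    \<open>C * G * (1/2)^n\<close>.\<close>
  define Gn where "Gn = (\<lambda>n::nat. G - 2 * C * (1/2)^n)"
  define Hn where "Hn = (\<lambda>n::nat. H - 2 * C * G * (1/2)^n)"
  \<comment> \<open>The clause for \<open>n = 0\<close> ties the chosen sequence to
    \<open>(v0, w0)\<close>; the choice principle by itself would allow any start.\<close>
  define P where "P = (\<lambda>n (p :: (real^2 \<Rightarrow> real) \<times> (2 \<Rightarrow> real^2 \<Rightarrow> real)). C2b (Gn n) (m * t^n) (fst p) \<and> (\<forall>i. C2b (Hn n) (m * t^n) (snd p i))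
     \<and> (\<forall>i j x. \<bar>A i j x - vk_metric (fst p) (snd p) i j x - (if i = j then \<delta> n else 0)\<bar> \<le> \<delta> n / 64)
     \<and> (n = 0 \<longrightarrow> p = (v0, w0)))"
  define Q where "Q = (\<lambda>n (p :: (real^2 \<Rightarrow> real) \<times> (2 \<Rightarrow> real^2 \<Rightarrow> real)) p'.
      (\<forall>x. \<bar>fst p' x - fst p x\<bar> \<le> (C * l0 * (G + H)) * (1/2)^n)
    \<and> (\<forall>i x. \<bar>snd p' i x - snd p i x\<bar> \<le> (C * l0 * (G + H)) * (1/2)^n)
    \<and> (\<forall>i x. \<bar>dd i (fst p') x - dd i (fst p) x\<bar> \<le> (C * G) * q^n)
    \<and> (\<forall>i j x. \<bar>dd j (snd p' i) x - dd j (snd p i) x\<bar> \<le> (C * G) * q^n))"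
  have "\<exists>f. \<forall>n. P n (f n) \<and> Q n (f n) (f (Suc n))"
  proof (rule dependent_nat_choice)
    have "G0 \<le> Gn 0" "G0 \<le> Hn 0" by (auto simp: Gn_def Hn_def G_def H_def)
    then have "P 0 (v0, w0)"
    proof -
      have "\<delta> 0 = \<delta>0" by (simp add: \<delta>_def)
      then show ?thesis
        unfolding P_def fst_conv snd_conv power_0 mult_1_right
        using C2b_mono[OF v0 \<open>G0 \<le> Gn 0\<close> m(2)] C2b_mono[OF w0 \<open>G0 \<le> Hn 0\<close> m(2)] def0 by (simp only:) blast
    qed
    then show "\<exists>p. P 0 p" ..
  next
    fix p n assume p: "P n p"
    obtain v w where vw: "p = (v, w)" by (cases p)
    have hn: "(1/2::real)^n \<le> 1" "0 < (1/2::real)^n" by (auto simp: power_le_one)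
    have Gn1: "1 \<le> Gn n" "Gn n \<le> G"
    proof -
      have "2 * C * (1/2)^n \<le> 2 * C * 1" using hn C by (intro mult_left_mono) auto
      then show "1 \<le> Gn n" using G unfolding Gn_def by linarith
      show "Gn n \<le> G" using C hn by (simp add: Gn_def)
    qed
    have Hn1: "Hn n \<le> H" using C G hn by (simp add: Hn_def)
    have l: "0 < l n" "l n \<le> l0 * (1/2)^n"
      using l0 pos r2 by (auto simp: l_def intro!: mult_left_mono power_mono)
    have \<delta>: "0 < \<delta> n" "\<delta> n \<le> 1"
    proof -
      have "1 \<le> K^n" using K by (intro one_le_power) auto
      then have "\<delta>0 \<le> K^n" using \<delta>0 by linarith
      then show "0 < \<delta> n" "\<delta> n \<le> 1" using \<delta>0 pos by (auto simp: \<delta>_def divide_le_eq)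
    qed
    have lM: "300 * (l n * (m * t^n)) \<le> sqrt (\<delta> n)"
    proof -
      have "300 * (l n * (m * t^n)) = (300 * l0 * m) * (r * t)^n" by (simp add: l_def power_mult_distrib)
      also have "\<dots> = sqrt (\<delta> n)" unfolding rt sq using l0 by (simp add: m_def)
      finally show ?thesis by simp
    qed
    have mA: "\<bar>moll (l n) (A i j) x - A i j x\<bar> \<le> \<delta> n / (128 * K)" for i j x
    proof -
      have "\<bar>moll (l n) (A i j) x - A i j x\<bar> \<le> 6 * Hc * l n powr \<beta>"
        by (rule moll_hoelder[OF A Ac \<beta> l(1) Hc])
      also have "\<dots> = (6 * Hc * l0 powr \<beta>) * (r powr \<beta>)^n"
        using l0 pos by (simp add: l_def powr_mult power_powr_swap)
      also have "\<dots> \<le> (\<delta>0 / (128 * K)) * (1/K)^n"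
        using l0b rb pos \<delta>0 Hc by (intro mult_mono power_mono) auto
      also have "\<dots> = \<delta> n / (128 * K)" by (simp add: \<delta>_def power_divide)
      finally show ?thesis .
    qed
    have AA: "\<forall>i j. continuous_on UNIV (A i j) \<and> A i j = A j i" using Ac As by blast
    have 1: "C2b (Gn n) (m * t^n) v" and 2: "\<forall>i. C2b (Hn n) (m * t^n) (w i)"
      and 3: "\<forall>i j x. \<bar>A i j x - vk_metric v w i j x - (if i = j then \<delta> n else 0)\<bar> \<le> \<delta> n / 64"
      using p by (auto simp: P_def vw)
    have mA': "\<forall>i j x. \<bar>moll (l n) (A i j) x - A i j x\<bar> \<le> \<delta> n / (128 * K)" using mA by blast
    obtain v' w' where s: "stage_result C (Gn n) (Hn n) (\<delta> n) K (l n) A v w v' w'"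
      by (rule stage_constantD[OF stage Gn1(1) \<delta> K(1) l(1) lM AA 1 2 3 mA'])
    note s = s[unfolded stage_result_def]
    note s1 = s[THEN conjunct1] and s2 = s[THEN conjunct2, THEN conjunct1, rule_format]
      and s3 = s[THEN conjunct2, THEN conjunct2]
    have dS: "\<delta> (Suc n) = \<delta> n / K" by (simp add: \<delta>_def)
    have M': "C * Gn n * K^3 * sqrt (\<delta> n) / l n \<le> m * t^Suc n"
    proof -
      have "q^n = r^n * t^n" by (simp flip: rt power_mult_distrib)
      then have "C * Gn n * K^3 * sqrt (\<delta> n) / l n = (300 * C * Gn n * K^3) * (m * t^n)"
        unfolding sq using l0 pos by (simp add: l_def m_def)
      also have "\<dots> \<le> (300 * C * G * K^3) * (m * t^n)"
        using C Gn1 pos m by (intro mult_right_mono mult_left_mono) auto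
      also have "\<dots> \<le> t * (m * t^n)" using tK m pos by (intro mult_right_mono) auto
      also have "\<dots> = m * t^Suc n" by simp
      finally show ?thesis .
    qed
    have G': "Gn n + C * sqrt (\<delta> n) \<le> Gn (Suc n)"
      using mult_left_mono[OF sh[of n], of C] C by (simp add: Gn_def)
    have Cs: "C * Gn n * sqrt (\<delta> n) \<le> C * G * sqrt (\<delta> n)" using C Gn1 \<delta> by (intro mult_right_mono mult_left_mono) auto
    have H': "Hn n + C * Gn n * sqrt (\<delta> n) \<le> Hn (Suc n)"
    proof -
      have "C * G * sqrt (\<delta> n) \<le> C * G * (1/2)^n" using sh C G by (intro mult_left_mono) auto
      moreover have "Hn (Suc n) = Hn n + C * G * (1/2)^n" by (simp add: Hn_def)
      ultimately show ?thesis using Cs by linarith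
    qed
    have sq': "sqrt (\<delta> n) \<le> q^n" unfolding sq using sd1 pos by (simp add: mult_left_le_one_le)
    have 4: "C * sqrt (\<delta> n) \<le> C * G * q^n" "C * Gn n * sqrt (\<delta> n) \<le> C * G * q^n"
    proof -
      have "C * G * sqrt (\<delta> n) \<le> C * G * q^n" using sq' C G by (intro mult_left_mono) auto
      then show "C * Gn n * sqrt (\<delta> n) \<le> C * G * q^n" using Cs by linarith
      have "C * 1 * sqrt (\<delta> n) \<le> C * G * q^n" using sq' C G \<delta> by (intro mult_mono) auto
      then show "C * sqrt (\<delta> n) \<le> C * G * q^n" by simp
    qed
    have 5: "C * l n * x \<le> (C * l0 * (G + H)) * (1/2)^n" if "x \<le> G + H" for x
    proof -
      have "C * l n * x \<le> C * l n * (G + H)" using that C l by (intro mult_left_mono) auto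
      also have "\<dots> \<le> C * (l0 * (1/2)^n) * (G + H)" using C l G H by (intro mult_right_mono mult_left_mono) auto
      finally show ?thesis by (simp add: mult_ac)
    qed
    have "P (Suc n) (v', w')"
      unfolding P_def fst_conv snd_conv dS using C2b_mono[OF s1 G' M'] C2b_mono[OF s2 H' M'] s3 by blast
    moreover have "Q n p (v', w')"
    proof -
      have "Gn n \<le> G + H" "Gn n + Hn n \<le> G + H" using Gn1 Hn1 H by auto
      then show ?thesis
        unfolding Q_def vw fst_conv snd_conv using s3 4 5 by (meson order_trans)
    qed
    ultimately show "\<exists>p'. P (Suc n) p' \<and> Q n p p'" by blast
  qed
  then obtain f where f: "\<And>n. P n (f n)" "\<And>n. Q n (f n) (f (Suc n))" by blast
  have f0: "f 0 = (v0, w0)" using f(1)[of 0] by (simp add: P_def)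
  have hn: "0 < (1/2::real)^n" for n by simp
  have Gb: "Gn n \<le> G" "Hn n \<le> H" for n using C G hn[of n] by (auto simp: Gn_def Hn_def)
  have a1: "\<alpha> < 1" using \<alpha> by simp
  have q1: "q < 1" using q2 by simp
  have F1: "C2b G (m * t^n) (fst (f n))" and F2: "C2b H (m * t^n) (snd (f n) k)" for n k
    using f(1)[of n] C2b_mono[OF _ Gb(1)[of n] order_refl] C2b_mono[OF _ Gb(2)[of n] order_refl] unfolding P_def by blast+
  have F3: "\<bar>fst (f (Suc n)) x - fst (f n) x\<bar> \<le> (C * l0 * (G + H)) * (1/2)^n"
    and F4: "\<bar>snd (f (Suc n)) k x - snd (f n) k x\<bar> \<le> (C * l0 * (G + H)) * (1/2)^n"
    and F5: "\<bar>dd i (fst (f (Suc n))) x - dd i (fst (f n)) x\<bar> \<le> (C * G) * q^n"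
    and F6: "\<bar>dd i (snd (f (Suc n)) k) x - dd i (snd (f n) k) x\<bar> \<le> (C * G) * q^n" for n k i x
    using f(2)[of n] unfolding Q_def by blast+
  note C1_limit' = C1_limit[OF _ _ _ pos(1) q1 t1 m(1) \<alpha>(1) a1 \<sigma>]
  obtain v where v: "\<And>x. \<bar>v x - v0 x\<bar> \<le> 2 * (C * l0 * (G + H))" "C1h \<alpha> v"
      "\<And>i x. (\<lambda>n. dd i (fst (f n)) x) \<longlonglongrightarrow> dd i v x"
    using C1_limit'[where f="\<lambda>n. fst (f n)", OF F1 F3 F5] unfolding C1h_def f0 fst_conv by meson
  have "\<exists>g. (\<forall>x. \<bar>g x - w0 k x\<bar> \<le> 2 * (C * l0 * (G + H))) \<and> C1h \<alpha> g
      \<and> (\<forall>i x. (\<lambda>n. dd i (snd (f n) k) x) \<longlonglongrightarrow> dd i g x)" for k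
    using C1_limit'[where f="\<lambda>n. snd (f n) k", OF F2 F4 F6] unfolding C1h_def f0 snd_conv by meson
  then obtain w where w: "\<And>k x. \<bar>w k x - w0 k x\<bar> \<le> 2 * (C * l0 * (G + H))" "\<And>k. C1h \<alpha> (w k)"
      "\<And>k i x. (\<lambda>n. dd i (snd (f n) k) x) \<longlonglongrightarrow> dd i (w k) x" by metis
  have "A i j x = vk_metric v w i j x" for i j x
  proof -
    have d0: "\<delta> \<longlonglongrightarrow> 0"
    proof -
      have "(\<lambda>n. \<delta>0 * (1/K)^n) \<longlonglongrightarrow> \<delta>0 * 0" using K by (intro tendsto_intros LIMSEQ_power_zero) auto
      then show ?thesis by (simp add: \<delta>_def[abs_def] power_divide)
    qed
    have "(\<lambda>n. vk_metric (fst (f n)) (snd (f n)) i j x) \<longlonglongrightarrow> vk_metric v w i j x"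
      unfolding vk_metric_def by (intro tendsto_intros v w) auto
    moreover have "(\<lambda>n. if i = j then \<delta> n else 0) \<longlonglongrightarrow> 0" using d0 by (cases "i = j") auto
    ultimately have "(\<lambda>n. A i j x - vk_metric (fst (f n)) (snd (f n)) i j x - (if i = j then \<delta> n else 0))
        \<longlonglongrightarrow> A i j x - vk_metric v w i j x - 0"
      by (intro tendsto_diff tendsto_const)
    then have "(\<lambda>n. A i j x - vk_metric (fst (f n)) (snd (f n)) i j x - (if i = j then \<delta> n else 0))
        \<longlonglongrightarrow> A i j x - vk_metric v w i j x" by simp
    moreover have "(\<lambda>n. A i j x - vk_metric (fst (f n)) (snd (f n)) i j x - (if i = j then \<delta> n else 0)) \<longlonglongrightarrow> 0"
    proof (rule Lim_null_comparison)
      show "\<forall>\<^sub>F n in sequentially. norm (A i j x - vk_metric (fst (f n)) (snd (f n)) i j x - (if i = j then \<delta> n else 0)) \<le> \<delta> n / 64"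
        using f(1) by (auto simp: P_def)
      show "(\<lambda>n. \<delta> n / 64) \<longlonglongrightarrow> 0" using tendsto_divide[OF d0 tendsto_const[of 64]] by simp
    qed
    ultimately have "A i j x - vk_metric v w i j x = 0" by (rule LIMSEQ_unique)
    then show ?thesis by simp
  qed
  then show ?thesis using v w l0e by (meson order_trans)
qed

section \<open>The initial stage\<close>

text \<open>The initial stage is performed once, so its amplitudes may depend on the data in any
  way; only the existence of a bound is recorded.\<close>

definition Bd :: "real \<Rightarrow> (real^2 \<Rightarrow> real) \<Rightarrow> bool" where
  "Bd L f \<longleftrightarrow> (\<exists>s. bnd 3 s L f)"

lemma Bd_const: "0 \<le> L \<Longrightarrow> Bd L (\<lambda>x. c)"
  unfolding Bd_def by (blast intro: bnd_const[OF order_refl])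

lemma Bd_add: "Bd L f \<Longrightarrow> Bd L g \<Longrightarrow> Bd L (\<lambda>x. f x + g x)"
  unfolding Bd_def by (blast intro: bnd_add)

lemma Bd_diff: "Bd L f \<Longrightarrow> Bd L g \<Longrightarrow> Bd L (\<lambda>x. f x - g x)"
  unfolding Bd_def by (blast intro: bnd_minus)

lemma Bd_mult: "Bd L f \<Longrightarrow> Bd L g \<Longrightarrow> Bd L (\<lambda>x. f x * g x)"
  unfolding Bd_def by (blast intro: bnd_mult)

lemma Bd_power: "0 \<le> L \<Longrightarrow> Bd L f \<Longrightarrow> Bd L (\<lambda>x. f x ^ n)"
  by (induction n) (auto intro: Bd_const Bd_mult)

lemma Bd_powr:
  assumes "Bd L f" "0 < c" "\<And>x. c \<le> f x" "0 \<le> L"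
  shows "Bd L (\<lambda>x. f x powr q)"
proof -
  obtain s where s: "bnd 3 s L f" using assms by (auto simp: Bd_def)
  obtain C where "\<forall>L f. 0 \<le> L \<longrightarrow> bnd 3 s L f \<longrightarrow> (\<forall>x. c \<le> f x) \<longrightarrow> bnd 3 C L (\<lambda>x. f x powr q)"
    using bnd_powr[OF assms(2) bnd_nonneg[OF s], of 3 q] by blast
  then show ?thesis unfolding Bd_def using s assms by blast
qed

lemma Bd_divide:
  assumes "Bd L f" "Bd L g" "0 < c" "\<And>x. c \<le> g x" "0 \<le> L"
  shows "Bd L (\<lambda>x. f x / g x)"
proof -
  have "Bd L (\<lambda>x. f x * g x powr (-1))" by (intro Bd_mult Bd_powr[OF assms(2-5)] assms(1))
  moreover have "f x * g x powr (-1) = f x / g x" for x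
  proof -
    have "0 < g x" using assms(3) assms(4)[of x] by linarith
    then show ?thesis by (simp add: powr_minus_divide)
  qed
  ultimately show ?thesis by (simp only:)
qed

text \<open>Mean and second moment of a binomial variable moved affinely to the interval from
  \<open>-T\<close> to \<open>T\<close>; the last summand is its variance.\<close>

lemma Bernstein_moments:
  fixes T u :: real
  assumes n: "0 < n"
  defines "\<tau> \<equiv> \<lambda>m. -T + 2 * T * real m / real n"
  shows "(\<Sum>m\<le>n. Bernstein n m u * \<tau> m) = -T + 2 * T * u"
    and "(\<Sum>m\<le>n. Bernstein n m u * (\<tau> m)^2) = (-T + 2 * T * u)^2 + 4 * T^2 * u * (1 - u) / n"
proof -
  have s1: "(\<Sum>m\<le>n. Bernstein n m u) = 1" by simp
  have s2: "(\<Sum>m\<le>n. real m * Bernstein n m u) = n * u" by simp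
  have s3: "(\<Sum>m\<le>n. real m * real m * Bernstein n m u) = real n * (real n - 1) * u^2 + n * u"
  proof -
    have "(\<Sum>m\<le>n. real m * real m * Bernstein n m u)
        = (\<Sum>m\<le>n. real m * (real m - 1) * Bernstein n m u) + (\<Sum>m\<le>n. real m * Bernstein n m u)"
      unfolding sum.distrib[symmetric] by (intro sum.cong) (auto simp: algebra_simps)
    then show ?thesis by (simp only: sum_kk_Bernstein sum_k_Bernstein)
  qed
  have "(\<Sum>m\<le>n. Bernstein n m u * \<tau> m) = (\<Sum>m\<le>n. (-T) * Bernstein n m u + (2 * T / n) * (real m * Bernstein n m u))"
    by (intro sum.cong) (auto simp: \<tau>_def algebra_simps)
  also have "\<dots> = (-T) * 1 + (2 * T / n) * (n * u)"
    by (simp only: sum.distrib s1 s2 flip: sum_distrib_left)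
  finally show "(\<Sum>m\<le>n. Bernstein n m u * \<tau> m) = -T + 2 * T * u" using n by simp
  have "(\<Sum>m\<le>n. Bernstein n m u * (\<tau> m)^2) = (\<Sum>m\<le>n. T^2 * Bernstein n m u - (4 * T^2 / n) * (real m * Bernstein n m u)
      + (4 * T^2 / n^2) * (real m * real m * Bernstein n m u))"
    using n by (intro sum.cong) (auto simp: \<tau>_def power2_eq_square field_simps)
  also have "\<dots> = T^2 * 1 - (4 * T^2 / n) * (n * u) + (4 * T^2 / n^2) * (real n * (real n - 1) * u^2 + n * u)"
    by (simp only: sum.distrib sum_subtractf s1 s2 s3 flip: sum_distrib_left)
  also have "\<dots> = (-T + 2 * T * u)^2 + 4 * T^2 * u * (1 - u) / n"
    using n by (simp add: power2_eq_square field_simps)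
  finally show "(\<Sum>m\<le>n. Bernstein n m u * (\<tau> m)^2) = (-T + 2 * T * u)^2 + 4 * T^2 * u * (1 - u) / n" .
qed

text \<open>A positive definite matrix with entries \<open>p, q, r\<close> is \<open>p (1, t) \<otimes> (1, t)\<close> plus a positive
  multiple of the second coordinate direction, where \<open>t = q / p\<close>. The varying direction \<open>(1, t)\<close> is
  replaced by the fixed directions \<open>(1, \<tau> m)\<close>, weighted by Bernstein polynomials, which reproduce
  \<open>t\<close> exactly and \<open>t\<^sup>2\<close> up to an error that the remainder absorbs.\<close>

lemma positive_decomposition:
  fixes E :: "2 \<Rightarrow> 2 \<Rightarrow> real^2 \<Rightarrow> real"
  assumes Eb: "\<And>i j. bnd 3 s L (E i j)" and Es: "E 2 1 = E 1 2" and L: "0 \<le> L"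
    and c: "0 < c" "\<And>x. c \<le> E 1 1 x" "\<And>x. c \<le> E 2 2 x - (E 1 2 x)^2 / E 1 1 x"
  shows "\<exists>N (a :: nat \<Rightarrow> real^2 \<Rightarrow> real) (z :: nat \<Rightarrow> real^2).
     (\<forall>k. Bd L (a k)) \<and> (\<forall>k<N. \<forall>i. \<bar>z k $ i\<bar> \<le> 1) \<and>
     (\<forall>i j x. (\<Sum>k<N. (a k x)^2 * z k $ i * z k $ j) = E i j x)"
proof -
  have s: "0 \<le> s" "\<bar>E i j x\<bar> \<le> s" for i j x using bnd_nonneg[OF Eb] bnd_bound[OF Eb] by auto
  define p where "p = E 1 1"
  define q where "q = E 1 2"
  define r where "r = E 2 2"
  have p: "c \<le> p x" "0 < p x" "p x \<le> s" for x using c(1,2) s(2)[of 1 1 x] by (auto simp: p_def intro: less_le_trans)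
  have Bp: "Bd L p" "Bd L q" "Bd L r" using Eb by (auto simp: p_def q_def r_def Bd_def)
  define t where "t = (\<lambda>x. q x / p x)"
  have Bt: "Bd L t" unfolding t_def by (rule Bd_divide[OF Bp(2,1) c(1) p(1) L])
  \<comment> \<open>The extra 1 keeps \<open>t\<close> at distance at least 1 from the ends of the
    interval from \<open>-T\<close> to \<open>T\<close>. So \<open>u\<close> stays away from 0 and
    1, and all Bernstein weights have the positive lower bound \<open>u0 ^ n\<close> that their
    square roots need.\<close>
  define T where "T = s / c + 1"
  have T: "1 \<le> T" "0 < T" using s c by (auto simp: T_def intro: add_nonneg_pos)
  have tT: "\<bar>t x\<bar> \<le> T - 1" for x
  proof -
    have "\<bar>t x\<bar> = \<bar>q x\<bar> / p x" using p(2)[of x] by (simp add: t_def)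
    also have "\<dots> \<le> s / c" using s(2)[of 1 2 x] p(1)[of x] c(1) s(1) by (intro frac_le) (auto simp: q_def)
    finally show ?thesis by (simp add: T_def)
  qed
  define u where "u = (\<lambda>x. (1 / (2 * T)) * (t x + T))"
  define u0 where "u0 = 1 / (2 * T)"
  have u: "u0 \<le> u x" "u0 \<le> 1 - u x" "0 < u0" "u0 \<le> 1" "-T + 2 * T * u x = t x" for x
    using tT[of x] T by (auto simp: u_def u0_def field_simps abs_le_iff)
  have Bu: "Bd L u" unfolding u_def by (intro Bd_mult Bd_add Bd_const Bt L)
  \<comment> \<open>Since \<open>4 * u * (1 - u) \<le> 1\<close> and \<open>p \<le> s\<close>, this
    \<open>n\<close> makes \<open>p\<close> times the variance at most \<open>c / 2\<close>, half of
    what the Schur complement offers.\<close>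
  obtain n :: nat where n: "2 * s * T^2 / c < n" using reals_Archimedean2 by blast
  have n0: "0 < n"
  proof -
    have "0 \<le> 2 * s * T^2 / c" using s c by simp
    then show ?thesis using n by (metis less_le_trans of_nat_0_less_iff le_less_trans)
  qed
  define \<tau> where "\<tau> = (\<lambda>m. -T + 2 * T * real m / real n)"
  \<comment> \<open>The factor \<open>T^2\<close> here and the division by \<open>T\<close> in
    \<open>z\<close> compensate each other; they make the entries of the directions
    \<open>(1, \<tau> k)\<close> at most 1.\<close>
  define g where "g = (\<lambda>k x. if k \<le> n then T^2 * (p x * Bernstein n k (u x))
      else r x - p x * (t x)^2 - p x * (4 * T^2 * u x * (1 - u x) / n))"
  define z :: "nat \<Rightarrow> real^2" where "z = (\<lambda>k. if k \<le> n then vector [1 / T, \<tau> k / T] else vector [0, 1])"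
  have BB: "Bd L (\<lambda>x. Bernstein n k (u x))" for k
    unfolding Bernstein_def by (intro Bd_mult Bd_power Bd_diff Bd_const Bu L)
  have gB: "Bd L (g k)" for k
  proof (cases "k \<le> n")
    case True then show ?thesis unfolding g_def by simp (intro Bd_mult Bd_const Bp BB L)
  next
    case False
    have "Bd L (\<lambda>x. r x - p x * (t x)^2 - p x * ((4 * T^2 / n) * (u x * (1 - u x))))"
      by (intro Bd_mult Bd_diff Bd_power Bd_const Bp Bt Bu L)
    then show ?thesis using False by (simp add: g_def mult.assoc)
  qed
  have Bpos: "u0 ^ n \<le> Bernstein n k (u x)" if "k \<le> n" for k x
  proof -
    have "u0 ^ n = 1 * u0 ^ k * u0 ^ (n - k)" using that by (simp flip: power_add)
    also have "\<dots> \<le> real (n choose k) * u x ^ k * (1 - u x) ^ (n - k)"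
      using u(1,2)[of x] u(3) that by (intro mult_mono power_mono) (auto simp: Suc_le_eq)
    finally show ?thesis by (simp add: Bernstein_def)
  qed
  define c' where "c' = min (c * u0 ^ n) (c / 2)"
  have c': "0 < c'" using c u by (simp add: c'_def)
  have gpos: "c' \<le> g k x" for k x
  proof (cases "k \<le> n")
    case True
    have "c * u0 ^ n \<le> 1 * (p x * Bernstein n k (u x))"
      using p(1)[of x] Bpos[OF True, of x] c(1) u(3) by (simp add: mult_mono)
    also have "\<dots> \<le> T^2 * (p x * Bernstein n k (u x))"
    proof -
      have "0 \<le> Bernstein n k (u x)" using Bpos[OF True, of x] zero_less_power[OF u(3), of n] by linarith
      then show ?thesis using T p(2)[of x] by (intro mult_right_mono one_le_power mult_nonneg_nonneg) auto
    qed
    finally show ?thesis using True by (simp add: g_def c'_def)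
  next
    case False
    have "p x * (t x)^2 = (q x)^2 / p x" using p(2)[of x] by (simp add: t_def power2_eq_square)
    then have 1: "c \<le> r x - p x * (t x)^2" using c(3)[of x] by (simp add: p_def q_def r_def)
    have "4 * u x * (1 - u x) \<le> 1" using zero_le_power2[of "2 * u x - 1"] by (simp add: power2_eq_square algebra_simps)
    then have "p x * (4 * T^2 * u x * (1 - u x) / n) \<le> s * (T^2 / n)"
      using p(2,3)[of x] n0 T u(1,2)[of x] u(3)
      by (intro mult_mono) (auto simp: divide_le_cancel mult.assoc intro!: divide_nonneg_nonneg mult_nonneg_nonneg mult_left_le)
    also have "\<dots> \<le> c / 2" using n n0 c(1) by (simp add: field_simps)
    finally show ?thesis using 1 False by (simp add: g_def c'_def)
  qed
  define a where "a = (\<lambda>k x. g k x powr (1/2))"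
  have a2: "(a k x)^2 = g k x" for k x
    using gpos[of k x] c' by (simp add: a_def powr_half_sqrt)
  have "(\<Sum>k<n+2. g k x * z k $ i * z k $ j) = E i j x" for i j x
  proof -
    have M1: "(\<Sum>k\<le>n. Bernstein n k (u x) * \<tau> k) = t x"
      and M2: "(\<Sum>k\<le>n. Bernstein n k (u x) * (\<tau> k)^2) = (t x)^2 + 4 * T^2 * u x * (1 - u x) / n"
      using Bernstein_moments(1)[OF n0, of "u x" T] Bernstein_moments(2)[OF n0, of "u x" T]
      by (simp_all only: \<tau>_def u(5))
    have z1: "z k $ 1 = 1 / T" "z k $ 2 = \<tau> k / T" if "k \<le> n" for k using that by (auto simp: z_def)
    have z2: "z (Suc n) $ 1 = 0" "z (Suc n) $ 2 = 1" by (auto simp: z_def)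
    have g2: "g (Suc n) x = r x - p x * (t x)^2 - p x * (4 * T^2 * u x * (1 - u x) / n)" by (simp add: g_def)
    have sp: "(\<Sum>k<n+2. g k x * z k $ i * z k $ j) = (\<Sum>k\<le>n. g k x * z k $ i * z k $ j) + g (Suc n) x * z (Suc n) $ i * z (Suc n) $ j"
      by (simp add: lessThan_Suc_atMost[symmetric])
    have S: "(\<Sum>k\<le>n. g k x * z k $ i * z k $ j) = p x * (\<Sum>k\<le>n. Bernstein n k (u x) * (T * z k $ i) * (T * z k $ j))"
      by (subst sum_distrib_left) (intro sum.cong, auto simp: g_def power2_eq_square)
    have pt: "p x * t x = q x" using p(2)[of x] by (simp add: t_def)
    consider "i = 1" "j = 1" | "i = 1" "j = 2" | "i = 2" "j = 1" | "i = 2" "j = 2" using exhaust_2[of i] exhaust_2[of j] by blast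
    then show ?thesis
    proof cases
      case 1
      have "(\<Sum>k\<le>n. Bernstein n k (u x) * (T * z k $ i) * (T * z k $ j)) = (\<Sum>k\<le>n. Bernstein n k (u x))"
        using T by (intro sum.cong) (auto simp: 1 z1)
      then show ?thesis unfolding sp S using 1 by (simp add: z2 p_def)
    next
      case 2
      have "(\<Sum>k\<le>n. Bernstein n k (u x) * (T * z k $ i) * (T * z k $ j)) = (\<Sum>k\<le>n. Bernstein n k (u x) * \<tau> k)"
        using T by (intro sum.cong) (auto simp: 2 z1)
      then show ?thesis unfolding sp S using 2 by (simp add: z2 M1 pt) (simp add: q_def)
    next
      case 3
      have "(\<Sum>k\<le>n. Bernstein n k (u x) * (T * z k $ i) * (T * z k $ j)) = (\<Sum>k\<le>n. Bernstein n k (u x) * \<tau> k)"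
        using T by (intro sum.cong) (auto simp: 3 z1)
      then show ?thesis unfolding sp S using 3 by (simp add: z2 M1 pt Es) (simp add: q_def)
    next
      case 4
      have "(\<Sum>k\<le>n. Bernstein n k (u x) * (T * z k $ i) * (T * z k $ j)) = (\<Sum>k\<le>n. Bernstein n k (u x) * (\<tau> k)^2)"
        using T by (intro sum.cong) (auto simp: 4 z1 power2_eq_square)
      then show ?thesis unfolding sp S using 4 by (simp add: z2 M2 g2 distrib_left) (simp add: r_def)
    qed
  qed
  then have "\<forall>i j x. (\<Sum>k<n+2. (a k x)^2 * z k $ i * z k $ j) = E i j x" unfolding a2 by blast
  moreover have "Bd L (a k)" for k
    unfolding a_def by (rule Bd_powr[OF gB c' gpos L])
  moreover have "\<bar>z k $ i\<bar> \<le> 1" for k i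
  proof (cases "k \<le> n")
    case True
    then have "real k / real n \<le> 1" "0 \<le> real k / real n" using n0 by auto
    then have "2 * T * (real k / real n) \<le> 2 * T * 1" "0 \<le> 2 * T * (real k / real n)"
      using T by (intro mult_left_mono mult_nonneg_nonneg; simp)+
    then have "\<bar>\<tau> k\<bar> \<le> T" by (simp add: \<tau>_def)
    then show ?thesis using True T exhaust_2[of i] by (auto simp: z_def)
  qed (use exhaust_2[of i] in \<open>auto simp: z_def\<close>)
  ultimately show ?thesis by blast
qed


text \<open>The diagonal entries cost \<open>h\<close>, and the off-diagonal entry costs another
  \<open>h\<close> because \<open>\<bar>2 * a * b\<bar> \<le> a^2 + b^2\<close>.\<close>

lemma form_perturb:
  fixes a b :: real
  assumes "\<bar>p' - p\<bar> \<le> h" "\<bar>q' - q\<bar> \<le> h" "\<bar>r' - r\<bar> \<le> h"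
    and "c * (a^2 + b^2) \<le> p * a^2 + 2 * q * a * b + r * b^2"
  shows "(c - 2 * h) * (a^2 + b^2) \<le> p' * a^2 + 2 * q' * a * b + r' * b^2"
proof -
  have "\<bar>(p' - p) * a^2\<bar> \<le> h * a^2" "\<bar>(r' - r) * b^2\<bar> \<le> h * b^2"
    using assms by (auto intro!: abs_mult_le)
  moreover have "\<bar>(q' - q) * (2 * a * b)\<bar> \<le> h * (a^2 + b^2)"
  proof (rule abs_mult_le)
    show "\<bar>2 * a * b\<bar> \<le> a^2 + b^2"
      using zero_le_power2[of "a + b"] zero_le_power2[of "a - b"] by (simp add: power2_eq_square algebra_simps abs_le_iff)
  qed (rule assms)
  ultimately have "- (2 * (h * (a^2 + b^2))) \<le> (p' - p) * a^2 + (q' - q) * (2 * a * b) + (r' - r) * b^2"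
    by (simp add: distrib_left abs_le_iff)
  then show ?thesis using assms(4) by (simp add: algebra_simps)
qed

text \<open>Only \<open>A\<close> is mollified, as \<open>v\<close> and \<open>w\<close> are regular
  enough. Subtracting \<delta> Id from the defect leaves a positive definite field, which is removed
  by as many corrugations as its decomposition needs. No relation between frequency and amplitude
  has to be respected, because \<open>L\<close> and \<open>K\<close> are free. Mollification and
  corrugations err by \<open>h\<close> each, together \<open>\<delta> / 64\<close>.\<close>

lemma first_stage:
  fixes A :: "2 \<Rightarrow> 2 \<Rightarrow> real^2 \<Rightarrow> real"
  assumes A: "\<And>i j x y. \<bar>A i j x - A i j y\<bar> \<le> Hc * dist x y powr \<beta>" and As: "\<And>i j. A i j = A j i"
    and AB: "\<And>i j x. \<bar>A i j x\<bar> \<le> B" and \<beta>: "0 < \<beta>" "\<beta> < 1"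
    and v: "\<And>x. v differentiable (at x)" "\<And>i. bnd 3 s0 L0 (dd i v)"
    and w: "\<And>i x. w i differentiable (at x)" "\<And>i j. bnd 3 s0 L0 (dd j (w i))" and L0: "0 \<le> L0"
    and c: "0 < c" and form: "\<And>x a b. c * (a^2 + b^2) \<le> (A 1 1 x - vk_metric v w 1 1 x) * a^2
        + 2 * (A 1 2 x - vk_metric v w 1 2 x) * a * b + (A 2 2 x - vk_metric v w 2 2 x) * b^2"
    and \<epsilon>: "0 < \<epsilon>"
  shows "\<exists>\<delta> G M v' w'. 0 < \<delta> \<and> \<delta> \<le> 1 \<and> C2b G M v' \<and> (\<forall>i. C2b G M (w' i))
     \<and> (\<forall>x. \<bar>v' x - v x\<bar> \<le> \<epsilon>) \<and> (\<forall>i x. \<bar>w' i x - w i x\<bar> \<le> \<epsilon>)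
     \<and> (\<forall>i j x. \<bar>A i j x - vk_metric v' w' i j x - (if i = j then \<delta> else 0)\<bar> \<le> \<delta> / 64)"
proof -
  have Hc: "0 \<le> Hc"
    using order_trans[OF abs_ge_zero A[of 1 1 0 "axis 1 1"]] by (simp add: zero_le_mult_iff)
  have Ac: "continuous_on UNIV (A i j)" for i j by (rule hoelder_continuous[OF A \<beta>(1)])
  \<comment> \<open>With this choice the form keeps the lower bound \<open>c / 2\<close> after
    \<delta> Id and the perturbation loss \<open>2 * h\<close> are subtracted.\<close>
  define \<delta> where "\<delta> = min 1 (c / 4)"
  have \<delta>: "0 < \<delta>" "\<delta> \<le> 1" "4 * \<delta> \<le> c" using c by (auto simp: \<delta>_def)
  define h where "h = \<delta> / 128"
  have h: "0 < h" "2 * h = \<delta> / 64" "4 * h \<le> \<delta>" using \<delta> by (auto simp: h_def)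
  define l where "l = (h / (6 * (Hc + 1))) powr (1/\<beta>)"
  have l: "0 < l" using h Hc by (simp add: l_def)
  have mA: "\<bar>moll l (A i j) x - A i j x\<bar> \<le> h" for i j x
  proof -
    have "\<bar>moll l (A i j) x - A i j x\<bar> \<le> 6 * Hc * l powr \<beta>"
      by (rule moll_hoelder[OF A Ac \<beta> l Hc])
    also have "l powr \<beta> = h / (6 * (Hc + 1))" using \<beta> h Hc by (simp add: l_def powr_powr)
    also have "6 * Hc * (h / (6 * (Hc + 1))) = (Hc / (Hc + 1)) * h"
      using Hc by (simp add: divide_simps)
    also have "\<dots> \<le> 1 * h" using Hc h by (intro mult_right_mono) auto
    finally show ?thesis by simp
  qed
  define L1 where "L1 = max L0 (2/l)"
  have L1: "0 < L1" "L0 \<le> L1" "2/l \<le> L1" using l by (auto simp: L1_def less_max_iff_disj)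
  define E where "E = (\<lambda>i j x. moll l (A i j) x - vk_metric v w i j x - (if i = j then \<delta> else 0))"
  define s where "s = B + (\<bar>1/2\<bar> * (2^3 * (s0 * s0)) + \<bar>1/2\<bar> * (s0 + s0)) + \<delta>"
  have Eb: "bnd 3 s L1 (E i j)" for i j
  proof -
    have "E i j = (\<lambda>x. moll l (A i j) x - ((1/2) * (dd i v x * dd j v x) + (1/2) * (dd j (w i) x + dd i (w j) x)) - (if i = j then \<delta> else 0))"
      by (auto simp: E_def vk_metric_def)
    moreover have "bnd 3 s L1 \<dots>"
      unfolding s_def using L1 l \<delta>
      by (intro bnd_minus bnd_add bnd_cmult bnd_mult bnd_mono[OF v(2)] bnd_mono[OF w(2)] bnd_const
          bnd_mono[OF moll_smooth[OF l Ac AB]] L0) auto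
    ultimately show ?thesis by simp
  qed
  have Eform: "(c / 2) * (a^2 + b^2) \<le> E 1 1 x * a^2 + 2 * E 1 2 x * a * b + E 2 2 x * b^2" for x a b
  proof -
    have "(c - 2 * h) * (a^2 + b^2) \<le> (moll l (A 1 1) x - vk_metric v w 1 1 x) * a^2
        + 2 * (moll l (A 1 2) x - vk_metric v w 1 2 x) * a * b + (moll l (A 2 2) x - vk_metric v w 2 2 x) * b^2"
      by (rule form_perturb[OF _ _ _ form[of _ _ x]]) (use mA in simp_all)
    moreover have "(c / 2 + \<delta>) * (a^2 + b^2) \<le> (c - 2 * h) * (a^2 + b^2)"
      using \<delta> h by (intro mult_right_mono) auto
    ultimately show ?thesis by (simp add: E_def algebra_simps)
  qed
  have c2: "0 < c / 2" using c by simp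
  have E1: "c / 2 \<le> E 1 1 x" for x using Eform[of 1 0 x] by simp
  have E2: "c / 2 \<le> E 2 2 x - (E 1 2 x)^2 / E 1 1 x" for x
  proof -
    \<comment> \<open>Testing the form with \<open>(-t, 1)\<close>, its minimiser over the first
      variable, yields the Schur complement.\<close>
    define t where "t = E 1 2 x / E 1 1 x"
    have E0: "E 1 1 x \<noteq> 0" using E1[of x] c by linarith
    have "c / 2 \<le> c / 2 * ((-t)^2 + 1^2)" using c by (simp add: algebra_simps)
    also have "\<dots> \<le> E 1 1 x * (-t)^2 + 2 * E 1 2 x * (-t) * 1 + E 2 2 x * 1^2" by (rule Eform)
    also have "\<dots> = E 2 2 x - (E 1 2 x)^2 / E 1 1 x"
      using E0 by (simp add: t_def power2_eq_square)
    finally show ?thesis .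
  qed
  have Es: "E 2 1 = E 1 2" by (simp add: E_def vk_metric_def As[of 2 1] mult.commute add.commute)
  obtain N and a :: "nat \<Rightarrow> real^2 \<Rightarrow> real" and z :: "nat \<Rightarrow> real^2" where
    a: "\<forall>k. Bd L1 (a k)" and z: "\<forall>k<N. \<forall>i. \<bar>z k $ i\<bar> \<le> 1" and
    sumE: "\<forall>i j x. (\<Sum>k<N. (a k x)^2 * z k $ i * z k $ j) = E i j x"
    using positive_decomposition[OF Eb Es less_imp_le[OF L1(1)] c2 E1 E2] by (elim exE conjE) (rule that)
  obtain f where f: "\<And>k. bnd 3 (f k) L1 (a k)" using a unfolding Bd_def by metis
  have s0: "0 \<le> s0" using bnd_nonneg[OF v(2)] .
  define s1 where "s1 = 1 + (\<Sum>k<N. f k)"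
  have f0: "0 \<le> f k" for k by (rule bnd_nonneg[OF f])
  have s1: "1 \<le> s1" "0 < s1" using sum_nonneg[of "{..<N}" f] f0 by (auto simp: s1_def)
  have fs: "f k \<le> s1" if "k < N" for k
    using member_le_sum[of k "{..<N}" f] that f0 by (simp add: s1_def)
  obtain C where C: "1 \<le> C" and steps: "corrugation_constant N C" using corrugation_steps by blast
  define G where "G = s1 + s0"
  have G: "s1 \<le> G" "1 \<le> G" "s0 \<le> G" using s0 s1 by (auto simp: G_def)
  \<comment> \<open>Large enough for three purposes: to be a frequency for the coefficients and for
    \<open>v\<close>, to dominate the Hessian of \<open>v\<close> through
    \<open>s0 * L0 \<le> L\<close>, and to make the displacement \<open>C * s1 * G / L\<close> at
    most \<epsilon>.\<close>
  define L where "L = L1 + s0 * L0 + C * s1 * G / \<epsilon>"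
  have CsG: "0 < C * s1 * G" using C s1 G by simp
  have sL: "0 \<le> s0 * L0" using s0 L0 by simp
  have "0 < C * s1 * G / \<epsilon>" using CsG \<epsilon> by simp
  then have L: "0 < L" "L1 \<le> L" "L0 \<le> L" "s0 * L0 \<le> L" "C * s1 * G / \<epsilon> \<le> L"
    using L1 sL unfolding L_def by linarith+
  have LE: "C * s1 * G / L \<le> \<epsilon>" using L(1,5) \<epsilon> by (simp add: field_simps)
  define K where "K = max 1 (C * s1^2 / h)"
  have K: "1 \<le> K" by (simp add: K_def)
  have Kh: "C * s1^2 / K \<le> h"
  proof -
    have "C * s1^2 / h \<le> K" by (simp add: K_def)
    then show ?thesis using h K by (simp add: field_simps)
  qed
  have aa: "\<forall>k<N. bnd 3 s1 L (a k) \<and> (\<forall>i. \<bar>z k $ i\<bar> \<le> 1)"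
    using z bnd_mono[OF f fs _ L(2)] L1 by simp
  have v': "bnd 2 (s0 * L0) L0 (dd j (dd i v))" for i j
    using v(2)[of i] by (simp add: numeral_3_eq_3 numeral_2_eq_2)
  have ad: "admissible s1 G L v"
  proof -
    have "s0 * L0 \<le> s1 * L" using L s1 mult_right_mono[of 1 s1 L] by linarith
    then show ?thesis
      unfolding admissible_def using v(1) bnd_mono[OF bnd_le[OF v(2), of 2] G(3) L0 L(3)]
        bnd_mono[OF bnd_le[OF v', of 1] _ L0 L(3)] by auto
  qed
  have wd: "\<forall>i x. w i differentiable (at x)" using w by blast
  obtain b \<omega> where R: "corrugation_result C s1 G L K N a z v w b \<omega>"
    by (rule corrugation_constantD[OF steps s1(2) G(1,2) L(1) K aa ad wd])
  note R = R[unfolded corrugation_result_def]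
  note b = R[THEN conjunct1] and \<omega> = R[THEN conjunct2, THEN conjunct1]
    and err = R[THEN conjunct2, THEN conjunct2, THEN conjunct2]
  have KL: "0 \<le> K^N * L" using K L by simp
  have "C * s1 \<le> C * s1 * G" using C s1 G by simp
  then have b': "correction (C * s1 * G) L (K^N * L) b" using correction_mono[OF b _ L(1) KL] by simp
  have Cv: "C2b s0 (s0 * L0) v" unfolding C2b_def
    using v(1) bnd_bound[OF v(2)] bnd_bound[OF v'] bnd_cont[OF v'] v(2) by (simp add: numeral_3_eq_3)
  have Cw: "C2b s0 (s0 * L0) (w i)" for i
  proof -
    have "bnd 2 (s0 * L0) L0 (dd k (dd j (w i)))" for j k
      using w(2)[of j i] by (simp add: numeral_3_eq_3 numeral_2_eq_2)
    note w' = bnd_bound[OF this] bnd_cont[OF this]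
    show ?thesis unfolding C2b_def using w(1) bnd_bound[OF w(2)] w' w(2) by (simp add: numeral_3_eq_3)
  qed
  have "\<bar>A i j x - vk_metric (\<lambda>x. v x + b x) (\<lambda>i x. w i x + \<omega> i x) i j x - (if i = j then \<delta> else 0)\<bar> \<le> \<delta> / 64" for i j x
  proof -
    have "\<bar>vk_metric (\<lambda>x. v x + b x) (\<lambda>i x. w i x + \<omega> i x) i j x - vk_metric v w i j x - E i j x\<bar> \<le> h"
      using err[rule_format, of i j x] Kh unfolding sumE[rule_format] by linarith
    then show ?thesis using mA[of i j x] unfolding E_def h(2)[symmetric] by linarith
  qed
  moreover have "\<bar>(v x + b x) - v x\<bar> \<le> \<epsilon>" "\<bar>(w i x + \<omega> i x) - w i x\<bar> \<le> \<epsilon>" for i x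
    using b' \<omega> LE unfolding correction_def by (auto intro: order_trans)
  ultimately show ?thesis
    using \<delta> C2b_add_correction[OF Cv b'] C2b_add_correction[OF Cw \<omega>[rule_format]]
    by (intro exI[of _ \<delta>] exI[of _ "s0 + C * s1 * G"] exI[of _ "s0 * L0 + C * s1 * G * (K^N * L)"]
        exI[of _ "\<lambda>x. v x + b x"] exI[of _ "\<lambda>i x. w i x + \<omega> i x"]) blast
qed

section \<open>Reduction to the whole plane\<close>

lemma uniformly_near:
  fixes g :: "real^2 \<Rightarrow> real"
  assumes g: "continuous_on UNIV g" and e: "0 < e"
  shows "\<exists>d>0. d \<le> 1 \<and> (\<forall>x\<in>cball 0 R. \<forall>y. dist y x \<le> d \<longrightarrow> \<bar>g y - g x\<bar> \<le> e)"
proof -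
  have "uniformly_continuous_on (cball 0 (R + 1)) g"
    by (intro compact_uniformly_continuous continuous_on_subset[OF g]) auto
  then obtain d where d: "0 < d" "\<And>x y. x \<in> cball 0 (R + 1) \<Longrightarrow> y \<in> cball 0 (R + 1) \<Longrightarrow> dist y x < d \<Longrightarrow> dist (g y) (g x) < e"
    using e unfolding uniformly_continuous_on_def by metis
  show ?thesis
  proof (intro exI[of _ "min 1 (d / 2)"] conjI ballI allI impI)
    fix x y :: "real^2" assume x: "x \<in> cball 0 R" and y: "dist y x \<le> min 1 (d / 2)"
    have "norm y \<le> norm x + dist y x" by (metis dist_norm norm_triangle_sub)
    then have "dist (g y) (g x) < e" using x y d(1) by (intro d(2)) auto
    then show "\<bar>g y - g x\<bar> \<le> e" by (simp add: dist_real_def)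
  qed (use d in auto)
qed

lemma moll_twice_near:
  assumes g: "continuous_on UNIV g" and l: "0 \<le> l" and b: "\<And>y. dist y x \<le> 12 * l \<Longrightarrow> \<bar>g y - c\<bar> \<le> e"
  shows "\<bar>moll l (moll l g) x - c\<bar> \<le> e"
proof (rule moll_near[OF moll_cont[OF g] l], rule moll_near[OF g l])
  fix y z assume "dist y x \<le> 6 * l" "dist z y \<le> 6 * l"
  then show "\<bar>g z - c\<bar> \<le> e" using dist_triangle[of z x y] by (intro b) linarith
qed

lemma bnd_moll_raise:
  assumes "0 < l" "bnd k s (2/l) f" shows "bnd (k + 3) s (2/l) (moll l f)"
  using bnd_box_avg[OF assms(1) bnd_box_avg[OF assms(1) bnd_box_avg[OF assms]]]
  by (simp only: moll_def numeral_3_eq_3 add_Suc_right add_0_right)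

text \<open>The approximant must have four derivatives bounded on the whole plane, while one
  mollification yields three; hence two mollifications. Clamping the coordinates of the argument
  makes \<open>F\<close> bounded without changing it near the ball. There, by locality, the
  derivatives of \<open>g\<close> are computed from \<open>f\<close>, which is differentiable, and
  not from \<open>F\<close>.\<close>

lemma smooth_approximation:
  fixes f :: "real^2 \<Rightarrow> real"
  assumes f: "\<And>x. f differentiable (at x)" "\<And>i. continuous_on UNIV (dd i f)" and e: "0 < e" and R: "0 < R"
  shows "\<exists>g s L. 0 \<le> L \<and> (\<forall>x. g differentiable (at x)) \<and> (\<forall>x. \<bar>g x\<bar> \<le> s) \<and> (\<forall>i. bnd 3 s L (dd i g))
    \<and> (\<forall>x\<in>cball 0 R. \<bar>g x - f x\<bar> \<le> e) \<and> (\<forall>x\<in>cball 0 R. \<forall>i. \<bar>dd i g x - dd i f x\<bar> \<le> e)"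
proof -
  \<comment> \<open>Two mollifications with \<open>l \<le> 1\<close> reach up to 12, and equality on
    the open ball of radius \<open>R + 1\<close> makes the derivatives agree on the closed ball of
    radius \<open>R\<close>.\<close>
  define \<rho> where "\<rho> = R + 13"
  define T :: "real^2 \<Rightarrow> real^2" where "T = (\<lambda>x. \<chi> i. max (-\<rho>) (min \<rho> (x $ i)))"
  define F where "F = (\<lambda>x. f (T x))"
  have fc: "continuous_on UNIV f" by (rule differentiable_imp_cont[OF f(1)])
  have Fc: "continuous_on UNIV F" unfolding F_def
    by (rule continuous_on_UNIV_compose[OF fc]) (auto simp: T_def intro!: continuous_intros)
  have Tn: "T x \<in> cball 0 (2 * \<rho>)" for x
  proof -
    have "norm (T x) \<le> (\<Sum>i\<in>UNIV. \<bar>T x $ i\<bar>)" by (rule norm_le_l1_cart)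
    also have "\<dots> \<le> (\<Sum>i\<in>(UNIV::2 set). \<rho>)"
      using R by (intro sum_mono) (auto simp: T_def \<rho>_def abs_le_iff)
    finally show ?thesis by simp
  qed
  have "bounded (f ` cball 0 (2 * \<rho>))"
    by (intro compact_imp_bounded compact_continuous_image continuous_on_subset[OF fc]) auto
  then obtain B where "\<forall>x\<in>cball 0 (2 * \<rho>). \<bar>f x\<bar> \<le> B" by (auto simp: bounded_iff)
  then have FB: "\<bar>F x\<bar> \<le> B" for x using Tn by (simp add: F_def)
  have FT: "F x = f x" if "norm x \<le> \<rho>" for x
  proof -
    have "-\<rho> \<le> x $ i" "x $ i \<le> \<rho>" for i
      using that component_le_norm_cart[of x i] by linarith+
    then have "T x = x" by (simp add: T_def vec_eq_iff)
    then show ?thesis by (simp add: F_def)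
  qed
  obtain d0 where d0: "0 < d0" "\<forall>x\<in>cball 0 R. \<forall>y. dist y x \<le> d0 \<longrightarrow> \<bar>f y - f x\<bar> \<le> e"
    using uniformly_near[OF fc e] by blast
  have "\<exists>d>0. \<forall>x\<in>cball 0 R. \<forall>y. dist y x \<le> d \<longrightarrow> \<bar>dd i f y - dd i f x\<bar> \<le> e" for i
    using uniformly_near[OF f(2) e] by blast
  then obtain d where d: "\<And>i. 0 < d i" "\<And>i. \<forall>x\<in>cball 0 R. \<forall>y. dist y x \<le> d i \<longrightarrow> \<bar>dd i f y - dd i f x\<bar> \<le> e"
    by metis
  define l where "l = min 1 (min d0 (min (d 1) (d 2)) / 12)"
  have l: "0 < l" "l \<le> 1" using d0 d by (auto simp: l_def)
  have "l \<le> min d0 (min (d 1) (d 2)) / 12" unfolding l_def by (rule min.cobounded2)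
  then have "12 * l \<le> min d0 (min (d 1) (d 2))" by linarith
  then have ld: "12 * l \<le> d0" "12 * l \<le> d i" for i using exhaust_2[of i] by auto
  define g where "g = moll l (moll l F)"
  have "bnd 3 B (2/l) (moll l F)" by (rule moll_smooth[OF l(1) Fc FB])
  from bnd_le[OF bnd_moll_raise[OF l(1) this], of 4] have gb: "bnd (Suc 3) B (2/l) g" by (simp add: g_def)
  have geq: "g x = moll l (moll l f) x" if "x \<in> ball 0 (R + 1)" for x
    unfolding g_def
  proof (rule moll_cong[OF moll_cont[OF Fc] moll_cont[OF fc] less_imp_le[OF l(1)]],
      rule moll_cong[OF Fc fc less_imp_le[OF l(1)]], rule FT)
    fix y z assume "dist y x \<le> 6 * l" "dist z y \<le> 6 * l"
    then have "dist z x \<le> 12" using dist_triangle[of z x y] l by linarith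
    moreover have "norm z \<le> norm x + dist z x" by (metis dist_norm norm_triangle_sub)
    ultimately show "norm z \<le> \<rho>" using that by (simp add: \<rho>_def)
  qed
  note m1 = moll_dd[where l=l, OF f]
  have c1: "continuous_on UNIV (dd i (moll l f))" for i unfolding m1(2) by (rule moll_cont[OF f(2)])
  note m2 = moll_dd[where l=l, OF m1(1) c1]
  have dg: "dd i g x = moll l (moll l (dd i f)) x" if "x \<in> ball 0 (R + 1)" for x i
    using dd_cong_open[where i=i, OF open_ball that geq] by (simp add: m2(2) m1(2))
  have near: "\<bar>g x - f x\<bar> \<le> e" "\<bar>dd i g x - dd i f x\<bar> \<le> e" if x: "x \<in> cball 0 R" for x i
  proof -
    have xb: "x \<in> ball 0 (R + 1)" using x by simp
    show "\<bar>g x - f x\<bar> \<le> e" unfolding geq[OF xb]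
      using d0(2)[rule_format, OF x] ld(1) l by (intro moll_twice_near fc) auto
    show "\<bar>dd i g x - dd i f x\<bar> \<le> e" unfolding dg[OF xb]
      using d(2)[rule_format, OF x] ld(2)[of i] l by (intro moll_twice_near f(2)) auto
  qed
  have B0: "0 \<le> B" using bnd_nonneg[OF gb] .
  have "bnd 3 (B + B * (2/l)) (2/l) (dd i g)" for i
    by (rule bnd_mono[OF bnd_dd[OF gb]]) (use B0 l in auto)
  moreover have "\<bar>g x\<bar> \<le> B + B * (2/l)" for x
    using bnd_bound[OF gb, of x] B0 l by (simp add: add_increasing2)
  ultimately show ?thesis
    using near bnd_diff[OF gb] l by (intro exI[of _ g] exI[of _ "B + B * (2/l)"] exI[of _ "2/l"]) auto
qed

lemma abs_half_add_le: "\<bar>x\<bar> \<le> p \<Longrightarrow> \<bar>y\<bar> \<le> q \<Longrightarrow> \<bar>x / 2 + y / 2\<bar> \<le> p / 2 + q / 2" for x :: real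
  by linarith

text \<open>The function is 1-Lipschitz with oscillation at most 1; interpolation between the two
  bounds gives every exponent between 0 and 1.\<close>

lemma truncated_infdist_hoelder:
  fixes X :: "'a::metric_space set"
  assumes "0 < \<beta>" "\<beta> < 1"
  shows "\<bar>min 1 (infdist x X) - min 1 (infdist y X)\<bar> \<le> dist x y powr \<beta>"
proof -
  have "\<bar>infdist x X - infdist y X\<bar> \<le> dist x y"
    using infdist_triangle_abs[of x X y] by simp
  then have 1: "\<bar>min 1 (infdist x X) - min 1 (infdist y X)\<bar> \<le> dist x y" by linarith
  have 2: "\<bar>min 1 (infdist x X) - min 1 (infdist y X)\<bar> \<le> 1"
    using infdist_nonneg[of x X] infdist_nonneg[of y X] by linarith
  show ?thesis using interpolate_powr[OF 2 1, of \<beta>] assms by simp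
qed

text \<open>Shortness is known on \<open>X\<close> only. Within distance \<open>d\<close> of
  \<open>X\<close> it persists by continuity, and \<open>k\<close>, being nonnegative, does no harm;
  farther away \<open>k\<close> is at least \<open>N * d\<close> and outweighs every other term. As
  \<open>k\<close> is Hoelder continuous and vanishes on \<open>X\<close>, the modified problem is
  of the same class, and its solution solves the original one on \<open>X\<close>.\<close>

lemma compact_strictly_short_solution:
  fixes X :: "(real^2) set" and A :: "2 \<Rightarrow> 2 \<Rightarrow> real^2 \<Rightarrow> real"
  assumes X: "compact X" "X \<noteq> {}"
    and A: "\<And>i j x y. \<bar>A i j x - A i j y\<bar> \<le> Hc * dist x y powr \<beta>" and As: "\<And>i j. A i j = A j i"
    and AB: "\<And>i j x. \<bar>A i j x\<bar> \<le> B" and \<beta>: "0 < \<beta>" "\<beta> < 1" and \<alpha>: "0 < \<alpha>" "\<alpha> < 1/7" "\<alpha> < \<beta>/2"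
    and v0: "\<And>x. v0 differentiable (at x)" "\<And>i. continuous_on UNIV (dd i v0)"
    and w0: "\<And>i x. w0 i differentiable (at x)" "\<And>i j. continuous_on UNIV (dd j (w0 i))"
    and c: "0 < c" and form: "\<And>x a b. x \<in> X \<Longrightarrow> c * (a^2 + b^2) \<le> (A 1 1 x - vk_metric v0 w0 1 1 x) * a^2
        + 2 * (A 1 2 x - vk_metric v0 w0 1 2 x) * a * b + (A 2 2 x - vk_metric v0 w0 2 2 x) * b^2"
    and \<epsilon>: "0 < \<epsilon>"
  shows "\<exists>v w. C1h \<alpha> v \<and> (\<forall>i. C1h \<alpha> (w i)) \<and> (\<exists>s. \<forall>x. \<bar>v x\<bar> \<le> s) \<and> (\<forall>i. \<exists>s. \<forall>x. \<bar>w i x\<bar> \<le> s)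
    \<and> (\<forall>x\<in>X. \<bar>v x - v0 x\<bar> \<le> \<epsilon>) \<and> (\<forall>i. \<forall>x\<in>X. \<bar>w i x - w0 i x\<bar> \<le> \<epsilon>)
    \<and> (\<forall>i j. \<forall>x\<in>X. A i j x = vk_metric v w i j x)"
proof -
  obtain R where R: "0 < R" "X \<subseteq> cball 0 R"
    using bounded_subset_ballD[OF compact_imp_bounded[OF X(1)], of 0] ball_subset_cball by blast
  have Ac: "continuous_on UNIV (A i j)" for i j by (rule hoelder_continuous[OF A \<beta>(1)])
  define D where "D = (\<lambda>i j x. A i j x - vk_metric v0 w0 i j x)"
  have Dc: "continuous_on UNIV (D i j)" for i j
    unfolding D_def vk_metric_def by (intro continuous_intros Ac v0 w0) auto
  have "\<exists>d>0. d \<le> 1 \<and> (\<forall>x\<in>cball 0 R. \<forall>y. dist y x \<le> d \<longrightarrow> \<bar>D i j y - D i j x\<bar> \<le> c / 8)" for i j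
    using c by (intro uniformly_near Dc) auto
  then obtain df where df: "\<And>i j. 0 < df i j" "\<And>i j. df i j \<le> 1"
      "\<And>i j. \<forall>x\<in>cball 0 R. \<forall>y. dist y x \<le> df i j \<longrightarrow> \<bar>D i j y - D i j x\<bar> \<le> c / 8" by metis
  define d where "d = min (min (df 1 1) (df 1 2)) (min (df 2 1) (df 2 2))"
  have d: "0 < d" "d \<le> 1" using df by (auto simp: d_def min_le_iff_disj)
  have dD: "\<bar>D i j y - D i j x\<bar> \<le> c / 8" if "x \<in> X" "dist y x \<le> d" for i j x y
  proof -
    have "d \<le> df i j" using exhaust_2[of i] exhaust_2[of j] by (auto simp: d_def)
    then show ?thesis using df(3)[of i j] that R by auto
  qed
  have "\<exists>b. \<forall>x\<in>cball 0 (R + 1). \<bar>dd i v0 x\<bar> \<le> b" for i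
  proof -
    have "bounded (dd i v0 ` cball 0 (R + 1))"
      by (intro compact_imp_bounded compact_continuous_image continuous_on_subset[OF v0(2)]) auto
    then show ?thesis by (auto simp: bounded_iff)
  qed
  then obtain bf where bf: "\<And>i. \<forall>x\<in>cball 0 (R + 1). \<bar>dd i v0 x\<bar> \<le> bf i" by metis
  define B1 where "B1 = max (bf 1) (bf 2)"
  have B1: "\<bar>dd i v0 x\<bar> \<le> B1" if "x \<in> cball 0 (R + 1)" for i x
    using bf[of 1] bf[of 2] exhaust_2[of i] that by (force simp: B1_def)
  have B1n: "0 \<le> B1" using B1[of 0 1] R by force
  \<comment> \<open>The entry \<open>\<epsilon> / 3\<close> is one of three equal shares, the others
    going to \<open>first_stage\<close> and \<open>iteration\<close>; the last entry keeps the
    change of the metric at most \<open>c / 16\<close>.\<close>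
  define e where "e = min (min 1 (\<epsilon> / 3)) (c / (16 * (B1 + 2)))"
  have e: "0 < e" "e \<le> 1" "e \<le> \<epsilon> / 3" "e * (B1 + 2) \<le> c / 16"
  proof -
    show "0 < e" using \<epsilon> c B1n by (auto simp: e_def)
    have "e \<le> min 1 (\<epsilon> / 3)" unfolding e_def by (rule min.cobounded1)
    then show "e \<le> 1" "e \<le> \<epsilon> / 3" by linarith+
    have "e \<le> c / (16 * (B1 + 2))" by (simp add: e_def)
    then show "e * (B1 + 2) \<le> c / 16" using B1n by (simp add: field_simps)
  qed
  have R1: "0 < R + 1" using R by simp
  obtain v sv Lv where v: "0 \<le> Lv" "\<And>x. v differentiable (at x)" "\<And>x. \<bar>v x\<bar> \<le> sv" "\<And>i. bnd 3 sv Lv (dd i v)"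
      "\<And>x. x \<in> cball 0 (R + 1) \<Longrightarrow> \<bar>v x - v0 x\<bar> \<le> e" "\<And>x i. x \<in> cball 0 (R + 1) \<Longrightarrow> \<bar>dd i v x - dd i v0 x\<bar> \<le> e"
    using smooth_approximation[OF v0 e(1) R1] by blast
  have "\<exists>g s L. 0 \<le> L \<and> (\<forall>x. g differentiable (at x)) \<and> (\<forall>x. \<bar>g x\<bar> \<le> s) \<and> (\<forall>i. bnd 3 s L (dd i g))
    \<and> (\<forall>x\<in>cball 0 (R+1). \<bar>g x - w0 k x\<bar> \<le> e) \<and> (\<forall>x\<in>cball 0 (R+1). \<forall>i. \<bar>dd i g x - dd i (w0 k) x\<bar> \<le> e)" for k
    by (rule smooth_approximation[OF w0 e(1) R1])
  then obtain w sw Lw where w: "\<And>k. 0 \<le> Lw k" "\<And>k x. w k differentiable (at x)" "\<And>k x. \<bar>w k x\<bar> \<le> sw k"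
      "\<And>k i. bnd 3 (sw k) (Lw k) (dd i (w k))"
      "\<And>k x. x \<in> cball 0 (R + 1) \<Longrightarrow> \<bar>w k x - w0 k x\<bar> \<le> e"
      "\<And>k x i. x \<in> cball 0 (R + 1) \<Longrightarrow> \<bar>dd i (w k) x - dd i (w0 k) x\<bar> \<le> e" by metis
  define s where "s = max sv (max (sw 1) (sw 2))"
  define L where "L = max Lv (max (Lw 1) (Lw 2))"
  have sL: "sv \<le> s" "sw k \<le> s" "Lv \<le> L" "Lw k \<le> L" "0 \<le> L" for k
    using exhaust_2[of k] v(1) by (auto simp: s_def L_def)
  have v3: "bnd 3 s L (dd i v)" and w3: "bnd 3 s L (dd i (w k))" for i k
    using bnd_mono[OF v(4) sL(1) v(1) sL(3)] bnd_mono[OF w(4) sL(2) w(1) sL(4)] by auto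
  have met: "\<bar>vk_metric v w i j x - vk_metric v0 w0 i j x\<bar> \<le> c / 16" if x: "x \<in> cball 0 (R + 1)" for i j x
  proof -
    have "\<bar>(dd i v x - dd i v0 x) * dd j v x\<bar> \<le> e * (B1 + e)"
      using v(6)[OF x, of i] v(6)[OF x, of j] B1[OF x, of j] by (intro abs_mult_le) linarith+
    moreover have "e * (B1 + e) \<le> e * (B1 + 1)" using e by (intro mult_left_mono) auto
    moreover have "\<bar>dd i v0 x * (dd j v x - dd j v0 x)\<bar> \<le> B1 * e"
      using v(6)[OF x, of j] B1[OF x, of i] by (intro abs_mult_le) auto
    moreover have "dd i v x * dd j v x - dd i v0 x * dd j v0 x
        = (dd i v x - dd i v0 x) * dd j v x + dd i v0 x * (dd j v x - dd j v0 x)" by (simp add: algebra_simps)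
    ultimately have 1: "\<bar>dd i v x * dd j v x - dd i v0 x * dd j v0 x\<bar> \<le> 2 * (e * B1) + e"
      by (simp add: distrib_left mult.commute)
    have 2: "\<bar>(dd j (w i) x + dd i (w j) x) - (dd j (w0 i) x + dd i (w0 j) x)\<bar> \<le> 2 * e"
      using w(6)[OF x, of j i] w(6)[OF x, of i j] by linarith
    have "vk_metric v w i j x - vk_metric v0 w0 i j x = (dd i v x * dd j v x - dd i v0 x * dd j v0 x) / 2
       + ((dd j (w i) x + dd i (w j) x) - (dd j (w0 i) x + dd i (w0 j) x)) / 2"
      by (simp add: vk_metric_def diff_divide_distrib add_divide_distrib)
    then have "\<bar>vk_metric v w i j x - vk_metric v0 w0 i j x\<bar> \<le> (2 * (e * B1) + e) / 2 + 2 * e / 2"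
      using abs_half_add_le[OF 1 2] by simp
    also have "\<dots> = e * B1 + e / 2 + e" by (simp add: add_divide_distrib)
    also have "\<dots> \<le> e * (B1 + 2)" using e by (simp add: distrib_left)
    finally show ?thesis using e by linarith
  qed
  have sn: "0 \<le> s" using bnd_nonneg[OF v3] .
  define B2 where "B2 = s * s / 2 + s"
  have B2: "\<bar>vk_metric v w i j x\<bar> \<le> B2" for i j x
  proof -
    have "\<bar>dd i v x * dd j v x\<bar> \<le> s * s" using bnd_bound[OF v3] by (intro abs_mult_le)
    moreover have "\<bar>dd j (w i) x + dd i (w j) x\<bar> \<le> s + s" by (intro abs_add_le bnd_bound[OF w3])
    ultimately show ?thesis
      unfolding vk_metric_def B2_def using abs_half_add_le by fastforce
  qed
  have Bn: "0 \<le> B" using order_trans[OF abs_ge_zero AB] .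
  \<comment> \<open>Then \<open>N * d\<close> is the loss \<open>2 * (B + B2)\<close> in
    \<open>form_perturb\<close> plus a remaining lower bound \<open>c\<close>; the truncation at 1
    does not interfere, as \<open>d \<le> 1\<close>.\<close>
  define N where "N = (2 * (B + B2) + c) / d"
  have B2n: "0 \<le> B2" using sn by (simp add: B2_def)
  have N: "0 \<le> N" using Bn B2n c d by (simp add: N_def)
  define k where "k = (\<lambda>x. N * min 1 (infdist x X))"
  have k0: "0 \<le> k x" "k x \<le> N" for x
    using N infdist_nonneg[of x X] mult_left_mono[of "min 1 (infdist x X)" 1 N] by (auto simp: k_def)
  define A' where "A' = (\<lambda>i j x. A i j x + (if i = j then k x else 0))"
  have form': "c / 2 * (a^2 + b^2) \<le> (A' 1 1 x - vk_metric v w 1 1 x) * a^2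
        + 2 * (A' 1 2 x - vk_metric v w 1 2 x) * a * b + (A' 2 2 x - vk_metric v w 2 2 x) * b^2" for x a b
  proof (cases "infdist x X \<le> d")
    case True
    have arith: "\<lbrakk>p \<le> q; r \<le> p; 0 \<le> u; t = q + u\<rbrakk> \<Longrightarrow> r \<le> t" for p q r u t :: real by linarith
    obtain y where y: "y \<in> X" "infdist x X = dist x y"
      using infdist_attains_inf[OF compact_imp_closed[OF X(1)] X(2)] by metis
    have yx: "dist x y \<le> d" using True y by simp
    have "norm x \<le> norm y + dist x y" by (metis dist_norm norm_triangle_sub)
    then have x: "x \<in> cball 0 (R + 1)" using y R yx d by auto
    \<comment> \<open>Moving to \<open>y\<close> costs \<open>c / 8\<close> and the smoothing
      \<open>c / 16\<close>; after the doubling in \<open>form_perturb\<close> a lower bound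
      \<open>5 * c / 8\<close> remains.\<close>
    have *: "\<bar>(A i j x - vk_metric v w i j x) - (A i j y - vk_metric v0 w0 i j y)\<bar> \<le> 3 * c / 16" for i j
      using dD[OF y(1) yx, of i j] met[OF x, of i j] unfolding D_def by linarith
    have "(c - 2 * (3 * c / 16)) * (a^2 + b^2) \<le> (A 1 1 x - vk_metric v w 1 1 x) * a^2
        + 2 * (A 1 2 x - vk_metric v w 1 2 x) * a * b + (A 2 2 x - vk_metric v w 2 2 x) * b^2"
      by (rule form_perturb[OF * * * form[OF y(1)]])
    moreover have "c / 2 * (a^2 + b^2) \<le> (c - 2 * (3 * c / 16)) * (a^2 + b^2)"
      using c by (intro mult_right_mono) auto
    moreover have "0 \<le> k x * a^2 + k x * b^2" using k0 by auto
    moreover have "(A' 1 1 x - vk_metric v w 1 1 x) * a^2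
        + 2 * (A' 1 2 x - vk_metric v w 1 2 x) * a * b + (A' 2 2 x - vk_metric v w 2 2 x) * b^2
        = ((A 1 1 x - vk_metric v w 1 1 x) * a^2
        + 2 * (A 1 2 x - vk_metric v w 1 2 x) * a * b + (A 2 2 x - vk_metric v w 2 2 x) * b^2)
        + (k x * a^2 + k x * b^2)" by (simp add: A'_def algebra_simps)
    ultimately show ?thesis by (rule arith)
  next
    case False
    have "N * d \<le> k x" unfolding k_def using False d N by (intro mult_left_mono) auto
    then have k: "2 * (B + B2) + c \<le> k x" using d by (simp add: N_def)
    have *: "\<bar>(A i j x - vk_metric v w i j x) - 0\<bar> \<le> B + B2" for i j
      using AB[of i j x] B2[of i j x] by linarith
    have "(k x - 2 * (B + B2)) * (a^2 + b^2) \<le> (A' 1 1 x - vk_metric v w 1 1 x) * a^2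
        + 2 * (A' 1 2 x - vk_metric v w 1 2 x) * a * b + (A' 2 2 x - vk_metric v w 2 2 x) * b^2"
    proof (rule form_perturb)
      show "\<bar>(A' 1 1 x - vk_metric v w 1 1 x) - k x\<bar> \<le> B + B2" "\<bar>(A' 2 2 x - vk_metric v w 2 2 x) - k x\<bar> \<le> B + B2"
        "\<bar>(A' 1 2 x - vk_metric v w 1 2 x) - 0\<bar> \<le> B + B2"
        using *[of 1 1] *[of 2 2] *[of 1 2] by (simp_all add: A'_def)
    qed (simp add: algebra_simps)
    moreover have "c / 2 * (a^2 + b^2) \<le> (k x - 2 * (B + B2)) * (a^2 + b^2)"
      using k c by (intro mult_right_mono) auto
    ultimately show ?thesis by linarith
  qed
  have A'H: "\<bar>A' i j x - A' i j y\<bar> \<le> (Hc + N) * dist x y powr \<beta>" for i j x y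
  proof -
    have "k x - k y = N * (min 1 (infdist x X) - min 1 (infdist y X))" by (simp add: k_def right_diff_distrib)
    then have kk: "\<bar>k x - k y\<bar> \<le> N * dist x y powr \<beta>"
      using truncated_infdist_hoelder[OF \<beta>, of x X y] N by (simp add: abs_mult mult_left_mono)
    have "0 \<le> N * dist x y powr \<beta>" using N by simp
    then show ?thesis using A[of i j x y] kk by (cases "i = j") (simp_all add: A'_def distrib_right)
  qed
  have A's: "A' i j = A' j i" for i j by (auto simp: A'_def As[of i j])
  have A'B: "\<bar>A' i j x\<bar> \<le> B + N" for i j x
    using AB[of i j x] k0[of x] N by (auto simp: A'_def)
  have c2: "0 < c / 2" and e3: "0 < \<epsilon> / 3" using c \<epsilon> by auto
  obtain \<delta> G M v1 w1 where 1: "0 < \<delta>" "\<delta> \<le> 1" "C2b G M v1" "\<forall>i. C2b G M (w1 i)"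
     "\<forall>x. \<bar>v1 x - v x\<bar> \<le> \<epsilon> / 3" "\<forall>i x. \<bar>w1 i x - w i x\<bar> \<le> \<epsilon> / 3"
     "\<forall>i j x. \<bar>A' i j x - vk_metric v1 w1 i j x - (if i = j then \<delta> else 0)\<bar> \<le> \<delta> / 64"
    using first_stage[OF A'H A's A'B \<beta> v(2) v3 w(2) w3 sL(5) c2 form' e3]
    by (elim exE conjE) (rule that)
  obtain v2 w2 where 2: "C1h \<alpha> v2" "\<forall>i. C1h \<alpha> (w2 i)" "\<forall>x. \<bar>v2 x - v1 x\<bar> \<le> \<epsilon> / 3" "\<forall>i x. \<bar>w2 i x - w1 i x\<bar> \<le> \<epsilon> / 3"
     "\<forall>i j x. A' i j x = vk_metric v2 w2 i j x"
    using iteration[OF A'H A's \<beta> \<alpha> 1(3) 1(4)[rule_format] 1(1,2) 1(7)[rule_format] e3]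
    by (elim exE conjE) (rule that)
  have AA: "A i j x = A' i j x" if "x \<in> X" for i j x
    using that by (simp add: A'_def k_def)
  have vv: "\<bar>v2 x - v x\<bar> \<le> 2 * \<epsilon> / 3" and ww: "\<bar>w2 i x - w i x\<bar> \<le> 2 * \<epsilon> / 3" for i x
    using 1(5)[rule_format, of x] 2(3)[rule_format, of x] 1(6)[rule_format, of i x] 2(4)[rule_format, of i x] by argo+
  have X1: "x \<in> cball 0 (R + 1)" if "x \<in> X" for x using that R by force
  show ?thesis
  proof (intro exI[of _ v2] exI[of _ w2] conjI ballI allI 2(1) 2(2)[rule_format])
    show "\<exists>s. \<forall>x. \<bar>v2 x\<bar> \<le> s" 
    proof (intro exI allI)
      show "\<bar>v2 x\<bar> \<le> 2 * \<epsilon> / 3 + sv" for x using vv[of x] v(3)[of x] by argo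
    qed
    show "\<exists>s. \<forall>x. \<bar>w2 i x\<bar> \<le> s" for i
    proof (intro exI allI)
      show "\<bar>w2 i x\<bar> \<le> 2 * \<epsilon> / 3 + sw i" for x using ww[of i x] w(3)[of i x] by argo
    qed
    show "\<bar>v2 x - v0 x\<bar> \<le> \<epsilon>" if "x \<in> X" for x using vv[of x] v(5)[OF X1[OF that]] e(3) by argo
    show "\<bar>w2 i x - w0 i x\<bar> \<le> \<epsilon>" if "x \<in> X" for i x using ww[of i x] w(5)[OF X1[OF that], of i] e(3) by argo
    show "A i j x = vk_metric v2 w2 i j x" if "x \<in> X" for i j x using AA[OF that] 2(5) by metis
  qed
qed

section \<open>Passage between components and vector or matrix fields\<close>

lemma component_derivative:
  fixes W :: "real^2 \<Rightarrow> real^2"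
  assumes "W differentiable (at x)"
  shows "(\<lambda>x. W x $ i) differentiable (at x)" "dd j (\<lambda>x. W x $ i) x = frechet_derivative W (at x) (axis j 1) $ i"
proof -
  have "((\<lambda>x. W x $ i) has_derivative (\<lambda>h. frechet_derivative W (at x) h $ i)) (at x)"
    using assms by (intro bounded_linear.has_derivative[OF bounded_linear_vec_nth]) (simp add: frechet_derivative_works)
  then show "(\<lambda>x. W x $ i) differentiable (at x)" "dd j (\<lambda>x. W x $ i) x = frechet_derivative W (at x) (axis j 1) $ i"
    using dd_eqI by (auto simp: differentiable_def)
qed

lemma vec_lambda_differentiable:
  fixes w :: "2 \<Rightarrow> real^2 \<Rightarrow> real"
  assumes "\<And>i. w i differentiable (at x)"
  shows "(\<lambda>x. (\<chi> i. w i x)::real^2) differentiable (at x)"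
proof -
  have "(\<lambda>x. w 1 x *\<^sub>R (axis 1 1 :: real^2) + w 2 x *\<^sub>R axis 2 1) differentiable (at x)"
    using assms by (intro differentiable_add differentiable_scaleR differentiable_const)
  moreover have "(\<lambda>x. w 1 x *\<^sub>R (axis 1 1 :: real^2) + w 2 x *\<^sub>R axis 2 1) = (\<lambda>x. (\<chi> i. w i x)::real^2)"
    by (auto simp: vec_eq_iff forall_2 axis_def)
  ultimately show ?thesis by simp
qed

lemma Basis_real2: "e \<in> (Basis :: (real^2) set) \<Longrightarrow> \<exists>i. e = axis i 1"
  by (auto simp: Basis_vec_def)

lemma Ck1_D:
  fixes F :: "real^2 \<Rightarrow> 'b::real_normed_vector"
  assumes "F \<in> Ck 1"
  shows "F differentiable (at x)" "continuous_on UNIV (\<lambda>x. frechet_derivative F (at x) (axis i 1))"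
  using assms by (auto simp: axis_in_Basis_iff)

lemma Ckh1_scalar:
  assumes f: "C1h \<alpha> f" and s: "\<And>x. \<bar>f x\<bar> \<le> s"
  shows "f \<in> Ckh 1 \<alpha>"
proof -
  have "(\<lambda>x. frechet_derivative f (at x) e) \<in> Ckh 0 \<alpha>" if eB: "e \<in> Basis" for e
  proof -
    obtain i where "e = axis i 1" using Basis_real2[OF eB] by blast
    then have "(\<lambda>x. frechet_derivative f (at x) e) = dd i f" by (auto simp: dd_def)
    moreover have "bounded (range (dd i f))" using f unfolding C1h_def bounded_iff by (metis rangeE real_norm_def)
    ultimately show ?thesis using f by (auto simp: C1h_def)
  qed
  moreover have "bounded (range f)" using s by (auto simp: bounded_iff)
  ultimately show ?thesis using f by (auto simp: C1h_def)
qed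

lemma norm_le_components2: "norm (x :: real^2) \<le> \<bar>x $ 1\<bar> + \<bar>x $ 2\<bar>"
  using norm_le_l1_cart[of x] by (simp add: sum_2)

lemma Ckh1_vector:
  fixes w :: "2 \<Rightarrow> real^2 \<Rightarrow> real"
  assumes f: "\<And>i. C1h \<alpha> (w i)" and s: "\<And>i x. \<bar>w i x\<bar> \<le> s i"
  shows "(\<lambda>x. (\<chi> i. w i x)::real^2) \<in> Ckh 1 \<alpha>" (is "?W \<in> _")
proof -
  have d: "?W differentiable (at x)" for x
    using f by (intro vec_lambda_differentiable) (auto simp: C1h_def)
  have c: "frechet_derivative ?W (at x) (axis j 1) $ i = dd j (w i) x" for i j x
    using component_derivative(2)[OF d, of j i x] by simp
  have "(\<lambda>x. frechet_derivative ?W (at x) e) \<in> Ckh 0 \<alpha>" if eB: "e \<in> Basis" for e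
  proof -
    obtain j where e: "e = axis j 1" using Basis_real2[OF eB] by blast
    obtain G where G: "\<And>k i x. \<bar>dd i (w k) x\<bar> \<le> G k" using f unfolding C1h_def by metis
    obtain C where C: "\<And>k i x y. \<bar>dd i (w k) x - dd i (w k) y\<bar> \<le> C k i * dist x y powr \<alpha>"
      using f unfolding C1h_def by metis
    have "norm (frechet_derivative ?W (at x) e) \<le> G 1 + G 2" for x
      using norm_le_components2[of "frechet_derivative ?W (at x) e"] G[of j 1 x] G[of j 2 x] by (simp add: e c)
    moreover have "norm (frechet_derivative ?W (at x) e - frechet_derivative ?W (at y) e) \<le> (C 1 j + C 2 j) * dist x y powr \<alpha>" for x y
      using norm_le_components2[of "frechet_derivative ?W (at x) e - frechet_derivative ?W (at y) e"]
        C[of j 1 x y] C[of j 2 x y] by (simp add: e c distrib_right)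
    ultimately show ?thesis by (auto simp: bounded_iff)
  qed
  moreover have "norm (?W x) \<le> s 1 + s 2" for x
    using norm_le_components2[of "?W x"] s[of 1 x] s[of 2 x] by simp
  then have "bounded (range ?W)" by (auto simp: bounded_iff)
  ultimately show ?thesis using d by auto
qed

lemma C1h_Ck1:
  assumes "C1h \<alpha> f" "0 < \<alpha>" shows "f \<in> Ck 1"
proof -
  have "continuous_on UNIV (dd i f)" for i
    using assms unfolding C1h_def by (metis hoelder_continuous)
  then have "continuous_on UNIV (\<lambda>x. frechet_derivative f (at x) e)" if eB: "e \<in> Basis" for e
    using Basis_real2[OF eB] by (auto simp: dd_def[abs_def])
  then show ?thesis using assms(1) by (auto simp: C1h_def)
qed

lemma C1h_vector_Ck1:
  fixes w :: "2 \<Rightarrow> real^2 \<Rightarrow> real"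
  assumes f: "\<And>i. C1h \<alpha> (w i)" and \<alpha>: "0 < \<alpha>"
  shows "(\<lambda>x. (\<chi> i. w i x)::real^2) \<in> Ck 1" (is "?W \<in> _")
proof -
  have d: "?W differentiable (at x)" for x
    using f by (intro vec_lambda_differentiable) (auto simp: C1h_def)
  have c: "(\<lambda>x. frechet_derivative ?W (at x) (axis j 1)) = (\<lambda>x. \<chi> i. dd j (w i) x)" for j
    using component_derivative(2)[OF d, of j] by (auto simp: vec_eq_iff)
  have "continuous_on UNIV (dd j (w i))" for i j
    using f \<alpha> unfolding C1h_def by (metis hoelder_continuous)
  then have "continuous_on UNIV (\<lambda>x. frechet_derivative ?W (at x) e)" if eB: "e \<in> Basis" for e
  proof -
    obtain j where e: "e = axis j 1" using Basis_real2[OF eB] by blast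
    show ?thesis unfolding e c by (intro continuous_on_vec_lambda) fact
  qed
  then show ?thesis using d by auto
qed

lemma vk_matrix_entry:
  fixes W :: "real^2 \<Rightarrow> real^2"
  assumes "W differentiable (at x)"
  shows "((1/2) *\<^sub>R (gradient f x \<otimes>\<^sub>v gradient f x) + sym_part (jacobian W (at x))) $ i $ j
    = vk_metric f (\<lambda>i x. W x $ i) i j x"
  by (simp add: tensor_def gradient_def sym_part_def transpose_def jacobian_def matrix_def vk_metric_def
      component_derivative(2)[OF assms]) (simp add: dd_def)

text \<open>The order on matrices speaks of nonzero vectors only, hence the separate case
  \<open>a = b = 0\<close>; symmetry merges the two off-diagonal terms.\<close>

lemma form_of_matrix_gt:
  fixes A S :: "real^2^2"
  assumes "A - S \<succ> c *\<^sub>R mat 1" "S $ 2 $ 1 = S $ 1 $ 2" "A $ 2 $ 1 = A $ 1 $ 2"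
  shows "c * (a^2 + b^2) \<le> (A $ 1 $ 1 - S $ 1 $ 1) * a^2 + 2 * (A $ 1 $ 2 - S $ 1 $ 2) * a * b
    + (A $ 2 $ 2 - S $ 2 $ 2) * b^2"
proof (cases "a = 0 \<and> b = 0")
  case False
  define \<xi> :: "real^2" where "\<xi> = vector [a, b]"
  have x: "\<xi> $ 1 = a" "\<xi> $ 2 = b" by (auto simp: \<xi>_def)
  then have "\<xi> \<noteq> 0" using False by (metis zero_index)
  then have "0 < \<xi> \<bullet> ((A - S - c *\<^sub>R mat 1) *v \<xi>)"
    using assms by (auto simp: matrix_gt_def pos_definite_def)
  also have "\<dots> = (A $ 1 $ 1 - S $ 1 $ 1) * a^2 + 2 * (A $ 1 $ 2 - S $ 1 $ 2) * a * b
    + (A $ 2 $ 2 - S $ 2 $ 2) * b^2 - c * (a^2 + b^2)"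
    by (simp add: inner_vec_def sum_2 matrix_vector_mult_def x mat_def assms(2,3) power2_eq_square algebra_simps)
  finally show ?thesis by simp
qed simp

theorem theorem1p2:
  fixes \<Omega> :: "(real^2) set"
    and v0 :: "real^2 \<Rightarrow> real"
    and w0 :: "real^2 \<Rightarrow> real^2"
    and A0 :: "real^2 \<Rightarrow> real^2^2"
    and \<alpha> \<beta> :: real
  assumes "open \<Omega>" and "connected \<Omega>" and "\<Omega> \<noteq> {}" and "bounded \<Omega>"
    and "0 < \<beta>" and "\<beta> < 1"
    and "v0 \<in> Ck_bar 1 \<Omega>"
    and "w0 \<in> Ck_bar 1 \<Omega>"
    and "A0 \<in> Ckh_bar 0 \<beta> \<Omega>" and "\<forall>x\<in>closure \<Omega>. sym_matrix (A0 x)"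
    and "\<exists>c0>0. \<forall>x\<in>closure \<Omega>.
           A0 x - ((1/2) *\<^sub>R (gradient_bar \<Omega> v0 x \<otimes>\<^sub>v gradient_bar \<Omega> v0 x)
                   + sym_part (jacobian_bar \<Omega> w0 x)) \<succ> c0 *\<^sub>R mat 1"
    and "0 < \<alpha>" and "\<alpha> < min (1/7) (\<beta>/2)"
  shows "\<exists>(v :: nat \<Rightarrow> real^2 \<Rightarrow> real) (w :: nat \<Rightarrow> real^2 \<Rightarrow> real^2).
           (\<forall>n. v n \<in> Ckh_bar 1 \<alpha> \<Omega> \<and> w n \<in> Ckh_bar 1 \<alpha> \<Omega>) \<and>
           uniform_limit (closure \<Omega>) v v0 sequentially \<and>
           uniform_limit (closure \<Omega>) w w0 sequentially \<and>
           (\<forall>n. \<forall>x\<in>closure \<Omega>.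
             A0 x = (1/2) *\<^sub>R (gradient_bar \<Omega> (v n) x \<otimes>\<^sub>v gradient_bar \<Omega> (v n) x)
                    + sym_part (jacobian_bar \<Omega> (w n) x))"
proof -
  note [simp del] = Ck.simps Ckh.simps One_nat_def
  let ?X = "closure \<Omega>"
  have X: "compact ?X" "?X \<noteq> {}" using assms(3,4) by (auto simp: compact_closure)
  obtain F where F: "F \<in> Ck 1" "\<forall>x\<in>?X. v0 x = F x" using assms(7) by (auto simp: restrictions_def)
  obtain W where W: "W \<in> Ck 1" "\<forall>x\<in>?X. w0 x = W x" using assms(8) by (auto simp: restrictions_def)
  obtain A1 where A1: "A1 \<in> Ckh 0 \<beta>" "\<forall>x\<in>?X. A0 x = A1 x" using assms(9) by (auto simp: restrictions_def)
  obtain c0 where c0: "0 < c0" and pos: "\<forall>x\<in>?X. A0 x - ((1/2) *\<^sub>R (gradient_bar \<Omega> v0 x \<otimes>\<^sub>v gradient_bar \<Omega> v0 x)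
                   + sym_part (jacobian_bar \<Omega> w0 x)) \<succ> c0 *\<^sub>R mat 1" using assms(11) by blast
  \<comment> \<open>The extension \<open>A1\<close> may fail to be symmetric off the closure, so its
    upper off-diagonal entry is used twice. On the closure nothing changes.\<close>
  define A where "A = (\<lambda>i j x. if i = j then A1 x $ i $ i else A1 x $ 1 $ 2)"
  obtain B where B: "\<And>x. norm (A1 x) \<le> B" using A1(1) by (auto simp: Ckh.simps bounded_iff)
  obtain Hc where Hc: "\<And>x y. norm (A1 x - A1 y) \<le> Hc * dist x y powr \<beta>" using A1(1) by (auto simp: Ckh.simps)
  have entry: "\<bar>M $ i $ j\<bar> \<le> norm M" for M :: "real^2^2" and i j
    using component_le_norm_cart[of "M $ i" j] Finite_Cartesian_Product.norm_nth_le[of M i] by linarith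
  have AH: "\<bar>A i j x - A i j y\<bar> \<le> Hc * dist x y powr \<beta>" for i j x y
    using entry[of "A1 x - A1 y" i i] entry[of "A1 x - A1 y" 1 2] Hc[of x y] by (auto simp: A_def)
  have AB: "\<bar>A i j x\<bar> \<le> B" for i j x
    using entry[of "A1 x" i i] entry[of "A1 x" 1 2] B[of x] by (auto simp: A_def)
  have As: "A i j = A j i" for i j by (auto simp: A_def)
  have A0sym: "A0 x $ 2 $ 1 = A0 x $ 1 $ 2" if "x \<in> ?X" for x
  proof -
    have "transpose (A0 x) $ 2 $ 1 = A0 x $ 2 $ 1" using assms(10) that by (simp add: sym_matrix_def)
    then show ?thesis by (simp add: transpose_def)
  qed
  have AA: "A i j x = A0 x $ i $ j" if "x \<in> ?X" for i j x
    using A0sym[OF that] A1(2) that exhaust_2[of i] exhaust_2[of j] by (auto simp: A_def)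
  define w where "w = (\<lambda>i x. W x $ i)"
  have Fd: "F differentiable (at x)" "continuous_on UNIV (dd i F)" for x i
    using Ck1_D[OF F(1)] by (auto simp: dd_def[abs_def])
  have wd: "w i differentiable (at x)" "continuous_on UNIV (dd j (w i))" for x i j
  proof -
    show "w i differentiable (at x)" unfolding w_def by (rule component_derivative(1)[OF Ck1_D(1)[OF W(1)]])
    have "dd j (w i) = (\<lambda>x. frechet_derivative W (at x) (axis j 1) $ i)"
      unfolding w_def using component_derivative(2)[OF Ck1_D(1)[OF W(1)]] by auto
    then show "continuous_on UNIV (dd j (w i))"
      using Ck1_D(2)[OF W(1)] by (simp add: continuous_on_component)
  qed
  have form: "c0 * (a^2 + b^2) \<le> (A 1 1 x - vk_metric F w 1 1 x) * a^2
        + 2 * (A 1 2 x - vk_metric F w 1 2 x) * a * b + (A 2 2 x - vk_metric F w 2 2 x) * b^2"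
    if x: "x \<in> ?X" for x a b
  proof -
    define S where "S = (1/2) *\<^sub>R (gradient F x \<otimes>\<^sub>v gradient F x) + sym_part (jacobian W (at x))"
    have "A0 x - S \<succ> c0 *\<^sub>R mat 1"
      using pos[rule_format, OF x]
      unfolding gradient_bar_extension[OF assms(1) x F] jacobian_bar_extension[OF assms(1) x W] S_def .
    moreover have S: "S $ i $ j = vk_metric F w i j x" for i j
      unfolding S_def w_def by (rule vk_matrix_entry[OF Ck1_D(1)[OF W(1)]])
    moreover have "vk_metric F w 2 1 x = vk_metric F w 1 2 x" by (simp add: vk_metric_def mult.commute add.commute)
    ultimately show ?thesis using form_of_matrix_gt[of "A0 x" S c0 a b] A0sym[OF x] by (simp add: AA[OF x])
  qed
  have \<alpha>: "\<alpha> < 1/7" "\<alpha> < \<beta>/2" using assms(13) by auto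
  \<comment> \<open>One full construction for every \<open>n\<close>, with tolerance
    \<open>1 / (n + 1)\<close>, which makes the convergence uniform.\<close>
  have "\<exists>v u. C1h \<alpha> v \<and> (\<forall>i. C1h \<alpha> (u i)) \<and> (\<exists>s. \<forall>x. \<bar>v x\<bar> \<le> s) \<and> (\<forall>i. \<exists>s. \<forall>x. \<bar>u i x\<bar> \<le> s)
    \<and> (\<forall>x\<in>?X. \<bar>v x - F x\<bar> \<le> inverse (real (Suc n))) \<and> (\<forall>i. \<forall>x\<in>?X. \<bar>u i x - w i x\<bar> \<le> inverse (real (Suc n)))
    \<and> (\<forall>i j. \<forall>x\<in>?X. A i j x = vk_metric v u i j x)" for n
    by (rule compact_strictly_short_solution[OF X AH As AB assms(5,6,12) \<alpha> Fd wd c0 form]) auto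
  then obtain v u where v: "\<And>n. C1h \<alpha> (v n)" "\<And>n i. C1h \<alpha> (u n i)" "\<And>n. \<exists>s. \<forall>x. \<bar>v n x\<bar> \<le> s"
      "\<And>n i. \<exists>s. \<forall>x. \<bar>u n i x\<bar> \<le> s" "\<And>n x. x \<in> ?X \<Longrightarrow> \<bar>v n x - F x\<bar> \<le> inverse (real (Suc n))"
      "\<And>n i x. x \<in> ?X \<Longrightarrow> \<bar>u n i x - w i x\<bar> \<le> inverse (real (Suc n))"
      "\<And>n i j x. x \<in> ?X \<Longrightarrow> A i j x = vk_metric (v n) (u n) i j x"
    by metis
  define U where "U = (\<lambda>n x. (\<chi> i. u n i x) :: real^2)"
  have Uu: "(\<lambda>i x. U n x $ i) = u n" for n by (simp add: U_def)
  have vk: "v n \<in> Ckh 1 \<alpha>" for n using v(3)[of n] Ckh1_scalar[OF v(1)] by blast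
  have Uk: "U n \<in> Ckh 1 \<alpha>" for n
  proof -
    obtain s where "\<And>i x. \<bar>u n i x\<bar> \<le> s i" using v(4)[of n] by metis
    then show ?thesis unfolding U_def by (rule Ckh1_vector[OF v(2)])
  qed
  have vc: "v n \<in> Ck 1" and Uc: "U n \<in> Ck 1" for n
    using C1h_Ck1[OF v(1) assms(12)] C1h_vector_Ck1[OF v(2) assms(12)] by (auto simp: U_def)
  show ?thesis
  proof (intro exI[of _ v] exI[of _ U] conjI allI ballI)
    show "v n \<in> Ckh_bar 1 \<alpha> \<Omega>" "U n \<in> Ckh_bar 1 \<alpha> \<Omega>" for n
      using vk Uk by (auto simp: restrictions_def)
    show "uniform_limit ?X v v0 sequentially"
    proof (rule uniform_limitI)
      fix e :: real assume "0 < e"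
      then have "\<forall>\<^sub>F n in sequentially. inverse (real (Suc n)) < e"
        using LIMSEQ_inverse_real_of_nat by (rule order_tendstoD(2)[rotated])
      then show "\<forall>\<^sub>F n in sequentially. \<forall>x\<in>?X. dist (v n x) (v0 x) < e"
      proof eventually_elim
        case (elim n)
        show ?case
        proof
          fix x assume x: "x \<in> ?X"
          show "dist (v n x) (v0 x) < e" using v(5)[OF x, of n] elim F(2) x by (simp add: dist_real_def)
        qed
      qed
    qed
    show "uniform_limit ?X U w0 sequentially"
    proof (rule uniform_limitI)
      fix e :: real assume "0 < e"
      then have "0 < e / 2" by simp
      then have "\<forall>\<^sub>F n in sequentially. inverse (real (Suc n)) < e / 2"
        using LIMSEQ_inverse_real_of_nat by (rule order_tendstoD(2)[rotated])
      then show "\<forall>\<^sub>F n in sequentially. \<forall>x\<in>?X. dist (U n x) (w0 x) < e"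
      proof eventually_elim
        case (elim n)
        show ?case
        proof
          fix x assume x: "x \<in> ?X"
          have "dist (U n x) (w0 x) \<le> \<bar>u n 1 x - w 1 x\<bar> + \<bar>u n 2 x - w 2 x\<bar>"
            using norm_le_components2[of "U n x - w0 x"] x W(2) by (simp add: dist_norm U_def w_def)
          then show "dist (U n x) (w0 x) < e" using v(6)[OF x, of n 1] v(6)[OF x, of n 2] elim by linarith
        qed
      qed
    qed
    fix n x assume x: "x \<in> ?X"
    have e: "((1/2) *\<^sub>R (gradient (v n) x \<otimes>\<^sub>v gradient (v n) x) + sym_part (jacobian (U n) (at x))) $ i $ j = A0 x $ i $ j" for i j
      unfolding vk_matrix_entry[OF Ck1_D(1)[OF Uc]] Uu using v(7)[OF x] AA[OF x] by simp
    \<comment> \<open>The solutions are regular on the whole plane, so they serve as their own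
      extensions.\<close>
    have gb: "gradient_bar \<Omega> (v n) x = gradient (v n) x"
      by (rule gradient_bar_extension[OF assms(1) x vc]) simp
    have jb: "jacobian_bar \<Omega> (U n) x = jacobian (U n) (at x)"
      by (rule jacobian_bar_extension[OF assms(1) x Uc]) simp
    show "A0 x = (1/2) *\<^sub>R (gradient_bar \<Omega> (v n) x \<otimes>\<^sub>v gradient_bar \<Omega> (v n) x)
                    + sym_part (jacobian_bar \<Omega> (U n) x)"
      unfolding gb jb by (intro vec_eq_iff[THEN iffD2] allI) (rule e[symmetric])
  qed
qed

end
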